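(* Let $\Omega\subset\mathbb{R}^2$ be an open, bounded, connected set with $\sigma(\Omega)=\Omega$, where $\sigma(x_1,x_2)=(x_1,-x_2)$, and let $a^-=(a^-_1,0)$, $a^+=(a^+_1,0)$ with $a^-_1<a^+_1$. Then, with the operators defined in the context, the operator $H_{NDN}$ is unitarily equivalent to $H_{A,\Sigma}$ and the operator $H_{DND}$ is unitarily equivalent to $H_{A,a\Sigma}$.
   Context: Let $\mathcal R=\{x_2=0\}\subset\mathbb{R}^2$, $\mathcal I_c=[a_1^-,a_1^+]\times\{0\}$, and let $$A(x)=-\frac12\frac{(-x_2,\,x_1-a^-_1)}{(x_1-a^-_1)^2+x_2^2}+\frac12\frac{(-x_2,\,x_1-a^+_1)}{(x_1-a^+_1)^2+x_2^2}$$ on $\mathbb{R}^2\setminus\{a^-,a^+\}$. $H_A$ is the Friedrichs extension in the complex Hilbert space $L^2(\Omega)=L^2(\Omega,\mathbb{C})$ of $(i\nabla+A)^2$ acting on $C^\infty_c(\Omega\setminus\{a^-,a^+\})$ (complex-valued). Let $\psi:\mathbb{R}^2\setminus\{a^-,a^+\}\to\mathbb{C}$ be the unique smooth function with $|\psi|\equiv1$, $\nabla\psi=2i\psi A$, and $\psi(x_1,0)=-1$ for all $x_1\in(a^-_1,a^+_1)$. Define the antilinear operators $Ku=\psi\overline u$ and $\Sigma^cu=\overline u\circ\sigma$ on $L^2(\Omega)$. Let $L^2_K(\Omega)=\{u\in L^2(\Omega):Ku=u\}$, which is a real Hilbert space with the restriction of the $L^2$ scalar product, and let $L^2_{K,\Sigma}(\Omega)=L^2_K(\Omega)\cap\ker(\Sigma^c-\mathrm{Id})$,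 $L^2_{K,a\Sigma}(\Omega)=L^2_K(\Omega)\cap\ker(\Sigma^c+\mathrm{Id})$. The operator $H_A$ commutes with $K$ and $\Sigma^c$ (which preserve its domain), and it leaves these two real Hilbert spaces invariant; $H_{A,\Sigma}$ and $H_{A,a\Sigma}$ denote the restrictions of $H_A$ to $L^2_{K,\Sigma}(\Omega)$ and $L^2_{K,a\Sigma}(\Omega)$ respectively. Let $L^2_{\mathbb{R},\sigma}(\Omega)$ be the real Hilbert space of real-valued $u\in L^2(\Omega)$ with $u\circ\sigma=u$. $H_{NDN}$ is the operator on $L^2_{\mathbb{R},\sigma}(\Omega)$ which is the Friedrichs extension of $-\Delta$ acting on $\{u\in C^\infty_c(\Omega\setminus\mathcal I_c,\mathbb{R}):u\circ\sigma=u\}$; its domain is $\{u\in H^1_0(\Omega\setminus\mathcal I_c):u\circ\sigma=u,\ \Delta|_{\Omega\setminus\mathcal I_c}u\in L^2_{\mathbb{R},\sigma}(\Omega)\}$ (distributional Laplacian in $\Omega\setminus\mathcal I_c$). $H_{DND}$ is the operator on $L^2_{\mathbb{R},\sigma}(\Omega)$ defined in the same way with $\Omega\setminus\mathcal I_c$ replaced by $\Omega\setminus(\mathcal R\setminus\mathcal I_c)$, i.e. the Friedrichs extension of $-\Delta$ acting on $\{u\in C^\infty_c(\Omega\setminus(\mathcal R\setminus\mathcal I_c),\mathbb{R}):u\circ\sigma=u\}$, with domain $\{u\in H^1_0(\Omega\setminus(\mathcal R\setminus\mathcal I_c)):u\circ\sigma=u,\ \Delta|_{\Omega\setminus(\mathcal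 R\setminus\mathcal I_c)}u\in L^2_{\mathbb{R},\sigma}(\Omega)\}$. Unitary equivalence of operators on real Hilbert spaces means conjugacy by a surjective linear isometry mapping one domain onto the other. *)

theory Defs
  imports "HOL-Analysis.Analysis"
begin

type_synonym plane = "real \<times> real"

section \<open>Smooth functions and test functions\<close>

primrec differentiable_order_on ::
  "nat \<Rightarrow> 'a::real_normed_vector set \<Rightarrow> ('a \<Rightarrow> 'b::real_normed_vector) \<Rightarrow> bool" where
  "differentiable_order_on 0 S f \<longleftrightarrow> continuous_on S f"
| "differentiable_order_on (Suc n) S f \<longleftrightarrow>
     (\<forall>x\<in>S. f differentiable (at x)) \<and>
     (\<forall>v. differentiable_order_on n S (\<lambda>x. frechet_derivative f (at x) v))"

text \<open>Meaningful for open \<open>S\<close> only (the derivatives are taken in the ambient space).\<close>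
definition smooth_on ::
  "'a::real_normed_vector set \<Rightarrow> ('a \<Rightarrow> 'b::real_normed_vector) \<Rightarrow> bool" where
  "smooth_on S f \<longleftrightarrow> (\<forall>n. differentiable_order_on n S f)"

text \<open>Elements of \<open>C\<^sub>c\<^sup>\<infinity>(S)\<close> are identified with their extension by zero to the
  whole plane; \<open>S\<close> need not be open.\<close>
definition test_functions :: "plane set \<Rightarrow> (plane \<Rightarrow> complex) set" where
  "test_functions S =
     {u. smooth_on UNIV u \<and> compact (closure {x. u x \<noteq> 0}) \<and> closure {x. u x \<noteq> 0} \<subseteq> S}"

definition partial_deriv :: "plane \<Rightarrow> (plane \<Rightarrow> complex) \<Rightarrow> plane \<Rightarrow> complex" where
  "partial_deriv e u x = frechet_derivative u (at x) e"

definition laplace :: "(plane \<Rightarrow> complex) \<Rightarrow> plane \<Rightarrow> complex" where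
  "laplace u x = (\<Sum>e\<in>Basis. partial_deriv e (partial_deriv e u) x)"

section \<open>The complex space \<open>L\<^sup>2\<close> of the plane\<close>

definition square_int :: "(plane \<Rightarrow> complex) \<Rightarrow> bool" where
  "square_int f \<longleftrightarrow> f \<in> borel_measurable lborel \<and> integrable lborel (\<lambda>x. (cmod (f x))\<^sup>2)"

lemma square_int_mult:
  assumes "square_int f" "square_int g"
  shows "integrable lborel (\<lambda>x. f x * cnj (g x))"
proof (rule Bochner_Integration.integrable_bound)
  show "integrable lborel (\<lambda>x. (cmod (f x))\<^sup>2 + (cmod (g x))\<^sup>2)"
    using assms by (simp add: square_int_def)
  show "(\<lambda>x. f x * cnj (g x)) \<in> borel_measurable lborel"
    using assms borel_measurable_continuous_onI[OF continuous_on_cnj[OF continuous_on_id]]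
    by (auto simp: square_int_def intro!: borel_measurable_times
        intro: measurable_compose[where f = g])
  have "cmod a * cmod b \<le> (cmod a)\<^sup>2 + (cmod b)\<^sup>2" for a b
  proof -
    have "0 \<le> (cmod a - cmod b)\<^sup>2" by simp
    also have "\<dots> = (cmod a)\<^sup>2 + (cmod b)\<^sup>2 - 2 * (cmod a * cmod b)"
      by (simp add: power2_diff)
    finally show ?thesis
      using mult_nonneg_nonneg[OF norm_ge_zero[of a] norm_ge_zero[of b]] by linarith
  qed
  then show "AE x in lborel. norm (f x * cnj (g x)) \<le> norm ((cmod (f x))\<^sup>2 + (cmod (g x))\<^sup>2)"
    by (simp add: norm_mult)
qed

lemma square_int_zero: "square_int (\<lambda>x. 0)"
  by (simp add: square_int_def)

lemma square_int_scaleR: "square_int f \<Longrightarrow> square_int (\<lambda>x. r *\<^sub>R f x)"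
  by (auto simp: square_int_def power_mult_distrib)

lemma square_int_add:
  assumes "square_int f" "square_int g"
  shows "square_int (\<lambda>x. f x + g x)"
  unfolding square_int_def
proof
  show meas: "(\<lambda>x. f x + g x) \<in> borel_measurable lborel"
    using assms by (auto simp: square_int_def)
  show "integrable lborel (\<lambda>x. (cmod (f x + g x))\<^sup>2)"
  proof (rule Bochner_Integration.integrable_bound)
    show "integrable lborel (\<lambda>x. 2 * (cmod (f x))\<^sup>2 + 2 * (cmod (g x))\<^sup>2)"
      using assms by (simp add: square_int_def)
    show "(\<lambda>x. (cmod (f x + g x))\<^sup>2) \<in> borel_measurable lborel"
      using meas by measurable
    have "(cmod (a + b))\<^sup>2 \<le> 2 * (cmod a)\<^sup>2 + 2 * (cmod b)\<^sup>2" for a b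
    proof -
      have "(cmod (a + b))\<^sup>2 \<le> (cmod a + cmod b)\<^sup>2"
        by (simp add: norm_triangle_ineq power_mono)
      moreover have "0 \<le> (cmod a - cmod b)\<^sup>2" by simp
      ultimately show ?thesis by (simp add: power2_diff power2_sum)
    qed
    then show "AE x in lborel. norm ((cmod (f x + g x))\<^sup>2)
        \<le> norm (2 * (cmod (f x))\<^sup>2 + 2 * (cmod (g x))\<^sup>2)"
      by simp
  qed
qed

definition square_int_rel :: "(plane \<Rightarrow> complex) \<Rightarrow> (plane \<Rightarrow> complex) \<Rightarrow> bool" where
  "square_int_rel f g \<longleftrightarrow> square_int f \<and> square_int g \<and> (AE x in lborel. f x = g x)"

lemma part_equivp_square_int_rel: "part_equivp square_int_rel"
proof (rule part_equivpI)
  show "\<exists>f. square_int_rel f f"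
    using square_int_zero by (auto simp: square_int_rel_def)
  show "symp square_int_rel"
    by (auto intro!: sympI simp: square_int_rel_def)
  show "transp square_int_rel"
    by (auto intro!: transpI simp: square_int_rel_def)
qed

text \<open>\<open>L\<^sup>2(\<real>\<^sup>2, \<complex>)\<close>: classes, modulo equality almost everywhere, of Borel functions;
  each class of Lebesgue measurable functions has a Borel representative.\<close>
quotient_type l2 = "plane \<Rightarrow> complex" / partial: square_int_rel
  by (rule part_equivp_square_int_rel)

text \<open>The class of a square integrable function (an unspecified element for any other function).\<close>
abbreviation l2_of :: "(plane \<Rightarrow> complex) \<Rightarrow> l2" where
  "l2_of \<equiv> abs_l2"

text \<open>Some representative; used only where its choice does not matter.\<close>
abbreviation l2_rep :: "l2 \<Rightarrow> plane \<Rightarrow> complex" where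
  "l2_rep \<equiv> rep_l2"

lemma l2_rep_square_int: "square_int (l2_rep u)"
  using Quotient3_rep_reflp[OF Quotient3_l2] by (simp add: square_int_rel_def)

lemma l2_of_rep: "l2_of (l2_rep u) = u"
  by (rule Quotient3_abs_rep[OF Quotient3_l2])

lemma l2_rep_of: "square_int f \<Longrightarrow> AE x in lborel. l2_rep (l2_of f) x = f x"
  using rep_abs_rsp_left[OF Quotient3_l2, of f f] by (simp add: square_int_rel_def)

lift_definition cinner :: "l2 \<Rightarrow> l2 \<Rightarrow> complex" is
  "\<lambda>f g. integral\<^sup>L lborel (\<lambda>x. f x * cnj (g x))"
proof -
  fix f f' g g' assume "square_int_rel f f'" "square_int_rel g g'"
  then have s: "square_int f" "square_int f'" "square_int g" "square_int g'"
    and ae: "AE x in lborel. f x = f' x" "AE x in lborel. g x = g' x"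
    by (auto simp: square_int_rel_def)
  show "integral\<^sup>L lborel (\<lambda>x. f x * cnj (g x)) = integral\<^sup>L lborel (\<lambda>x. f' x * cnj (g' x))"
    using square_int_mult[OF s(1) s(3)] square_int_mult[OF s(2) s(4)] ae
    by (intro integral_cong_AE) auto
qed

instantiation l2 :: real_inner
begin

lift_definition zero_l2 :: l2 is "\<lambda>x. 0"
  by (simp add: square_int_rel_def square_int_zero)

lift_definition plus_l2 :: "l2 \<Rightarrow> l2 \<Rightarrow> l2" is "\<lambda>f g x. f x + g x"
  by (auto simp: square_int_rel_def square_int_add)

lift_definition scaleR_l2 :: "real \<Rightarrow> l2 \<Rightarrow> l2" is "\<lambda>r f x. r *\<^sub>R f x"
  by (auto simp: square_int_rel_def square_int_scaleR[unfolded scaleR_conv_of_real] scaleR_conv_of_real)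

definition uminus_l2 :: "l2 \<Rightarrow> l2" where "- u = (- 1) *\<^sub>R u" for u :: l2
definition minus_l2 :: "l2 \<Rightarrow> l2 \<Rightarrow> l2" where "u - v = u + (- v)" for u v :: l2
definition inner_l2 :: "l2 \<Rightarrow> l2 \<Rightarrow> real" where "inner u v = Re (cinner u v)" for u v :: l2
definition norm_l2 :: "l2 \<Rightarrow> real" where "norm u = sqrt (inner u u)" for u :: l2
definition sgn_l2 :: "l2 \<Rightarrow> l2" where "sgn u = inverse (norm u) *\<^sub>R u" for u :: l2
definition dist_l2 :: "l2 \<Rightarrow> l2 \<Rightarrow> real" where "dist u v = norm (u - v)" for u v :: l2
definition uniformity_l2 :: "(l2 \<times> l2) filter" where
  "uniformity_l2 = (INF e\<in>{0<..}. principal {(x, y). dist x y < e})"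
definition open_l2 :: "l2 set \<Rightarrow> bool" where
  "open_l2 U \<longleftrightarrow> (\<forall>x\<in>U. eventually (\<lambda>(x', y). x' = x \<longrightarrow> y \<in> U) uniformity)"

instance
proof
  fix u v w :: l2 and r s :: real
  show "u + v + w = u + (v + w)"
    by transfer (auto simp: square_int_rel_def add.assoc intro!: square_int_add)
  show "u + v = v + u"
    by transfer (auto simp: square_int_rel_def add.commute intro!: square_int_add)
  show "0 + u = u"
    by transfer (auto simp: square_int_rel_def)
  show "- u + u = 0"
    unfolding uminus_l2_def
    by transfer (auto simp: square_int_rel_def square_int_zero)
  show "u - v = u + - v"
    by (rule minus_l2_def)
  show "r *\<^sub>R (u + v) = r *\<^sub>R u + r *\<^sub>R v"
    by transfer (auto simp: square_int_rel_def scaleR_add_right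
        intro!: square_int_add square_int_scaleR)
  show "(r + s) *\<^sub>R u = r *\<^sub>R u + s *\<^sub>R u"
    by transfer (auto simp: square_int_rel_def scaleR_add_left
        intro!: square_int_add square_int_scaleR)
  show "r *\<^sub>R s *\<^sub>R u = (r * s) *\<^sub>R u"
    by transfer (auto simp: square_int_rel_def
        intro!: square_int_scaleR square_int_scaleR[of _ "r * s", simplified])
  show "1 *\<^sub>R u = u"
    by transfer (auto simp: square_int_rel_def)
  show "sgn u = inverse (norm u) *\<^sub>R u"
    by (rule sgn_l2_def)
  show "dist u v = norm (u - v)"
    by (rule dist_l2_def)
  show "uniformity = (INF e\<in>{0<..}. principal {(x, y). dist (x::l2) y < e})"
    by (rule uniformity_l2_def)
  show "open U \<longleftrightarrow> (\<forall>x\<in>U. eventually (\<lambda>(x', y). x' = x \<longrightarrow> y \<in> U) uniformity)" for U :: "l2 set"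
    by (rule open_l2_def)
  have cnj: "Re (integral\<^sup>L lborel (\<lambda>x. f x * cnj (g x))) = integral\<^sup>L lborel (\<lambda>x. f x \<bullet> g x)"
    if "square_int f" "square_int g" for f g
  proof -
    have "Re (integral\<^sup>L lborel (\<lambda>x. f x * cnj (g x)))
        = integral\<^sup>L lborel (\<lambda>x. Re (f x * cnj (g x)))"
      by (rule integral_bounded_linear[OF bounded_linear_Re square_int_mult[OF that], symmetric])
    also have "(\<lambda>x. Re (f x * cnj (g x))) = (\<lambda>x. f x \<bullet> g x)"
      by (auto simp: inner_complex_def)
    finally show ?thesis .
  qed
  have int: "integrable lborel (\<lambda>x. f x \<bullet> g x)" if "square_int f" "square_int g" for f g
  proof -
    have "integrable lborel (\<lambda>x. Re (f x * cnj (g x)))"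
      by (rule integrable_bounded_linear[OF bounded_linear_Re square_int_mult[OF that]])
    also have "(\<lambda>x. Re (f x * cnj (g x))) = (\<lambda>x. f x \<bullet> g x)"
      by (auto simp: inner_complex_def)
    finally show ?thesis .
  qed
  have in1: "inner u v = integral\<^sup>L lborel (\<lambda>x. l2_rep u x \<bullet> l2_rep v x)" for u v
    unfolding inner_l2_def cinner_def map_fun_def
    by (simp add: cnj l2_rep_square_int)
  have in2: "inner (l2_of f) (l2_of g) = integral\<^sup>L lborel (\<lambda>x. f x \<bullet> g x)"
    if "square_int f" "square_int g" for f g
  proof -
    have "cinner (l2_of f) (l2_of g) = integral\<^sup>L lborel (\<lambda>x. f x * cnj (g x))"
      by (rule cinner.abs_eq) (use that in \<open>auto simp: square_int_rel_def\<close>)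
    then show ?thesis by (simp add: inner_l2_def cnj that)
  qed
  have add: "l2_of (l2_rep u) + l2_of (l2_rep v) = l2_of (\<lambda>x. l2_rep u x + l2_rep v x)" for u v
    by (rule plus_l2.abs_eq) (auto simp: square_int_rel_def l2_rep_square_int)
  have scale: "r *\<^sub>R l2_of (l2_rep u) = l2_of (\<lambda>x. r *\<^sub>R l2_rep u x)" for r u
    by (rule scaleR_l2.abs_eq) (auto simp: square_int_rel_def l2_rep_square_int)
  show "inner u v = inner v u"
    by (simp add: in1 inner_commute)
  show "inner (u + v) w = inner u w + inner v w"
  proof -
    have "inner (u + v) w = inner (l2_of (\<lambda>x. l2_rep u x + l2_rep v x)) (l2_of (l2_rep w))"
      using add[of u v] by (simp only: l2_of_rep)
    also have "\<dots> = inner u w + inner v w"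
      by (subst in2) (simp_all add: square_int_add l2_rep_square_int in1 inner_add_left int)
    finally show ?thesis .
  qed
  show "inner (r *\<^sub>R u) v = r * inner u v"
  proof -
    have "inner (r *\<^sub>R u) v = inner (l2_of (\<lambda>x. r *\<^sub>R l2_rep u x)) (l2_of (l2_rep v))"
      using scale[of r u] by (simp only: l2_of_rep)
    also have "\<dots> = r * inner u v"
      by (subst in2[OF square_int_scaleR]) (simp_all add: l2_rep_square_int in1)
    finally show ?thesis .
  qed
  show "0 \<le> inner u u"
    by (simp add: in1)
  show "inner u u = 0 \<longleftrightarrow> u = 0"
  proof
    assume "inner u u = 0"
    then have "AE x in lborel. l2_rep u x = 0"
      using integral_nonneg_eq_0_iff_AE[OF int[OF l2_rep_square_int l2_rep_square_int, of u u]]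
      by (simp add: in1)
    then have "square_int_rel (l2_rep u) (\<lambda>x. 0)"
      by (simp add: square_int_rel_def l2_rep_square_int square_int_zero)
    then have "l2_of (l2_rep u) = l2_of (\<lambda>x. 0)"
      by (rule Quotient3_rel_abs[OF Quotient3_l2])
    then show "u = 0"
      by (simp add: l2_of_rep zero_l2_def)
  next
    assume "u = 0"
    then have "u = l2_of (\<lambda>x. 0)" by (simp add: zero_l2_def)
    then show "inner u u = 0"
      by (simp add: in2 square_int_zero)
  qed
  show "norm u = sqrt (inner u u)"
    by (rule norm_l2_def)
qed

end

text \<open>\<open>L\<^sup>2(\<Omega>, \<complex>)\<close>, embedded in \<open>L\<^sup>2(\<real>\<^sup>2, \<complex>)\<close> by extension by zero.\<close>
definition l2_on :: "plane set \<Rightarrow> l2 set" where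
  "l2_on \<Omega> = {u. AE x in lborel. x \<notin> \<Omega> \<longrightarrow> l2_rep u x = 0}"

section \<open>Unbounded operators, given by their graphs\<close>

text \<open>The completion of the domain of \<open>T\<close> for the energy norm
  \<open>\<parallel>u\<parallel>\<^sup>2 + \<langle>u, T u\<rangle>\<close>, realised inside \<open>L\<^sup>2\<close>.\<close>
definition form_domain :: "(l2 \<times> l2) set \<Rightarrow> l2 set" where
  "form_domain T = {u. \<exists>s g. (\<forall>n::nat. (s n, g n) \<in> T) \<and> s \<longlonglongrightarrow> u \<and>
     (\<forall>\<epsilon>>0. \<exists>N. \<forall>m\<ge>N. \<forall>n\<ge>N. cmod (cinner (s m - s n) (g m - g n)) < \<epsilon>)}"

definition adjoint_in :: "l2 set \<Rightarrow> (l2 \<times> l2) set \<Rightarrow> (l2 \<times> l2) set" where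
  "adjoint_in H T = {(u, f). u \<in> H \<and> f \<in> H \<and> (\<forall>(v, g)\<in>T. cinner u g = cinner f v)}"

text \<open>The Friedrichs extension, in the Hilbert space \<open>H\<close>, of a densely defined symmetric
  nonnegative operator \<open>T\<close>: the restriction of the adjoint of \<open>T\<close> to the form domain.
  Here \<open>H\<close> is either a complex subspace of \<open>L\<^sup>2(\<real>\<^sup>2, \<complex>)\<close>, or a real subspace on which
  \<open>cinner\<close> is real-valued, i.e. a real Hilbert space for the restriction of \<open>cinner\<close>.\<close>
definition friedrichs :: "l2 set \<Rightarrow> (l2 \<times> l2) set \<Rightarrow> (l2 \<times> l2) set" where
  "friedrichs H T = {(u, f) \<in> adjoint_in H T. u \<in> form_domain T}"

definition restrict_op :: "(l2 \<times> l2) set \<Rightarrow> l2 set \<Rightarrow> (l2 \<times> l2) set" where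
  "restrict_op T L = {(u, f) \<in> T. u \<in> L}"

text \<open>For (single-valued) graphs \<open>T\<close> and \<open>S\<close>, equality of \<open>S\<close> with the image of \<open>T\<close> says
  that \<open>U\<close> maps the domain of \<open>T\<close> onto that of \<open>S\<close> and that \<open>S (U u) = U (T u)\<close>.\<close>
definition unitarily_equivalent ::
  "'a::real_normed_vector set \<Rightarrow> ('a \<times> 'a) set \<Rightarrow>
   'b::real_normed_vector set \<Rightarrow> ('b \<times> 'b) set \<Rightarrow> bool" where
  "unitarily_equivalent H T L S \<longleftrightarrow>
     (\<exists>U. (\<forall>u\<in>H. \<forall>v\<in>H. U (u + v) = U u + U v) \<and>
          (\<forall>u\<in>H. \<forall>r. U (r *\<^sub>R u) = r *\<^sub>R U u) \<and>
          (\<forall>u\<in>H. norm (U u) = norm u) \<and>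
          U ` H = L \<and>
          map_prod U U ` T = S)"

section \<open>The Aharonov--Bohm operator\<close>

definition reflect :: "plane \<Rightarrow> plane" where
  "reflect x = (fst x, - snd x)"

text \<open>The poles are \<open>(a, 0)\<close> and \<open>(b, 0)\<close>. The values produced by division by zero at
  the poles play no role.\<close>
definition AB_potential :: "real \<Rightarrow> real \<Rightarrow> plane \<Rightarrow> plane" where
  "AB_potential a b x =
     - (1/2) *\<^sub>R ((1 / ((fst x - a)\<^sup>2 + (snd x)\<^sup>2)) *\<^sub>R (- snd x, fst x - a))
     + (1/2) *\<^sub>R ((1 / ((fst x - b)\<^sup>2 + (snd x)\<^sup>2)) *\<^sub>R (- snd x, fst x - b))"

definition magnetic_deriv ::
  "(plane \<Rightarrow> plane) \<Rightarrow> plane \<Rightarrow> (plane \<Rightarrow> complex) \<Rightarrow> plane \<Rightarrow> complex" where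
  "magnetic_deriv A e u x = \<i> * partial_deriv e u x + of_real (A x \<bullet> e) * u x"

text \<open>\<open>(i\<nabla> + A)\<^sup>2 u\<close>\<close>
definition magnetic_laplace ::
  "(plane \<Rightarrow> plane) \<Rightarrow> (plane \<Rightarrow> complex) \<Rightarrow> plane \<Rightarrow> complex" where
  "magnetic_laplace A u x = (\<Sum>e\<in>Basis. magnetic_deriv A e (magnetic_deriv A e u) x)"

definition H_A :: "plane set \<Rightarrow> real \<Rightarrow> real \<Rightarrow> (l2 \<times> l2) set" where
  "H_A \<Omega> a b = friedrichs (l2_on \<Omega>)
     {(l2_of u, l2_of (magnetic_laplace (AB_potential a b) u)) | u.
        u \<in> test_functions (\<Omega> - {(a, 0), (b, 0)})}"

definition gauge_function :: "real \<Rightarrow> real \<Rightarrow> (plane \<Rightarrow> complex) \<Rightarrow> bool" where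
  "gauge_function a b \<psi> \<longleftrightarrow>
     smooth_on (- {(a, 0), (b, 0)}) \<psi> \<and>
     (\<forall>x\<in>- {(a, 0), (b, 0)}. cmod (\<psi> x) = 1) \<and>
     (\<forall>x\<in>- {(a, 0), (b, 0)}.
        (\<psi> has_derivative (\<lambda>h. 2 * \<i> * \<psi> x * of_real (AB_potential a b x \<bullet> h))) (at x)) \<and>
     (\<forall>t. a < t \<and> t < b \<longrightarrow> \<psi> (t, 0) = - 1)"

definition K_op :: "(plane \<Rightarrow> complex) \<Rightarrow> l2 \<Rightarrow> l2" where
  "K_op \<psi> u = l2_of (\<lambda>x. \<psi> x * cnj (l2_rep u x))"

definition Sigma_op :: "l2 \<Rightarrow> l2" where
  "Sigma_op u = l2_of (\<lambda>x. cnj (l2_rep u (reflect x)))"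

definition l2_K :: "plane set \<Rightarrow> (plane \<Rightarrow> complex) \<Rightarrow> l2 set" where
  "l2_K \<Omega> \<psi> = {u \<in> l2_on \<Omega>. K_op \<psi> u = u}"

definition l2_K_Sigma :: "plane set \<Rightarrow> (plane \<Rightarrow> complex) \<Rightarrow> l2 set" where
  "l2_K_Sigma \<Omega> \<psi> = {u \<in> l2_K \<Omega> \<psi>. Sigma_op u = u}"

definition l2_K_aSigma :: "plane set \<Rightarrow> (plane \<Rightarrow> complex) \<Rightarrow> l2 set" where
  "l2_K_aSigma \<Omega> \<psi> = {u \<in> l2_K \<Omega> \<psi>. Sigma_op u = - u}"

definition H_A_Sigma ::
  "plane set \<Rightarrow> real \<Rightarrow> real \<Rightarrow> (plane \<Rightarrow> complex) \<Rightarrow> (l2 \<times> l2) set" where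
  "H_A_Sigma \<Omega> a b \<psi> = restrict_op (H_A \<Omega> a b) (l2_K_Sigma \<Omega> \<psi>)"

definition H_A_aSigma ::
  "plane set \<Rightarrow> real \<Rightarrow> real \<Rightarrow> (plane \<Rightarrow> complex) \<Rightarrow> (l2 \<times> l2) set" where
  "H_A_aSigma \<Omega> a b \<psi> = restrict_op (H_A \<Omega> a b) (l2_K_aSigma \<Omega> \<psi>)"

section \<open>Laplacians with mixed boundary conditions on the symmetry axis\<close>

definition real_axis :: "plane set" where
  "real_axis = {x. snd x = 0}"

definition slit :: "real \<Rightarrow> real \<Rightarrow> plane set" where
  "slit a b = {a..b} \<times> {0}"

text \<open>Real-valued functions are complex-valued functions with vanishing imaginary part.\<close>
definition l2_real_sym :: "plane set \<Rightarrow> l2 set" where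
  "l2_real_sym \<Omega> = {u \<in> l2_on \<Omega>. (AE x in lborel. l2_rep u x \<in> \<real>) \<and>
     (AE x in lborel. l2_rep u (reflect x) = l2_rep u x)}"

definition sym_laplacian :: "plane set \<Rightarrow> plane set \<Rightarrow> (l2 \<times> l2) set" where
  "sym_laplacian \<Omega> D = friedrichs (l2_real_sym \<Omega>)
     {(l2_of u, l2_of (\<lambda>x. - laplace u x)) | u.
        u \<in> test_functions (\<Omega> - D) \<and> range u \<subseteq> \<real> \<and> u \<circ> reflect = u}"

definition H_NDN :: "plane set \<Rightarrow> real \<Rightarrow> real \<Rightarrow> (l2 \<times> l2) set" where
  "H_NDN \<Omega> a b = sym_laplacian \<Omega> (slit a b)"

text \<open>The set \<open>\<Omega> - (real_axis - slit a b)\<close> is not open at a pole that lies in \<open>\<Omega>\<close>.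
  A test function on it vanishes on \<open>real_axis - slit a b\<close>, hence, by continuity, at both poles.\<close>
definition H_DND :: "plane set \<Rightarrow> real \<Rightarrow> real \<Rightarrow> (l2 \<times> l2) set" where
  "H_DND \<Omega> a b = sym_laplacian \<Omega> (real_axis - slit a b)"

end

theory Submission
  imports Defs
begin

text \<open>Write \<open>u = \<phi> v\<close> with \<open>\<phi>\<^sup>2 = \<psi>\<close>. Where \<open>\<phi>\<close> is smooth, \<open>\<nabla>\<phi> = i \<phi> A\<close>, so that \<open>(i\<nabla> + A) (\<phi> v) = i \<phi> \<nabla>v\<close>; moreover
  \<open>K u = u\<close> says that \<open>v\<close> is real. The two symmetry classes correspond to the two natural branch cuts of
  \<open>\<phi>\<close>, the slit between the poles (where \<open>\<psi> = -1\<close>) and the rest of the axis (where \<open>\<psi> = 1\<close>): with the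
  right cut, \<open>\<Sigma>\<^sup>c u = \<plusminus>u\<close> says that \<open>v\<close> is even, and the two symmetries together force \<open>u\<close> to vanish on
  the cut.

  Multiplication by \<open>\<phi>\<close> maps the even real test functions supported off the cut into the core of the
  symmetric part of \<open>H\<^sub>A\<close>. The image is smaller than that core, but it is dense in it for the energy
  norm: a symmetric test function \<open>w\<close> vanishes on the cut, hence its truncation near the zero set,
  \<open>w g(\<bar>w\<bar>\<^sup>2/\<epsilon>\<^sup>2)\<close> with a flat function \<open>g\<close>, is supported off the cut, and the energy of the error is
  \<open>O(\<epsilon>)\<close>. Symmetric nonnegative operators, one of which is form dense in the other, have
  the same Friedrichs extension. The same truncation disposes of the test functions for the
  Dirichlet condition outside the slit whose support touches the poles.\<close>

section \<open>Calculus of smooth functions\<close>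

text \<open>The operators \<open>K_op\<close> and \<open>Sigma_op\<close> are antilinear, hence
  linear only over the reals. Friedrichs extensions are therefore treated in real inner product
  spaces, with the real part of \<open>cinner\<close>; for the complex operator the imaginary part
  of the adjoint relation is recovered by testing with \<open>i w\<close> as well as with
  \<open>w\<close>.

  No form domain is identified with a Sobolev space and no trace theorem enters: all comparisons are
  between graphs on smooth compactly supported functions. The obstacle is that a symmetric function
  \<open>w\<close> vanishes on the cut while its support may cross it, so that dividing by \<phi>
  does not give a test function. Cutting off by the size of \<open>w\<close>, not by the distance to
  the cut, avoids any estimate on the geometry of the cut or of the nodal set. It works because a
  fixed point of \<open>K_op\<close> is locally a phase times a real function: a factor depending on
  \<open>|w|\<close> then merely rescales the magnetic derivative of \<open>w\<close>, and an
  integration by parts against a small function bounds the rest.\<close>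

lemma differentiable_order_on_cong:
  fixes f g :: "'a::real_normed_vector \<Rightarrow> 'b::real_normed_vector"
  assumes "open S" "\<And>x. x \<in> S \<Longrightarrow> f x = g x" "differentiable_order_on n S f"
  shows "differentiable_order_on n S g"
  using assms(2,3)
proof (induction n arbitrary: f g)
  case 0
  then show ?case by (metis differentiable_order_on.simps(1) continuous_on_cong)
next
  case (Suc n)
  have D: "(f has_derivative D) (at x) \<longleftrightarrow> (g has_derivative D) (at x)" if "x \<in> S" for x D
    using has_derivative_transform_within_open[OF _ assms(1) that] Suc.prems(1) by metis
  then have "frechet_derivative f (at x) = frechet_derivative g (at x)" if "x \<in> S" for x
    using that by (simp add: frechet_derivative_def)
  moreover have "g differentiable (at x)" if "x \<in> S" for x
    using that Suc.prems(2) D by (auto simp: differentiable_def)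
  ultimately show ?case
    using Suc.prems(2) Suc.IH[of "\<lambda>x. frechet_derivative f (at x) v"
        "\<lambda>x. frechet_derivative g (at x) v" for v] by auto
qed

lemma differentiable_order_on_SucD:
  "differentiable_order_on (Suc n) S f \<Longrightarrow> differentiable_order_on n S f"
proof (induction n arbitrary: f)
  case 0
  then show ?case
    using differentiable_at_withinI[of f _ S]
    by (simp add: differentiable_imp_continuous_on differentiable_on_def)
next
  case (Suc n)
  then show ?case by (metis differentiable_order_on.simps(2))
qed

text \<open>The definition speaks of \<open>frechet_derivative\<close>, which is a chosen
  derivative; by uniqueness any explicit derivative may take its place on the open set
  \<open>S\<close>.\<close>

lemma differentiable_order_on_SucI:
  assumes "open S" "\<And>x. x \<in> S \<Longrightarrow> (f has_derivative f' x) (at x)"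
    and "\<And>v. differentiable_order_on n S (\<lambda>x. f' x v)"
  shows "differentiable_order_on (Suc n) S f"
proof -
  have "frechet_derivative f (at x) = f' x" if "x \<in> S" for x
    using frechet_derivative_at[OF assms(2)[OF that]] by simp
  then have "differentiable_order_on n S (\<lambda>x. frechet_derivative f (at x) v)" for v
    using differentiable_order_on_cong[OF assms(1) _ assms(3)[of v]] by simp
  then show ?thesis
    using assms(2) by (auto simp: differentiable_def)
qed

lemma differentiable_order_on_SucE:
  assumes "differentiable_order_on (Suc n) S f"
  obtains f' where "\<And>x. x \<in> S \<Longrightarrow> (f has_derivative f' x) (at x)"
    and "\<And>v. differentiable_order_on n S (\<lambda>x. f' x v)"
proof (rule that[of "\<lambda>x. frechet_derivative f (at x)"])
qed (use assms in \<open>simp_all add: frechet_derivative_works\<close>)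

lemma differentiable_order_on_compose_linear:
  assumes "open S" "bounded_linear L" "differentiable_order_on n S f"
  shows "differentiable_order_on n S (\<lambda>x. L (f x))"
  using assms(3)
proof (induction n arbitrary: f)
  case 0
  then show ?case
    using bounded_linear.continuous_on[OF assms(2)] by simp
next
  case (Suc n)
  from Suc.prems obtain f' where f': "\<And>x. x \<in> S \<Longrightarrow> (f has_derivative f' x) (at x)"
    "\<And>v. differentiable_order_on n S (\<lambda>x. f' x v)"
    by (rule differentiable_order_on_SucE) blast
  show ?case
    by (rule differentiable_order_on_SucI[OF assms(1)])
      (rule bounded_linear.has_derivative[OF assms(2) f'(1)], simp, rule Suc.IH[OF f'(2)])
qed

lemma differentiable_order_on_add:
  assumes "open S" "differentiable_order_on n S f" "differentiable_order_on n S g"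
  shows "differentiable_order_on n S (\<lambda>x. f x + g x)"
  using assms(2,3)
proof (induction n arbitrary: f g)
  case 0
  then show ?case by (simp add: continuous_on_add)
next
  case (Suc n)
  from Suc.prems(1) obtain f' where f': "\<And>x. x \<in> S \<Longrightarrow> (f has_derivative f' x) (at x)"
    "\<And>v. differentiable_order_on n S (\<lambda>x. f' x v)"
    by (rule differentiable_order_on_SucE) blast
  from Suc.prems(2) obtain g' where g': "\<And>x. x \<in> S \<Longrightarrow> (g has_derivative g' x) (at x)"
    "\<And>v. differentiable_order_on n S (\<lambda>x. g' x v)"
    by (rule differentiable_order_on_SucE) blast
  show ?case
    by (rule differentiable_order_on_SucI[OF assms(1)])
      (rule has_derivative_add[OF f'(1) g'(1)], simp, simp, rule Suc.IH[OF f'(2) g'(2)])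
qed

text \<open>By the Leibniz rule the derivative is a sum of two terms of the same shape, each with
  one factor differentiated and the other one regarded as being of lower order.\<close>

lemma differentiable_order_on_bilinear:
  assumes "open S" "bounded_bilinear p"
    and "differentiable_order_on n S f" "differentiable_order_on n S g"
  shows "differentiable_order_on n S (\<lambda>x. p (f x) (g x))"
  using assms(3,4)
proof (induction n arbitrary: f g)
  case 0
  then show ?case using bounded_bilinear.continuous_on[OF assms(2)] by auto
next
  case (Suc n)
  from Suc.prems(1) obtain f' where f': "\<And>x. x \<in> S \<Longrightarrow> (f has_derivative f' x) (at x)"
    "\<And>v. differentiable_order_on n S (\<lambda>x. f' x v)"
    by (rule differentiable_order_on_SucE) blast
  from Suc.prems(2) obtain g' where g': "\<And>x. x \<in> S \<Longrightarrow> (g has_derivative g' x) (at x)"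
    "\<And>v. differentiable_order_on n S (\<lambda>x. g' x v)"
    by (rule differentiable_order_on_SucE) blast
  show ?case
    by (rule differentiable_order_on_SucI[OF assms(1)],
        rule bounded_bilinear.FDERIV[OF assms(2) f'(1) g'(1)], simp, simp,
        rule differentiable_order_on_add[OF assms(1)],
        rule Suc.IH[OF differentiable_order_on_SucD[OF Suc.prems(1)] g'(2)],
        rule Suc.IH[OF f'(2) differentiable_order_on_SucD[OF Suc.prems(2)]])
qed

lemma differentiable_order_on_const: "differentiable_order_on n S (\<lambda>x. c)"
proof (induction n arbitrary: c)
  case (Suc n)
  have "frechet_derivative (\<lambda>x. c) (at x) = (\<lambda>v. 0)" for x :: 'a
    by (metis frechet_derivative_at has_derivative_const)
  then show ?case using Suc by simp
qed simp

section \<open>Closure properties of smooth functions\<close>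

lemma smooth_on_cong:
  assumes "smooth_on S f" "open S" "\<And>x. x \<in> S \<Longrightarrow> f x = g x"
  shows "smooth_on S g"
  using assms unfolding smooth_on_def by (metis differentiable_order_on_cong)

lemma smooth_on_const: "smooth_on S (\<lambda>x. c)"
  by (simp add: smooth_on_def differentiable_order_on_const)

lemma smooth_on_add:
  "open S \<Longrightarrow> smooth_on S f \<Longrightarrow> smooth_on S g \<Longrightarrow> smooth_on S (\<lambda>x. f x + g x)"
  by (simp add: smooth_on_def differentiable_order_on_add)

lemma smooth_on_compose_linear:
  "open S \<Longrightarrow> bounded_linear L \<Longrightarrow> smooth_on S f \<Longrightarrow> smooth_on S (\<lambda>x. L (f x))"
  by (simp add: smooth_on_def differentiable_order_on_compose_linear)

lemma smooth_on_bilinear: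
  "open S \<Longrightarrow> bounded_bilinear p \<Longrightarrow> smooth_on S f \<Longrightarrow> smooth_on S g \<Longrightarrow>
    smooth_on S (\<lambda>x. p (f x) (g x))"
  by (simp add: smooth_on_def differentiable_order_on_bilinear)

lemmas smooth_on_mult = smooth_on_bilinear[OF _ bounded_bilinear_mult]
lemmas smooth_on_scaleR = smooth_on_bilinear[OF _ bounded_bilinear_scaleR]
lemmas smooth_on_of_real = smooth_on_compose_linear[OF _ bounded_linear_of_real]
lemmas smooth_on_cnj = smooth_on_compose_linear[OF _ bounded_linear_cnj]

lemma smooth_on_differentiable: "smooth_on S f \<Longrightarrow> x \<in> S \<Longrightarrow> f differentiable (at x)"
  unfolding smooth_on_def by (metis differentiable_order_on.simps(2))

lemma smooth_on_continuous_on: "smooth_on S f \<Longrightarrow> continuous_on S f"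
  unfolding smooth_on_def by (metis differentiable_order_on.simps(1))

lemma smooth_on_frechet_derivative:
  "smooth_on S f \<Longrightarrow> smooth_on S (\<lambda>x. frechet_derivative f (at x) v)"
  unfolding smooth_on_def by (metis differentiable_order_on.simps(2))

lemma smooth_on_subset: "smooth_on S f \<Longrightarrow> T \<subseteq> S \<Longrightarrow> smooth_on T f"
proof -
  have "differentiable_order_on n S f \<Longrightarrow> T \<subseteq> S \<Longrightarrow> differentiable_order_on n T f" for n
    by (induction n arbitrary: f) (auto intro: continuous_on_subset)
  then show "smooth_on S f \<Longrightarrow> T \<subseteq> S \<Longrightarrow> smooth_on T f"
    by (simp add: smooth_on_def)
qed

lemma smooth_on_Un:
  assumes "open S" "open T" "smooth_on S f" "smooth_on T f"
  shows "smooth_on (S \<union> T) f"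
proof -
  have "differentiable_order_on n (S \<union> T) f"
    if "differentiable_order_on n S f" "differentiable_order_on n T f" for n
    using that by (induction n arbitrary: f) (auto intro: continuous_on_open_Un[OF assms(1,2)])
  then show ?thesis using assms by (simp add: smooth_on_def)
qed

lemma smooth_on_linear:
  assumes "open S" "bounded_linear L"
  shows "smooth_on S L"
  unfolding smooth_on_def
proof
  fix n show "differentiable_order_on n S L"
  proof (cases n)
    case 0
    then show ?thesis using bounded_linear.continuous_on[OF assms(2) continuous_on_id] by simp
  next
    case (Suc m)
    show ?thesis unfolding Suc
      by (rule differentiable_order_on_SucI[OF assms(1), of _ "\<lambda>_. L"])
        (simp_all add: bounded_linear_imp_has_derivative[OF assms(2)] differentiable_order_on_const)
  qed
qed

text \<open>Induction on the order, for all members of \<open>F\<close> at once. It serves for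
  functions whose higher derivatives are known only up to their general shape: powers, the flat
  function, compositions with a linear map.\<close>

lemma smooth_on_coinduct:
  assumes "open S" "f \<in> F"
    and step: "\<And>f. f \<in> F \<Longrightarrow>
      \<exists>f'. (\<forall>x\<in>S. (f has_derivative f' x) (at x)) \<and> (\<forall>v. (\<lambda>x. f' x v) \<in> F)"
  shows "smooth_on S f"
proof -
  have "differentiable_order_on n S f" if "f \<in> F" for n f
    using that
  proof (induction n arbitrary: f)
    case 0
    from step[OF 0] obtain f' where "\<And>x. x \<in> S \<Longrightarrow> (f has_derivative f' x) (at x)" by blast
    then have "continuous_on S f"
      using has_derivative_continuous_on[OF has_derivative_at_withinI] by blast
    then show ?case by simp
  next
    case (Suc n)
    from step[OF Suc.prems] obtain f' where f': "\<And>x. x \<in> S \<Longrightarrow> (f has_derivative f' x) (at x)"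
      "\<And>v. (\<lambda>x. f' x v) \<in> F" by blast
    show ?case
      by (rule differentiable_order_on_SucI[OF assms(1) f'(1) Suc.IH[OF f'(2)]])
  qed
  then show ?thesis using assms(2) by (simp add: smooth_on_def)
qed

text \<open>As \<open>h\<close> has a real argument, the chain rule yields a product of a derivative
  of \<open>f\<close> with \<open>h' (f x)\<close>. The induction thus varies \<open>h\<close> and
  keeps \<open>f\<close>, and no formula for higher derivatives is needed.\<close>

lemma smooth_on_compose_real:
  fixes h :: "real \<Rightarrow> real" and f :: "'a::real_normed_vector \<Rightarrow> real"
  assumes "open S" "smooth_on T h" "smooth_on S f" "f ` S \<subseteq> T"
  shows "smooth_on S (\<lambda>x. h (f x))"
proof -
  have "differentiable_order_on n S (\<lambda>x. h (f x))" if "smooth_on T h"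
    for n and h :: "real \<Rightarrow> real"
    using that
  proof (induction n arbitrary: h)
    case 0
    then show ?case
      using continuous_on_compose2[OF smooth_on_continuous_on[OF 0]
          smooth_on_continuous_on[OF assms(3)] assms(4)] by simp
  next
    case (Suc n)
    let ?f = "\<lambda>x. frechet_derivative f (at x)" and ?h = "\<lambda>x. frechet_derivative h (at x)"
    have h: "(h has_derivative ?h y) (at y)" if "y \<in> T" for y
      using smooth_on_differentiable[OF Suc.prems that] by (simp add: frechet_derivative_works)
    have f: "(f has_derivative ?f x) (at x)" if "x \<in> S" for x
      using smooth_on_differentiable[OF assms(3) that] by (simp add: frechet_derivative_works)
    have eq: "?h y t = t * ?h y 1" if "y \<in> T" for y t :: real
      using linear_scale[OF has_derivative_linear[OF h[OF that]], of t 1] by simp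
    have "((\<lambda>x. h (f x)) has_derivative (\<lambda>v. ?f x v * ?h (f x) 1)) (at x)" if "x \<in> S" for x
    proof -
      have fx: "f x \<in> T" using that assms(4) by auto
      have "(\<lambda>v. ?h (f x) (?f x v)) = (\<lambda>v. ?f x v * ?h (f x) 1)"
        by (rule ext) (rule eq[OF fx])
      with has_derivative_compose[OF f[OF that] h[OF fx]] show ?thesis by metis
    qed
    moreover have "differentiable_order_on n S (\<lambda>x. ?f x v * ?h (f x) 1)" for v
    proof (rule differentiable_order_on_bilinear[OF assms(1) bounded_bilinear_mult])
      show "differentiable_order_on n S (\<lambda>x. ?f x v)"
        using smooth_on_frechet_derivative[OF assms(3)] by (simp add: smooth_on_def)
      show "differentiable_order_on n S (\<lambda>x. ?h (f x) 1)"
        by (rule Suc.IH) (rule smooth_on_frechet_derivative[OF Suc.prems])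
    qed
    ultimately show ?case
      by (rule differentiable_order_on_SucI[OF assms(1)])
  qed
  then show ?thesis using assms(2) by (simp add: smooth_on_def)
qed

lemma smooth_on_compose_linear_left:
  assumes "bounded_linear L" "smooth_on UNIV f"
  shows "smooth_on UNIV (\<lambda>x. f (L x))"
proof -
  let ?F = "{(\<lambda>x. g (L x)) |g. smooth_on UNIV g}"
  have step: "\<exists>f'. (\<forall>x\<in>UNIV. (f has_derivative f' x) (at x)) \<and> (\<forall>v. (\<lambda>x. f' x v) \<in> ?F)"
    if "f \<in> ?F" for f
  proof -
    from that obtain g where g: "f = (\<lambda>x. g (L x))" "smooth_on UNIV g" by auto
    let ?g = "\<lambda>x v. frechet_derivative g (at (L x)) (L v)"
    have "(f has_derivative ?g x) (at x)" for x
      unfolding g(1)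
      by (rule has_derivative_compose[OF bounded_linear_imp_has_derivative[OF assms(1)]])
        (use smooth_on_differentiable[OF g(2)] in \<open>simp add: frechet_derivative_works\<close>)
    moreover have "(\<lambda>x. ?g x v) \<in> ?F" for v
      using smooth_on_frechet_derivative[OF g(2)] by auto
    ultimately show ?thesis by (intro exI[of _ ?g]) auto
  qed
  show ?thesis
    by (rule smooth_on_coinduct[where F = ?F]) (use assms step in auto)
qed

lemma smooth_on_powr: "smooth_on {0<..} (\<lambda>t::real. t powr p)"
proof (rule smooth_on_coinduct[where F = "range (\<lambda>(c, q) t. c * t powr q)"])
  fix f :: "real \<Rightarrow> real" assume "f \<in> range (\<lambda>(c, q) t. c * t powr q)"
  then obtain c q where f: "f = (\<lambda>t. c * t powr q)" by auto
  have "(f has_derivative (\<lambda>v. (c * q * v) * t powr (q - 1))) (at t)" if "t > 0" for t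
    unfolding f using that
    by (auto intro!: derivative_eq_intros simp: fun_eq_iff powr_diff field_simps)
  moreover have "(\<lambda>t. (c * q * v) * t powr (q - 1)) \<in> range (\<lambda>(c, q) t. c * t powr q)" for v
    by (rule range_eqI[of _ _ "(c * q * v, q - 1)"]) simp
  ultimately show "\<exists>f'. (\<forall>x\<in>{0<..}. (f has_derivative f' x) (at x)) \<and>
      (\<forall>v. (\<lambda>x. f' x v) \<in> range (\<lambda>(c, q) t. c * t powr q))"
    by (intro exI[of _ "\<lambda>t v. (c * q * v) * t powr (q - 1)"]) auto
next
  show "(\<lambda>t. t powr p) \<in> range (\<lambda>(c, q) t. c * t powr q)"
    by (rule range_eqI[of _ _ "(1, p)"]) simp
qed simp

section \<open>A flat function\<close>

text \<open>The classical smooth function with all derivatives zero at the origin. It tends to 1 at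
  infinity and so acts as a cut-off by itself; \<open>1 - flat x\<close> decays only like
  \<open>1 / x\<close>, which is enough for the energy estimate.\<close>

definition flat :: "real \<Rightarrow> real" where
  "flat x = (if x > 0 then exp (- 1 / x) else 0)"

lemma flat_bounds: "0 \<le> flat x" "flat x \<le> 1"
  by (auto simp: flat_def)

text \<open>The shape of all derivatives of \<open>flat\<close>: a polynomial in
  \<open>1 / x\<close> times the exponential.\<close>

definition flat_poly :: "real poly \<Rightarrow> real \<Rightarrow> real" where
  "flat_poly p x = (if x > 0 then poly p (1 / x) * exp (- 1 / x) else 0)"

lemma poly_exp_decay: "((\<lambda>y::real. poly p y * exp (- y)) \<longlongrightarrow> 0) at_top"
proof -
  have "((\<lambda>y. \<Sum>i\<le>degree p. coeff p i * (y ^ i / exp y)) \<longlongrightarrow> (\<Sum>i\<le>degree p. coeff p i * 0)) at_top"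
    by (intro tendsto_sum tendsto_mult tendsto_const tendsto_power_div_exp_0)
  also have "(\<lambda>y. \<Sum>i\<le>degree p. coeff p i * (y ^ i / exp y)) = (\<lambda>y. poly p y * exp (- y))"
    by (simp add: fun_eq_iff poly_altdef exp_minus sum_distrib_right divide_inverse mult.assoc)
  finally show ?thesis by simp
qed

lemma flat_poly_deriv:
  "(flat_poly p has_real_derivative flat_poly ([:0, 0, 1:] * (p - pderiv p)) x) (at x)"
proof -
  consider "x < 0" | "x = 0" | "x > 0" by linarith
  then show ?thesis
  proof cases
    case 1
    have "((\<lambda>x. 0) has_real_derivative 0) (at x)" by simp
    then have "(flat_poly p has_real_derivative 0) (at x)"
      by (rule has_field_derivative_transform_within_open[of _ _ _ "{..<0}"])
        (use 1 in \<open>auto simp: flat_poly_def\<close>)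
    then show ?thesis using 1 by (simp add: flat_poly_def)
  next
    case 2
    have l: "((\<lambda>h. flat_poly p h / h) \<longlongrightarrow> 0) (at_left 0)"
      by (rule tendsto_eventually) (auto simp: eventually_at_filter flat_poly_def)
    \<comment> \<open>The difference quotient at 0 has an additional factor \<open>1 / h\<close>,
      which \<open>pCons 0\<close> absorbs into the polynomial.\<close>
    have "((\<lambda>h. poly (pCons 0 p) (inverse h) * exp (- inverse h)) \<longlongrightarrow> 0) (at_right 0)"
      by (rule filterlim_compose[OF poly_exp_decay filterlim_inverse_at_top_right])
    then have r: "((\<lambda>h. flat_poly p h / h) \<longlongrightarrow> 0) (at_right 0)"
      by (rule Lim_transform_eventually)
        (auto simp: eventually_at_filter flat_poly_def divide_inverse intro!: always_eventually)
    have "((\<lambda>h. flat_poly p h / h) \<longlongrightarrow> 0) (at 0)"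
      using filterlim_split_at[OF l r] .
    then show ?thesis
      using 2 by (simp add: DERIV_def flat_poly_def)
  next
    case 3
    have "((\<lambda>x. poly p (1 / x) * exp (- 1 / x)) has_real_derivative
        poly ([:0, 0, 1:] * (p - pderiv p)) (1 / x) * exp (- 1 / x)) (at x)"
      using 3 by (auto intro!: derivative_eq_intros DERIV_chain2[OF poly_DERIV]
          simp: field_simps power2_eq_square)
    then have "(flat_poly p has_real_derivative
        poly ([:0, 0, 1:] * (p - pderiv p)) (1 / x) * exp (- 1 / x)) (at x)"
      by (rule has_field_derivative_transform_within_open[of _ _ _ "{0<..}"])
        (use 3 in \<open>auto simp: flat_poly_def\<close>)
    then show ?thesis using 3 by (simp add: flat_poly_def)
  qed
qed

lemma flat_eq_flat_poly: "flat = flat_poly 1"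
  by (auto simp: flat_def flat_poly_def fun_eq_iff)

lemma smooth_on_flat: "smooth_on UNIV flat"
proof (rule smooth_on_coinduct[where F = "range flat_poly"])
  show "flat \<in> range flat_poly" by (simp add: flat_eq_flat_poly)
  fix f assume "f \<in> range flat_poly"
  then obtain p where f: "f = flat_poly p" by auto
  let ?q = "[:0, 0, 1:] * (p - pderiv p)"
  have "(\<lambda>x. flat_poly ?q x * v) = flat_poly (smult v ?q)" for v
    by (auto simp: flat_poly_def fun_eq_iff)
  then show "\<exists>f'. (\<forall>x\<in>UNIV. (f has_derivative f' x) (at x)) \<and> (\<forall>v. (\<lambda>x. f' x v) \<in> range flat_poly)"
    using flat_poly_deriv[of p] unfolding f
    by (intro exI[of _ "\<lambda>x v. flat_poly ?q x * v"]) (auto simp: has_field_derivative_def)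
qed simp

text \<open>At \<open>x = 0\<close> the formula reads \<open>0 / 0 = 0\<close>, which is the correct
  value.\<close>

lemma flat_deriv: "(flat has_real_derivative flat x / x\<^sup>2) (at x)"
proof -
  have "flat_poly ([:0, 0, 1:] * (1 - pderiv 1)) x = flat x / x\<^sup>2"
    by (simp add: flat_poly_def flat_def power2_eq_square)
  then show ?thesis
    using flat_poly_deriv[of 1 x] by (simp add: flat_eq_flat_poly)
qed

section \<open>Friedrichs extensions in real inner product spaces\<close>

definition nonneg_op :: "('a::real_inner \<times> 'a) set \<Rightarrow> bool" where
  "nonneg_op T \<longleftrightarrow> subspace T \<and> (\<forall>(v, g)\<in>T. \<forall>(w, h)\<in>T. v \<bullet> h = g \<bullet> w) \<and> (\<forall>(v, g)\<in>T. 0 \<le> v \<bullet> g)"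

text \<open>No modulus is taken: for a nonnegative operator the energy of a difference is its own
  absolute value.\<close>

definition real_form_domain :: "('a::real_inner \<times> 'a) set \<Rightarrow> 'a set" where
  "real_form_domain T = {u. \<exists>s g. (\<forall>n::nat. (s n, g n) \<in> T) \<and> s \<longlonglongrightarrow> u \<and>
     (\<forall>\<epsilon>>0. \<exists>N. \<forall>m\<ge>N. \<forall>n\<ge>N. (s m - s n) \<bullet> (g m - g n) < \<epsilon>)}"

definition real_friedrichs :: "'a::real_inner set \<Rightarrow> ('a \<times> 'a) set \<Rightarrow> ('a \<times> 'a) set" where
  "real_friedrichs H T =
     {(u, f). u \<in> H \<and> f \<in> H \<and> (\<forall>(v, g)\<in>T. u \<bullet> g = f \<bullet> v) \<and> u \<in> real_form_domain T}"

lemma real_friedrichs_iff: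
  "(u, f) \<in> real_friedrichs H T \<longleftrightarrow>
     u \<in> H \<and> f \<in> H \<and> (\<forall>v g. (v, g) \<in> T \<longrightarrow> u \<bullet> g = f \<bullet> v) \<and> u \<in> real_form_domain T"
  by (auto simp: real_friedrichs_def)

lemma nonneg_op_add: "nonneg_op T \<Longrightarrow> (v, g) \<in> T \<Longrightarrow> (w, h) \<in> T \<Longrightarrow> (v + w, g + h) \<in> T"
  unfolding nonneg_op_def by (metis subspace_add add_Pair)

lemma nonneg_op_diff: "nonneg_op T \<Longrightarrow> (v, g) \<in> T \<Longrightarrow> (w, h) \<in> T \<Longrightarrow> (v - w, g - h) \<in> T"
  unfolding nonneg_op_def by (metis subspace_diff diff_Pair)

lemma nonneg_op_scaleR: "nonneg_op T \<Longrightarrow> (v, g) \<in> T \<Longrightarrow> (r *\<^sub>R v, r *\<^sub>R g) \<in> T"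
  unfolding nonneg_op_def by (metis subspace_scale scaleR_Pair)

lemma nonneg_op_symmetric: "nonneg_op T \<Longrightarrow> (v, g) \<in> T \<Longrightarrow> (w, h) \<in> T \<Longrightarrow> v \<bullet> h = g \<bullet> w"
  by (auto simp: nonneg_op_def)

lemma nonneg_op_nonneg: "nonneg_op T \<Longrightarrow> (v, g) \<in> T \<Longrightarrow> 0 \<le> v \<bullet> g"
  by (auto simp: nonneg_op_def)

text \<open>The usual discriminant argument for the energy of \<open>v + t w\<close>; as the form
  may be degenerate, \<open>w \<bullet> h = 0\<close> is a separate case.\<close>

lemma nonneg_op_Cauchy_Schwarz:
  assumes T: "nonneg_op T" and v: "(v, g) \<in> T" and w: "(w, h) \<in> T"
  shows "\<bar>v \<bullet> h\<bar> \<le> sqrt (v \<bullet> g) * sqrt (w \<bullet> h)"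
proof -
  have exp: "0 \<le> v \<bullet> g + 2 * t * (v \<bullet> h) + t\<^sup>2 * (w \<bullet> h)" for t
  proof -
    have "(v + t *\<^sub>R w, g + t *\<^sub>R h) \<in> T"
      by (intro nonneg_op_add nonneg_op_scaleR T v w)
    from nonneg_op_nonneg[OF T this] show ?thesis
      using nonneg_op_symmetric[OF T v w]
      by (simp add: inner_add_left inner_add_right inner_commute[of w g] power2_eq_square
          algebra_simps)
  qed
  have "(v \<bullet> h)\<^sup>2 \<le> (v \<bullet> g) * (w \<bullet> h)"
  proof (cases "w \<bullet> h = 0")
    case True
    have "v \<bullet> h = 0"
    proof (rule ccontr)
      assume "v \<bullet> h \<noteq> 0"
      \<comment> \<open>At this \<open>t\<close> the expression, linear in \<open>t\<close> here,
        takes the value -1.\<close>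
      with exp[of "- (v \<bullet> g + 1) / (2 * (v \<bullet> h))"] True show False
        by (simp add: field_simps)
    qed
    then show ?thesis using True by simp
  next
    case False
    then have p: "w \<bullet> h > 0" using nonneg_op_nonneg[OF T w] by simp
    \<comment> \<open>The minimum of the quadratic polynomial in \<open>t\<close>.\<close>
    have "0 \<le> v \<bullet> g - (v \<bullet> h)\<^sup>2 / (w \<bullet> h)"
      using exp[of "- (v \<bullet> h) / (w \<bullet> h)"] p by (simp add: power2_eq_square field_simps)
    then show ?thesis using p by (simp add: field_simps)
  qed
  then have "sqrt ((v \<bullet> h)\<^sup>2) \<le> sqrt ((v \<bullet> g) * (w \<bullet> h))" by (rule real_sqrt_le_mono)
  then show ?thesis by (simp add: real_sqrt_mult)
qed

lemma nonneg_op_triangle: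
  assumes T: "nonneg_op T" and v: "(v, g) \<in> T" and w: "(w, h) \<in> T"
  shows "sqrt ((v + w) \<bullet> (g + h)) \<le> sqrt (v \<bullet> g) + sqrt (w \<bullet> h)"
proof (rule real_le_lsqrt)
  have "(v + w) \<bullet> (g + h) = v \<bullet> g + 2 * (v \<bullet> h) + w \<bullet> h"
    using nonneg_op_symmetric[OF T v w]
    by (simp add: inner_add_left inner_add_right inner_commute[of w g])
  also have "\<dots> \<le> v \<bullet> g + 2 * (sqrt (v \<bullet> g) * sqrt (w \<bullet> h)) + w \<bullet> h"
    using nonneg_op_Cauchy_Schwarz[OF assms] by (simp add: abs_le_iff)
  also have "\<dots> = (sqrt (v \<bullet> g) + sqrt (w \<bullet> h))\<^sup>2"
    using nonneg_op_nonneg[OF T v] nonneg_op_nonneg[OF T w] by (simp add: power2_sum)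
  finally show "(v + w) \<bullet> (g + h) \<le> (sqrt (v \<bullet> g) + sqrt (w \<bullet> h))\<^sup>2" .
qed (use nonneg_op_nonneg[OF T] v w in auto)

text \<open>Density for the energy norm; the second bound is on the square of the energy
  seminorm.\<close>

definition form_dense :: "('a::real_inner \<times> 'a) set \<Rightarrow> ('a \<times> 'a) set \<Rightarrow> bool" where
  "form_dense T T' \<longleftrightarrow> (\<forall>(v, g)\<in>T'. \<forall>\<epsilon>>0. \<exists>(w, h)\<in>T. norm (v - w) < \<epsilon> \<and> (v - w) \<bullet> (g - h) < \<epsilon>)"

lemma real_form_domain_mono: "T \<subseteq> T' \<Longrightarrow> real_form_domain T \<subseteq> real_form_domain T'"
  unfolding real_form_domain_def by blast

text \<open>Each member of an approximating sequence is replaced by an element of \<open>T\<close>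
  within \<open>1 / Suc n\<close> in norm and in energy seminorm; the new sequence has the same
  limit and is still Cauchy.\<close>

lemma real_form_domain_form_dense:
  assumes T: "nonneg_op T'" "T \<subseteq> T'" and dense: "form_dense T T'"
  shows "real_form_domain T' \<subseteq> real_form_domain T"
proof
  fix u assume "u \<in> real_form_domain T'"
  then obtain s g where sg: "\<And>n::nat. (s n, g n) \<in> T'" and lim: "s \<longlonglongrightarrow> u"
    and cau: "\<And>\<epsilon>. \<epsilon> > 0 \<Longrightarrow> \<exists>N. \<forall>m\<ge>N. \<forall>n\<ge>N. (s m - s n) \<bullet> (g m - g n) < \<epsilon>"
    unfolding real_form_domain_def by blast
  have "\<exists>w h. (w, h) \<in> T \<and> norm (s n - w) < 1 / real (Suc n) \<and>
      (s n - w) \<bullet> (g n - h) < (1 / real (Suc n))\<^sup>2" for n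
  proof -
    \<comment> \<open>The energy bound concerns a square, so its tolerance is squared;
      \<open>form_dense\<close> offers one tolerance for both bounds.\<close>
    let ?e = "min (1 / real (Suc n)) ((1 / real (Suc n))\<^sup>2)"
    have "?e > 0" by simp
    with dense sg[of n] obtain w h where "(w, h) \<in> T" "norm (s n - w) < ?e"
      "(s n - w) \<bullet> (g n - h) < ?e"
      unfolding form_dense_def by blast
    then show ?thesis by (metis min_less_iff_conj)
  qed
  then obtain w h where wh: "\<And>n. (w n, h n) \<in> T" and n: "\<And>n. norm (s n - w n) < 1 / real (Suc n)"
    and q: "\<And>n. (s n - w n) \<bullet> (g n - h n) < (1 / real (Suc n))\<^sup>2" by metis
  have wh': "(w n, h n) \<in> T'" for n using wh T by auto
  have null: "(\<lambda>n. 1 / real (Suc n)) \<longlonglongrightarrow> 0"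
    using LIMSEQ_inverse_real_of_nat by (simp add: inverse_eq_divide)
  have "(\<lambda>n. s n - w n) \<longlonglongrightarrow> 0"
    by (rule tendsto_0_le[OF null, of _ 1]) (use n in \<open>auto intro!: always_eventually less_imp_le\<close>)
  from tendsto_diff[OF lim this] have "w \<longlonglongrightarrow> u" by simp
  moreover have "\<exists>N. \<forall>m\<ge>N. \<forall>n\<ge>N. (w m - w n) \<bullet> (h m - h n) < \<epsilon>" if "\<epsilon> > 0" for \<epsilon>
  proof -
    \<comment> \<open>One third of the seminorm for each of \<open>w m - s m\<close>,
      \<open>s m - s n\<close> and \<open>s n - w n\<close>.\<close>
    define d where "d = sqrt \<epsilon> / 3"
    have "d > 0" using that by (simp add: d_def)
    then have "d\<^sup>2 > 0" by simp
    from cau[OF this] obtain N1 where N1: "\<And>m n. m \<ge> N1 \<Longrightarrow> n \<ge> N1 \<Longrightarrow>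
        (s m - s n) \<bullet> (g m - g n) < d\<^sup>2" by blast
    obtain N2 where N2: "\<And>n. n \<ge> N2 \<Longrightarrow> 1 / real (Suc n) < d"
      using order_tendstoD(2)[OF null \<open>d > 0\<close>] by (auto simp: eventually_sequentially)
    have a: "(s k - w k, g k - h k) \<in> T'" for k
      by (rule nonneg_op_diff[OF T(1) sg wh'])
    have a': "(w k - s k, h k - g k) \<in> T'" for k
      by (rule nonneg_op_diff[OF T(1) wh' sg])
    have b: "sqrt ((s k - w k) \<bullet> (g k - h k)) \<le> d" if "k \<ge> N2" for k
    proof -
      have "sqrt ((s k - w k) \<bullet> (g k - h k)) \<le> 1 / real (Suc k)"
        using q[of k] by (intro real_le_lsqrt) auto
      then show ?thesis using N2[OF that] by simp
    qed
    have "(w m - w n) \<bullet> (h m - h n) < \<epsilon>" if "m \<ge> max N1 N2" "n \<ge> max N1 N2" for m n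
    proof -
      have c: "(s m - s n, g m - g n) \<in> T'"
        by (rule nonneg_op_diff[OF T(1) sg sg])
      have "(s m - s n) \<bullet> (g m - g n) < d\<^sup>2" using N1 that by simp
      then have lt: "sqrt ((s m - s n) \<bullet> (g m - g n)) < d"
        using \<open>d > 0\<close> by (simp add: real_less_lsqrt)
      have "sqrt ((w m - s m + (s m - s n)) \<bullet> (h m - g m + (g m - g n)))
          \<le> sqrt ((w m - s m) \<bullet> (h m - g m)) + sqrt ((s m - s n) \<bullet> (g m - g n))"
        by (rule nonneg_op_triangle[OF T(1) a' c])
      also have "(w m - s m) \<bullet> (h m - g m) = (s m - w m) \<bullet> (g m - h m)"
        by (simp add: inner_diff_left inner_diff_right)
      finally have 1: "sqrt ((w m - s n) \<bullet> (h m - g n)) < d + d"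
        using b[of m] lt that by simp
      have "sqrt ((w m - s n + (s n - w n)) \<bullet> (h m - g n + (g n - h n)))
          \<le> sqrt ((w m - s n) \<bullet> (h m - g n)) + sqrt ((s n - w n) \<bullet> (g n - h n))"
        by (rule nonneg_op_triangle[OF T(1) nonneg_op_diff[OF T(1) wh' sg] a])
      then have "sqrt ((w m - w n) \<bullet> (h m - h n)) < d + d + d"
        using b[of n] 1 that by simp
      then show ?thesis by (simp add: d_def)
    qed
    then show ?thesis by blast
  qed
  ultimately show "u \<in> real_form_domain T"
    unfolding real_form_domain_def using wh by blast
qed

text \<open>Here \<open>u \<bullet> g\<close> is the value of the form at \<open>u\<close> and
  \<open>v\<close>. The energies along an approximating sequence of \<open>u\<close> are bounded,
  and the Cauchy-Schwarz inequality passes to the limit in the first argument.\<close>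

lemma real_form_domain_bounded:
  assumes T: "nonneg_op T" and u: "u \<in> real_form_domain T"
  obtains M where "M \<ge> 0" "\<And>v g. (v, g) \<in> T \<Longrightarrow> \<bar>u \<bullet> g\<bar> \<le> M * sqrt (v \<bullet> g)"
proof -
  from u obtain s g where sg: "\<And>n::nat. (s n, g n) \<in> T" and lim: "s \<longlonglongrightarrow> u"
    and cau: "\<And>\<epsilon>. \<epsilon> > 0 \<Longrightarrow> \<exists>N. \<forall>m\<ge>N. \<forall>n\<ge>N. (s m - s n) \<bullet> (g m - g n) < \<epsilon>"
    unfolding real_form_domain_def by blast
  from cau[of 1] obtain N where N: "\<And>m n. m \<ge> N \<Longrightarrow> n \<ge> N \<Longrightarrow> (s m - s n) \<bullet> (g m - g n) < 1"
    by auto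
  define M where "M = sqrt (s N \<bullet> g N) + 1"
  have M: "sqrt (s n \<bullet> g n) \<le> M" if "n \<ge> N" for n
  proof -
    have "sqrt ((s n - s N) \<bullet> (g n - g N)) \<le> 1"
      using N[OF that order_refl] by simp
    then show ?thesis
      using nonneg_op_triangle[OF T sg[of N] nonneg_op_diff[OF T sg[of n] sg[of N]]]
      unfolding M_def add_diff_eq add_diff_cancel_left' by linarith
  qed
  show ?thesis
  proof (rule that[of M])
    show "M \<ge> 0" using nonneg_op_nonneg[OF T sg[of N]] by (simp add: M_def)
    fix v h assume v: "(v, h) \<in> T"
    have "\<bar>s n \<bullet> h\<bar> \<le> M * sqrt (v \<bullet> h)" if "n \<ge> N" for n
      using nonneg_op_Cauchy_Schwarz[OF T sg[of n] v]
        mult_right_mono[OF M[OF that], of "sqrt (v \<bullet> h)"] nonneg_op_nonneg[OF T v] by simp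
    moreover have "(\<lambda>n. \<bar>s n \<bullet> h\<bar>) \<longlonglongrightarrow> \<bar>u \<bullet> h\<bar>"
      by (intro tendsto_rabs tendsto_inner lim tendsto_const)
    ultimately show "\<bar>u \<bullet> h\<bar> \<le> M * sqrt (v \<bullet> h)"
      by (intro LIMSEQ_le_const2) auto
  qed
qed

text \<open>The form of \<open>T'\<close> is continuous in its first argument on the form domain, so that
  the adjoint relation extends from a form dense subspace.\<close>
lemma real_friedrichs_form_dense:
  assumes T: "nonneg_op T'" "T \<subseteq> T'" and dense: "form_dense T T'"
  shows "real_friedrichs H T = real_friedrichs H T'"
proof -
  have dom: "real_form_domain T = real_form_domain T'"
    using real_form_domain_form_dense[OF assms] real_form_domain_mono[OF T(2)] by blast
  have "u \<bullet> g = f \<bullet> v" if u: "u \<in> real_form_domain T'" and adj: "\<forall>(v, g)\<in>T. u \<bullet> g = f \<bullet> v"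
    and v: "(v, g) \<in> T'" for u f v g
  proof -
    obtain M where M: "M \<ge> 0" "\<And>v g. (v, g) \<in> T' \<Longrightarrow> \<bar>u \<bullet> g\<bar> \<le> M * sqrt (v \<bullet> g)"
      using real_form_domain_bounded[OF T(1) u] by blast
    have bound: "\<bar>u \<bullet> g - f \<bullet> v\<bar> \<le> (M + norm f) * \<epsilon>" if "0 < \<epsilon>" "\<epsilon> < 1" for \<epsilon>
    proof -
      have "0 < \<epsilon>\<^sup>2" using that by simp
      then obtain w h where w: "(w, h) \<in> T" "norm (v - w) < \<epsilon>\<^sup>2" "(v - w) \<bullet> (g - h) < \<epsilon>\<^sup>2"
        using dense v unfolding form_dense_def by blast
      have "\<epsilon>\<^sup>2 \<le> \<epsilon>" using that by (simp add: power2_eq_square)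
      have "(v - w, g - h) \<in> T'"
        using nonneg_op_diff[OF T(1) v] w(1) T(2) by auto
      from M(2)[OF this] have "\<bar>u \<bullet> (g - h)\<bar> \<le> M * sqrt ((v - w) \<bullet> (g - h))" .
      also have "\<dots> \<le> M * \<epsilon>"
        using w(3) that M(1) by (intro mult_left_mono real_le_lsqrt) auto
      finally have 1: "\<bar>u \<bullet> (g - h)\<bar> \<le> M * \<epsilon>" .
      have "\<bar>f \<bullet> (v - w)\<bar> \<le> norm f * norm (v - w)" by (rule Cauchy_Schwarz_ineq2)
      also have "\<dots> \<le> norm f * \<epsilon>"
        using w(2) \<open>\<epsilon>\<^sup>2 \<le> \<epsilon>\<close> by (intro mult_left_mono) auto
      finally have 2: "\<bar>f \<bullet> (v - w)\<bar> \<le> norm f * \<epsilon>" .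
      have "u \<bullet> h = f \<bullet> w" using adj w(1) by auto
      then have "u \<bullet> g - f \<bullet> v = u \<bullet> (g - h) - f \<bullet> (v - w)" by (simp add: inner_diff_right)
      then show ?thesis using 1 2 by (simp add: distrib_right)
    qed
    show ?thesis
    proof (rule ccontr)
      assume ne: "u \<bullet> g \<noteq> f \<bullet> v"
      let ?C = "M + norm f + 1" and ?x = "\<bar>u \<bullet> g - f \<bullet> v\<bar>"
      have C: "?C > 0" using M(1) norm_ge_zero[of f] by linarith
      have x: "?x > 0" using ne by simp
      \<comment> \<open>The second term makes the bound half of the discrepancy \<open>?x\<close>;
        the first one ensures \<open>\<epsilon> < 1\<close>.\<close>
      define \<epsilon> where "\<epsilon> = min (1/2) (?x / (2 * ?C))"
      have "0 < \<epsilon>" "\<epsilon> < 1" using C x by (auto simp: \<epsilon>_def)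
      from bound[OF this] have "?x \<le> ?C * \<epsilon>" using \<open>0 < \<epsilon>\<close> by (simp add: distrib_right)
      also have "\<dots> \<le> ?C * (?x / (2 * ?C))"
        using C by (intro mult_left_mono) (auto simp: \<epsilon>_def)
      also have "\<dots> = ?x / 2" using C by (simp add: field_simps)
      finally show False using x by simp
    qed
  qed
  then have "(u, f) \<in> real_friedrichs H T \<Longrightarrow> (u, f) \<in> real_friedrichs H T'" for u f
    unfolding real_friedrichs_def dom by blast
  moreover have "(u, f) \<in> real_friedrichs H T' \<Longrightarrow> (u, f) \<in> real_friedrichs H T" for u f
    using T(2) unfolding real_friedrichs_def dom by blast
  ultimately show ?thesis by auto
qed

text \<open>\<open>P\<close> is the orthogonal projection onto \<open>L\<close> and commutes with
  \<open>T\<close>. Applying it to an approximating sequence does not increase the energy, and for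
  \<open>u\<close>, \<open>f\<close> in \<open>L\<close> the adjoint relation at
  \<open>(v, g)\<close> is the one at \<open>(P v, P g)\<close>. Hence the form domain and the
  adjoint both reduce to \<open>L\<close>.\<close>

lemma real_friedrichs_reduce:
  fixes P :: "'a::real_inner \<Rightarrow> 'a"
  assumes T: "nonneg_op T" "T \<subseteq> H \<times> H"
    and lin: "linear P" and sym: "\<And>u v. P u \<bullet> v = u \<bullet> P v" and idem: "\<And>u. P (P u) = P u"
    and PH: "P ` H \<subseteq> H" and H: "subspace H" and PT: "\<And>v g. (v, g) \<in> T \<Longrightarrow> (P v, P g) \<in> T"
    and dense: "\<And>f. f \<in> H \<Longrightarrow> (\<And>v g. (v, g) \<in> T \<Longrightarrow> f \<bullet> v = 0) \<Longrightarrow> f = 0"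
    and L: "L = {u \<in> H. P u = u}"
  shows "{(u, f) \<in> real_friedrichs H T. u \<in> L} = real_friedrichs L (T \<inter> L \<times> L)"
proof -
  have contr: "norm (P u) \<le> norm u" for u
  proof -
    have "norm (P u) ^ 2 = u \<bullet> P u"
      by (simp add: power2_norm_eq_inner sym idem)
    also have "\<dots> \<le> norm u * norm (P u)" by (rule norm_cauchy_schwarz)
    finally show ?thesis
      by (cases "norm (P u) = 0") (simp_all add: power2_eq_square)
  qed
  have lim: "(\<lambda>n. P (s n)) \<longlonglongrightarrow> P u" if "s \<longlonglongrightarrow> u" for s :: "nat \<Rightarrow> 'a" and u
  proof -
    have "bounded_linear P"
      using lin contr by (intro bounded_linear_intro[of P 1])
        (auto simp: linear_add linear_scale)
    then show ?thesis using that by (rule bounded_linear.tendsto)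
  qed
  \<comment> \<open>The energy of \<open>v\<close> is the sum of the energies of \<open>P v\<close>
    and \<open>v - P v\<close>.\<close>
  have dec: "P v \<bullet> P g \<le> v \<bullet> g" if "(v, g) \<in> T" for v g
  proof -
    have "0 \<le> (v - P v) \<bullet> (g - P g)"
      using nonneg_op_nonneg[OF T(1)] nonneg_op_diff[OF T(1) that PT[OF that]] by blast
    also have "\<dots> = v \<bullet> g - P v \<bullet> P g"
      by (simp add: inner_diff_left inner_diff_right sym idem)
    finally show ?thesis by simp
  qed
  have PL: "(P v, P g) \<in> T \<inter> L \<times> L" if "(v, g) \<in> T" for v g
    using PT[OF that] T(2) that PH by (auto simp: L idem)
  show ?thesis
  proof (intro set_eqI iffI)
    fix x assume "x \<in> {(u, f) \<in> real_friedrichs H T. u \<in> L}"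
    then obtain u f where x: "x = (u, f)" and u: "u \<in> L" "u \<in> real_form_domain T" and f: "f \<in> H"
      and adj: "\<And>v g. (v, g) \<in> T \<Longrightarrow> u \<bullet> g = f \<bullet> v"
      by (cases x) (auto simp: real_friedrichs_iff)
    \<comment> \<open>\<open>P f - f\<close> is thus orthogonal to the domain of \<open>T\<close>,
      which is total in \<open>H\<close>: this puts the image \<open>f\<close> into
      \<open>L\<close>.\<close>
    have "P f \<bullet> v = f \<bullet> v" if "(v, g) \<in> T" for v g
    proof -
      have "P f \<bullet> v = u \<bullet> P g" using adj[OF PT[OF that]] by (simp add: sym)
      also have "\<dots> = u \<bullet> g" using u by (simp add: sym[symmetric] L)
      finally show ?thesis using adj[OF that] by simp
    qed
    then have "P f - f = 0"
      using f PH H by (intro dense subspace_diff) (auto simp: inner_diff_left)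
    then have "f \<in> L" using f by (simp add: L)
    from u obtain s g where sg: "\<And>n::nat. (s n, g n) \<in> T" and su: "s \<longlonglongrightarrow> u"
      and cau: "\<And>\<epsilon>. \<epsilon> > 0 \<Longrightarrow> \<exists>N. \<forall>m\<ge>N. \<forall>n\<ge>N. (s m - s n) \<bullet> (g m - g n) < \<epsilon>"
      unfolding real_form_domain_def by blast
    have "(P (s m) - P (s n)) \<bullet> (P (g m) - P (g n)) \<le> (s m - s n) \<bullet> (g m - g n)" for m n
      using dec[OF nonneg_op_diff[OF T(1) sg[of m] sg[of n]]] lin by (simp add: linear_diff)
    with cau have "\<exists>N. \<forall>m\<ge>N. \<forall>n\<ge>N. (P (s m) - P (s n)) \<bullet> (P (g m) - P (g n)) < \<epsilon>" if "\<epsilon> > 0" for \<epsilon>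
      using that by (meson le_less_trans)
    moreover have "(\<lambda>n. P (s n)) \<longlonglongrightarrow> u" using lim[OF su] u by (simp add: L)
    ultimately have "u \<in> real_form_domain (T \<inter> L \<times> L)"
      unfolding real_form_domain_def mem_Collect_eq using PL[OF sg]
      by (intro exI[of _ "\<lambda>n. P (s n)"] exI[of _ "\<lambda>n. P (g n)"]) simp
    then show "x \<in> real_friedrichs L (T \<inter> L \<times> L)"
      using u \<open>f \<in> L\<close> adj by (auto simp: real_friedrichs_def x)
  next
    fix x assume "x \<in> real_friedrichs L (T \<inter> L \<times> L)"
    then obtain u f where x: "x = (u, f)" and u: "u \<in> L" "u \<in> real_form_domain (T \<inter> L \<times> L)"
      and f: "f \<in> L" and adj: "\<And>v g. (v, g) \<in> T \<inter> L \<times> L \<Longrightarrow> u \<bullet> g = f \<bullet> v"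
      by (cases x) (auto simp: real_friedrichs_iff)
    have "u \<bullet> g = f \<bullet> v" if "(v, g) \<in> T" for v g
      using adj[OF PL[OF that]] u f by (simp add: sym[symmetric] L)
    then show "x \<in> {(u, f) \<in> real_friedrichs H T. u \<in> L}"
      using u f real_form_domain_mono[of "T \<inter> L \<times> L" T]
      by (auto simp: real_friedrichs_def x L)
  qed
qed

text \<open>Transport of structure. Surjectivity is onto the whole space, so that sequences in the
  target can be pulled back before it is known where their members lie.\<close>

lemma real_friedrichs_isometry:
  fixes U :: "'a::real_inner \<Rightarrow> 'b::real_inner"
  assumes lin: "linear U" and iso: "\<And>u v. U u \<bullet> U v = u \<bullet> v" and surj: "surj U"
  shows "map_prod U U ` real_friedrichs H T = real_friedrichs (U ` H) (map_prod U U ` T)"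
proof -
  have norm: "norm (U u) = norm u" for u
    by (simp add: norm_eq_sqrt_inner iso)
  have inj: "U u = U v \<longleftrightarrow> u = v" for u v
    using norm[of "u - v"] linear_diff[OF lin, of u v] by auto
  have lim: "(\<lambda>n. U (s n)) \<longlonglongrightarrow> U u \<longleftrightarrow> s \<longlonglongrightarrow> u" for s :: "nat \<Rightarrow> 'a" and u
    by (simp add: LIMSEQ_iff linear_diff[OF lin, symmetric] norm)
  have mem: "(U v, U g) \<in> map_prod U U ` T \<longleftrightarrow> (v, g) \<in> T" for v g
    using inj by auto
  have pr: "(\<exists>s g. Q s g) \<longleftrightarrow> (\<exists>s g. Q (\<lambda>n. U (s n)) (\<lambda>n. U (g n)))"
    for Q :: "(nat \<Rightarrow> 'b) \<Rightarrow> (nat \<Rightarrow> 'b) \<Rightarrow> bool"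
  proof
    assume "\<exists>s g. Q s g"
    then obtain s g where "Q s g" by blast
    moreover have "U (inv U y) = y" for y using surj by (rule surj_f_inv_f)
    ultimately have "Q (\<lambda>n. U (inv U (s n))) (\<lambda>n. U (inv U (g n)))" by simp
    then show "\<exists>s g. Q (\<lambda>n. U (s n)) (\<lambda>n. U (g n))"
      by (intro exI[of _ "\<lambda>n. inv U (s n)"] exI[of _ "\<lambda>n. inv U (g n)"])
  qed auto
  have dom: "U u \<in> real_form_domain (map_prod U U ` T) \<longleftrightarrow> u \<in> real_form_domain T" for u
    unfolding real_form_domain_def mem_Collect_eq
    by (subst pr) (simp only: mem lim linear_diff[OF lin, symmetric] iso)
  have H: "U u \<in> U ` H \<longleftrightarrow> u \<in> H" for u using inj by auto
  have main: "(U u, U f) \<in> real_friedrichs (U ` H) (map_prod U U ` T) \<longleftrightarrow> (u, f) \<in> real_friedrichs H T"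
    for u f
  proof -
    have "(\<forall>v g. (v, g) \<in> map_prod U U ` T \<longrightarrow> U u \<bullet> g = U f \<bullet> v) \<longleftrightarrow>
        (\<forall>v g. (v, g) \<in> T \<longrightarrow> u \<bullet> g = f \<bullet> v)"
      using iso by (auto 0 4)
    then show ?thesis by (simp add: real_friedrichs_iff dom H)
  qed
  show ?thesis
  proof (intro set_eqI)
    fix x :: "'b \<times> 'b"
    obtain u f where "x = (U u, U f)" using surj by (metis surj_pair surjD)
    then show "x \<in> map_prod U U ` real_friedrichs H T \<longleftrightarrow>
        x \<in> real_friedrichs (U ` H) (map_prod U U ` T)"
      using main inj by auto
  qed
qed

section \<open>Test functions and magnetic derivatives\<close>

lemma compact_closure_subset:
  fixes K :: "'a::heine_borel set"
  assumes "compact K" "X \<subseteq> K"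
  shows "compact (closure X)" "closure X \<subseteq> K"
proof -
  show "closure X \<subseteq> K" using assms by (intro closure_minimal compact_imp_closed)
  show "compact (closure X)"
    using bounded_subset[OF compact_imp_bounded[OF assms(1)] assms(2)] by (simp add: compact_closure)
qed

lemma test_functions_smooth: "u \<in> test_functions S \<Longrightarrow> smooth_on UNIV u"
  by (simp add: test_functions_def)

lemma test_functions_compact: "u \<in> test_functions S \<Longrightarrow> compact (closure {x. u x \<noteq> 0})"
  by (simp add: test_functions_def)

lemma test_functions_support: "u \<in> test_functions S \<Longrightarrow> closure {x. u x \<noteq> 0} \<subseteq> S"
  by (simp add: test_functions_def)

lemma test_functions_outside: "u \<in> test_functions S \<Longrightarrow> x \<notin> S \<Longrightarrow> u x = 0"
  using test_functions_support closure_subset[of "{x. u x \<noteq> 0}"] by blast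

lemma test_functions_mono: "S \<subseteq> S' \<Longrightarrow> test_functions S \<subseteq> test_functions S'"
  by (auto simp: test_functions_def)

lemma test_functions_has_derivative:
  "u \<in> test_functions S \<Longrightarrow> (u has_derivative frechet_derivative u (at x)) (at x)"
  using smooth_on_differentiable[OF test_functions_smooth, of u S x]
  by (simp add: frechet_derivative_works)

lemma partial_deriv_eq: "(u has_derivative u') (at x) \<Longrightarrow> partial_deriv e u x = u' e"
  unfolding partial_deriv_def using frechet_derivative_at by metis

lemma test_functionsI:
  assumes "smooth_on UNIV v" "u \<in> test_functions S" "\<And>x. x \<notin> closure {x. u x \<noteq> 0} \<Longrightarrow> v x = 0"
  shows "v \<in> test_functions S"
proof -
  have "{x. v x \<noteq> 0} \<subseteq> closure {x. u x \<noteq> 0}" using assms(3) by auto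
  from compact_closure_subset[OF test_functions_compact[OF assms(2)] this]
  show ?thesis
    using assms(1) test_functions_support[OF assms(2)] unfolding test_functions_def by auto
qed

lemma test_functions_add:
  assumes "u \<in> test_functions S" "v \<in> test_functions S"
  shows "(\<lambda>x. u x + v x) \<in> test_functions S"
proof -
  let ?K = "closure {x. u x \<noteq> 0} \<union> closure {x. v x \<noteq> 0}"
  have "{x. u x + v x \<noteq> 0} \<subseteq> ?K"
    using closure_subset[of "{x. u x \<noteq> 0}"] closure_subset[of "{x. v x \<noteq> 0}"] by fastforce
  moreover have "compact ?K" "?K \<subseteq> S"
    using assms by (auto simp: test_functions_def)
  ultimately show ?thesis
    using assms compact_closure_subset[of ?K "{x. u x + v x \<noteq> 0}"] unfolding test_functions_def
    by (auto intro: smooth_on_add)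
qed

text \<open>The product is smooth on \<open>W\<close> and zero off the support of \<open>u\<close>,
  and these two open sets cover the plane. So \<open>f\<close> may be singular outside
  \<open>W\<close>, like the potential at the poles or \<phi> on its cut.\<close>

lemma test_functions_smooth_mult:
  assumes u: "u \<in> test_functions S" and W: "S \<subseteq> W" "open W" and f: "smooth_on W f"
  shows "(\<lambda>x. f x * u x) \<in> test_functions S"
proof (rule test_functionsI[OF _ u])
  let ?K = "closure {x. u x \<noteq> 0}"
  have 0: "f x * u x = 0" if "x \<notin> ?K" for x
    using that closure_subset[of "{x. u x \<noteq> 0}"] by auto
  then show "\<And>x. x \<notin> ?K \<Longrightarrow> f x * u x = 0" .
  have "smooth_on W (\<lambda>x. f x * u x)"
    by (rule smooth_on_mult[OF W(2) f smooth_on_subset[OF test_functions_smooth[OF u]]]) simp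
  moreover have "smooth_on (- ?K) (\<lambda>x. f x * u x)"
    by (rule smooth_on_cong[OF smooth_on_const[of _ 0]]) (use 0 in auto)
  ultimately have "smooth_on (W \<union> - ?K) (\<lambda>x. f x * u x)"
    using W(2) by (intro smooth_on_Un) auto
  moreover have "W \<union> - ?K = UNIV"
    using test_functions_support[OF u] W(1) by auto
  ultimately show "smooth_on UNIV (\<lambda>x. f x * u x)" by simp
qed

lemma test_functions_const_mult: "u \<in> test_functions S \<Longrightarrow> (\<lambda>x. c * u x) \<in> test_functions S"
  by (rule test_functions_smooth_mult[where W = UNIV]) (auto intro: smooth_on_const)

lemma test_functions_zero: "(\<lambda>x. 0) \<in> test_functions S"
  by (simp add: test_functions_def smooth_on_const)

lemma test_functions_cnj:
  assumes "u \<in> test_functions S" shows "(\<lambda>x. cnj (u x)) \<in> test_functions S"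
  by (rule test_functionsI[OF smooth_on_cnj[OF _ test_functions_smooth[OF assms]] assms])
    (use closure_subset[of "{x. u x \<noteq> 0}"] in auto)

lemma bounded_linear_reflect: "bounded_linear reflect"
  unfolding reflect_def
  by (intro bounded_linear_Pair bounded_linear_fst bounded_linear_minus bounded_linear_snd)

lemma reflect_reflect [simp]: "reflect (reflect x) = x"
  by (simp add: reflect_def)

lemma test_functions_reflect:
  assumes u: "u \<in> test_functions S" and S: "reflect ` S = S"
  shows "(\<lambda>x. u (reflect x)) \<in> test_functions S"
proof -
  have cont: "continuous_on X reflect" for X
    using bounded_linear.continuous_on[OF bounded_linear_reflect continuous_on_id] by simp
  have eq: "{x. u (reflect x) \<noteq> 0} = reflect ` {x. u x \<noteq> 0}"
  proof
    show "reflect ` {x. u x \<noteq> 0} \<subseteq> {x. u (reflect x) \<noteq> 0}" by auto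
    show "{x. u (reflect x) \<noteq> 0} \<subseteq> reflect ` {x. u x \<noteq> 0}"
      by (intro subsetI rev_image_eqI[of "reflect _"]) auto
  qed
  let ?K = "closure {x. u x \<noteq> 0}"
  have comp: "compact (reflect ` ?K)"
    by (rule compact_continuous_image[OF cont test_functions_compact[OF u]])
  have "{x. u (reflect x) \<noteq> 0} \<subseteq> reflect ` ?K"
    unfolding eq by (intro image_mono closure_subset)
  from compact_closure_subset[OF comp this] have "compact (closure {x. u (reflect x) \<noteq> 0})"
    "closure {x. u (reflect x) \<noteq> 0} \<subseteq> S"
    using test_functions_support[OF u] S by auto
  then show ?thesis
    using smooth_on_compose_linear_left[OF bounded_linear_reflect test_functions_smooth[OF u]]
    by (simp add: test_functions_def)
qed

lemma test_functions_partial_deriv: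
  assumes u: "u \<in> test_functions S" shows "partial_deriv e u \<in> test_functions S"
proof (rule test_functionsI[OF _ u])
  show "smooth_on UNIV (partial_deriv e u)"
    unfolding partial_deriv_def[abs_def]
    by (rule smooth_on_frechet_derivative[OF test_functions_smooth[OF u]])
  fix x assume x: "x \<notin> closure {x. u x \<noteq> 0}"
  have "((\<lambda>x. 0) has_derivative (\<lambda>v. 0)) (at x)" by simp
  then have "(u has_derivative (\<lambda>v. 0)) (at x)"
    by (rule has_derivative_transform_within_open[of _ _ _ _ "- closure {x. u x \<noteq> 0}"])
      (use x closure_subset[of "{x. u x \<noteq> 0}"] in auto)
  then show "partial_deriv e u x = 0" by (simp add: partial_deriv_eq)
qed

section \<open>Integration of test functions\<close>

lemma test_functions_continuous: "u \<in> test_functions S \<Longrightarrow> continuous_on X u"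
  using smooth_on_continuous_on[OF test_functions_smooth] continuous_on_subset by blast

lemma test_functions_measurable: "u \<in> test_functions S \<Longrightarrow> u \<in> borel_measurable borel"
  by (rule borel_measurable_continuous_onI[OF test_functions_continuous])

lemma test_functions_integrable:
  assumes u: "u \<in> test_functions S" shows "integrable lborel u"
proof -
  let ?K = "closure {x. u x \<noteq> 0}"
  have "integrable lborel (\<lambda>x. indicator ?K x *\<^sub>R u x)"
    by (rule borel_integrable_compact[OF test_functions_compact[OF u] test_functions_continuous[OF u]])
  also have "(\<lambda>x. indicator ?K x *\<^sub>R u x) = u"
    using closure_subset[of "{x. u x \<noteq> 0}"] by (force simp: indicator_def fun_eq_iff)
  finally show ?thesis .
qed

lemma test_functions_mult:
  "u \<in> test_functions S \<Longrightarrow> v \<in> test_functions S' \<Longrightarrow> (\<lambda>x. u x * v x) \<in> test_functions S'"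
  by (rule test_functions_smooth_mult[where W = UNIV]) (auto intro: test_functions_smooth)

lemma test_functions_integrable_mult_cnj:
  "f \<in> test_functions S \<Longrightarrow> g \<in> test_functions S \<Longrightarrow> integrable lborel (\<lambda>x. f x * cnj (g x))"
  by (intro test_functions_integrable[of _ S] test_functions_mult test_functions_cnj)

lemma square_int_test_functions:
  assumes u: "u \<in> test_functions S" shows "square_int u"
proof -
  have "integrable lborel (\<lambda>x. u x * cnj (u x))"
    by (rule test_functions_integrable_mult_cnj[OF u u])
  then have "integrable lborel (\<lambda>x. Re (u x * cnj (u x)))" by (rule integrable_Re)
  then show ?thesis
    using test_functions_measurable[OF u]
    by (simp add: square_int_def complex_mult_cnj cmod_power2)
qed

text \<open>The difference quotients have integral zero by translation invariance. They converge to
  the derivative and, by the mean value inequality, are dominated by a constant on a ball that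
  contains the support and its translates.\<close>

lemma integral_partial_deriv:
  assumes F: "F \<in> test_functions S"
  shows "integral\<^sup>L lborel (partial_deriv e F) = 0"
proof -
  let ?K = "closure {x. F x \<noteq> 0}" and ?D = "partial_deriv e F"
  have D: "?D \<in> test_functions S" by (rule test_functions_partial_deriv[OF F])
  obtain R where R: "\<And>x. x \<in> ?K \<Longrightarrow> norm x \<le> R"
    using compact_imp_bounded[OF test_functions_compact[OF F]] by (auto simp: bounded_iff)
  have "compact (?D ` closure {x. ?D x \<noteq> 0})"
    by (rule compact_continuous_image[OF test_functions_continuous[OF D] test_functions_compact[OF D]])
  then obtain B0 where B0: "\<And>x. x \<in> closure {x. ?D x \<noteq> 0} \<Longrightarrow> norm (?D x) \<le> B0"
    using compact_imp_bounded by (fastforce simp: bounded_iff)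
  define B where "B = max B0 0"
  have B: "norm (?D x) \<le> B" for x
    using B0[of x] closure_subset[of "{x. ?D x \<noteq> 0}"] by (cases "?D x = 0") (auto simp: B_def)
  define t where "t n = 1 / real (Suc n)" for n
  have t: "0 < t n" "t n \<le> 1" for n by (auto simp: t_def)
  have t0: "t \<longlonglongrightarrow> 0"
    unfolding t_def using LIMSEQ_inverse_real_of_nat by (simp add: inverse_eq_divide)
  define G where "G n x = (F (x + t n *\<^sub>R e) - F x) /\<^sub>R t n" for n x
  have line: "((\<lambda>s. F (x + s *\<^sub>R e)) has_vector_derivative ?D (x + s *\<^sub>R e)) (at s)" for x s
  proof -
    have "((\<lambda>s. x + s *\<^sub>R e) has_derivative (\<lambda>h. h *\<^sub>R e)) (at s)"
      by (auto intro!: derivative_eq_intros)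
    from has_derivative_compose[OF this test_functions_has_derivative[OF F]]
    show ?thesis
      unfolding has_vector_derivative_def partial_deriv_def
      using linear_scale[OF has_derivative_linear[OF test_functions_has_derivative[OF F]]] by simp
  qed
  have "(\<lambda>n. integral\<^sup>L lborel (G n)) \<longlonglongrightarrow> integral\<^sup>L lborel ?D"
  proof (rule integral_dominated_convergence)
    show "?D \<in> borel_measurable lborel" using test_functions_measurable[OF D] by simp
    have meas: "F \<in> borel_measurable borel" by (rule test_functions_measurable[OF F])
    show "G n \<in> borel_measurable lborel" for n
      unfolding G_def[abs_def] using meas by measurable
    show "integrable lborel (\<lambda>x. indicator (cball 0 (R + norm e)) x *\<^sub>R B)"
      by (rule borel_integrable_compact) auto
    show "AE x in lborel. (\<lambda>n. G n x) \<longlonglongrightarrow> ?D x"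
    proof (rule AE_I2)
      fix x
      let ?N = "\<lambda>s. norm (F (x + s *\<^sub>R e) - F x - s *\<^sub>R ?D x) / norm s"
      have "(?N \<longlongrightarrow> 0) (at 0)"
        using line[of x 0] by (simp add: has_vector_derivative_def has_derivative_at)
      moreover have "filterlim t (at 0) sequentially"
        using t0 t(1) by (auto simp: filterlim_at intro!: always_eventually less_imp_neq[symmetric])
      ultimately have "(\<lambda>n. ?N (t n)) \<longlonglongrightarrow> 0"
        by (rule filterlim_compose)
      moreover have "?N (t n) = norm (G n x - ?D x)" for n
      proof -
        have "G n x - ?D x = (F (x + t n *\<^sub>R e) - F x - t n *\<^sub>R ?D x) /\<^sub>R t n"
          using t(1)[of n] by (simp add: G_def scaleR_diff_right)
        then show ?thesis using t(1)[of n] by (simp add: divide_inverse_commute)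
      qed
      ultimately show "(\<lambda>n. G n x) \<longlonglongrightarrow> ?D x"
        by (simp add: tendsto_norm_zero_iff LIM_zero_iff)
    qed
    show "AE x in lborel. norm (G n x) \<le> indicator (cball 0 (R + norm e)) x *\<^sub>R B" for n
    proof (rule AE_I2)
      fix x
      show "norm (G n x) \<le> indicator (cball 0 (R + norm e)) x *\<^sub>R B"
      proof (cases "x \<in> cball 0 (R + norm e)")
        case True
        have "norm (F (x + t n *\<^sub>R e) - F (x + 0 *\<^sub>R e)) \<le> B * norm (t n - 0)"
        proof (rule differentiable_bound)
          show "convex {0..t n}" by simp
          show "((\<lambda>s. F (x + s *\<^sub>R e)) has_derivative (\<lambda>h. h *\<^sub>R ?D (x + s *\<^sub>R e))) (at s within {0..t n})" for s
            using line[of x s] has_derivative_at_withinI unfolding has_vector_derivative_def by blast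
          show "onorm (\<lambda>h. h *\<^sub>R ?D (x + s *\<^sub>R e)) \<le> B" for s
          proof (rule onorm_le)
            show "norm (h *\<^sub>R ?D (x + s *\<^sub>R e)) \<le> B * norm h" for h
              using mult_right_mono[OF B[of "x + s *\<^sub>R e"], of "norm h"] by (simp add: mult.commute)
          qed
        qed (use t in \<open>auto simp: less_imp_le\<close>)
        then show ?thesis
          using t(1)[of n] True
            by (simp add: G_def inverse_eq_divide pos_divide_le_eq)
      next
        case False
        then have gt: "norm x > R + norm e" by simp
        have "norm (t n *\<^sub>R e) \<le> norm e"
          using t[of n] mult_right_mono[of "t n" 1 "norm e"] by simp
        then have "norm (x + t n *\<^sub>R e) > R"
          using gt norm_diff_ineq[of x "t n *\<^sub>R e"] by linarith
        then have "F (x + t n *\<^sub>R e) = 0"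
          using R[of "x + t n *\<^sub>R e"] closure_subset[of "{x. F x \<noteq> 0}"] by force
        moreover have "F x = 0"
          using gt R[of x] norm_ge_zero[of e] closure_subset[of "{x. F x \<noteq> 0}"] by force
        ultimately show ?thesis using False by (simp add: G_def)
      qed
    qed
  qed
  moreover have "integral\<^sup>L lborel (G n) = 0" for n
  proof -
    have iF: "integrable lborel F" by (rule test_functions_integrable[OF F])
    let ?T = "(+) (t n *\<^sub>R e)"
    have T: "distr lborel borel ?T = lborel" by (rule lborel_distr_plus)
    have "integrable lborel (\<lambda>x. F (?T x))"
      using iF by (subst integrable_distr_eq[symmetric, of _ _ borel])
        (use T test_functions_measurable[OF F] in simp_all)
    moreover have "integral\<^sup>L lborel (\<lambda>x. F (?T x)) = integral\<^sup>L lborel F"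
      by (subst integral_distr[symmetric, of _ _ borel])
        (use T test_functions_measurable[OF F] in simp_all)
    ultimately show ?thesis
      using iF by (simp add: G_def[abs_def] add.commute)
  qed
  ultimately show ?thesis by (simp add: LIMSEQ_const_iff)
qed

section \<open>Magnetic derivatives and their integration by parts\<close>

lemma smooth_on_potential:
  assumes "open W" "smooth_on W A"
  shows "smooth_on W (\<lambda>x. complex_of_real (A x \<bullet> e))"
  by (intro smooth_on_of_real[OF assms(1)]
      smooth_on_compose_linear[OF assms(1) bounded_linear_inner_left assms(2)])

lemma test_functions_magnetic_deriv:
  assumes u: "u \<in> test_functions S" and W: "S \<subseteq> W" "open W" "smooth_on W A"
  shows "magnetic_deriv A e u \<in> test_functions S"
  unfolding magnetic_deriv_def[abs_def]
  by (intro test_functions_add test_functions_const_mult test_functions_partial_deriv u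
      test_functions_smooth_mult[OF u W(1,2) smooth_on_potential] W)

lemma test_functions_sum:
  "(\<And>i. i \<in> I \<Longrightarrow> f i \<in> test_functions S) \<Longrightarrow> (\<lambda>x. \<Sum>i\<in>I. f i x) \<in> test_functions S"
  by (induction I rule: infinite_finite_induct)
    (auto intro: test_functions_zero test_functions_add)

lemma test_functions_magnetic_laplace:
  assumes u: "u \<in> test_functions S" and W: "S \<subseteq> W" "open W" "smooth_on W A"
  shows "magnetic_laplace A u \<in> test_functions S"
  unfolding magnetic_laplace_def[abs_def]
  by (intro test_functions_sum test_functions_magnetic_deriv[OF _ W] u)

lemma magnetic_deriv_eq:
  "(u has_derivative u') (at x) \<Longrightarrow>
    magnetic_deriv A e u x = \<i> * u' e + of_real (A x \<bullet> e) * u x"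
  by (simp add: magnetic_deriv_def partial_deriv_eq)

lemma magnetic_deriv_add:
  assumes "u \<in> test_functions S" "v \<in> test_functions S'"
  shows "magnetic_deriv A e (\<lambda>x. u x + v x) = (\<lambda>x. magnetic_deriv A e u x + magnetic_deriv A e v x)"
proof
  fix x
  note d = test_functions_has_derivative[OF assms(1), of x] test_functions_has_derivative[OF assms(2), of x]
  show "magnetic_deriv A e (\<lambda>x. u x + v x) x = magnetic_deriv A e u x + magnetic_deriv A e v x"
    using magnetic_deriv_eq[OF has_derivative_add[OF d]] magnetic_deriv_eq[OF d(1)]
      magnetic_deriv_eq[OF d(2)] by (simp add: algebra_simps)
qed

lemma magnetic_deriv_const_mult:
  assumes "u \<in> test_functions S"
  shows "magnetic_deriv A e (\<lambda>x. c * u x) = (\<lambda>x. c * magnetic_deriv A e u x)"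
proof
  fix x
  note d = test_functions_has_derivative[OF assms, of x]
  show "magnetic_deriv A e (\<lambda>x. c * u x) x = c * magnetic_deriv A e u x"
    using magnetic_deriv_eq[OF has_derivative_mult_right[OF d]] magnetic_deriv_eq[OF d]
    by (simp add: algebra_simps)
qed

lemma magnetic_laplace_add:
  assumes "u \<in> test_functions S" "v \<in> test_functions S" "S \<subseteq> W" "open W" "smooth_on W A"
  shows "magnetic_laplace A (\<lambda>x. u x + v x) = (\<lambda>x. magnetic_laplace A u x + magnetic_laplace A v x)"
  using assms
  by (simp add: magnetic_laplace_def fun_eq_iff magnetic_deriv_add[of _ S _ S]
      test_functions_magnetic_deriv sum.distrib)

lemma magnetic_laplace_const_mult:
  assumes "u \<in> test_functions S" "S \<subseteq> W" "open W" "smooth_on W A"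
  shows "magnetic_laplace A (\<lambda>x. c * u x) = (\<lambda>x. c * magnetic_laplace A u x)"
  using assms
  by (simp add: magnetic_laplace_def fun_eq_iff magnetic_deriv_const_mult[of _ S]
      test_functions_magnetic_deriv sum_distrib_left)

text \<open>The potential is real, so its two contributions cancel; what remains is \<open>i\<close>
  times a derivative of \<open>u * cnj v\<close>.\<close>

lemma integral_magnetic_deriv:
  assumes u: "u \<in> test_functions S" and v: "v \<in> test_functions S"
    and W: "S \<subseteq> W" "open W" "smooth_on W A"
  shows "(\<integral>x. magnetic_deriv A e u x * cnj (v x) \<partial>lborel) = (\<integral>x. u x * cnj (magnetic_deriv A e v x) \<partial>lborel)"
proof -
  let ?F = "\<lambda>x. u x * cnj (v x)"
  note int = test_functions_integrable_mult_cnj[of _ S]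
  have F: "?F \<in> test_functions S"
    using test_functions_mult[OF u test_functions_cnj[OF v]] .
  have "magnetic_deriv A e u x * cnj (v x) - u x * cnj (magnetic_deriv A e v x) = \<i> * partial_deriv e ?F x"
    for x
  proof -
    note d = test_functions_has_derivative[OF u, of x] test_functions_has_derivative[OF v, of x]
    show ?thesis
      using partial_deriv_eq[OF has_derivative_mult[OF d(1) has_derivative_cnj[OF d(2)]]]
        magnetic_deriv_eq[OF d(1)] magnetic_deriv_eq[OF d(2)] by (simp add: algebra_simps)
  qed
  then have "(\<integral>x. magnetic_deriv A e u x * cnj (v x) - u x * cnj (magnetic_deriv A e v x) \<partial>lborel) = 0"
    by (simp add: integral_partial_deriv[OF F])
  then show ?thesis
    by (simp add: int u v test_functions_magnetic_deriv[OF _ W])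
qed

lemma integral_magnetic_laplace:
  assumes u: "u \<in> test_functions S" and v: "v \<in> test_functions S"
    and W: "S \<subseteq> W" "open W" "smooth_on W A"
  shows "(\<integral>x. u x * cnj (magnetic_laplace A v x) \<partial>lborel) =
    (\<Sum>e\<in>Basis. \<integral>x. magnetic_deriv A e u x * cnj (magnetic_deriv A e v x) \<partial>lborel)"
proof -
  have D: "magnetic_deriv A e f \<in> test_functions S" if "f \<in> test_functions S" for e f
    by (rule test_functions_magnetic_deriv[OF that W])
  note int = test_functions_integrable_mult_cnj[of _ S]
  show ?thesis
    by (simp add: magnetic_laplace_def sum_distrib_left int u D v
        integral_magnetic_deriv[OF u D[OF v] W])
qed

section \<open>Truncation near the zero set\<close>

lemma has_derivative_cmod_square:
  assumes "(w has_derivative w') (at x)"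
  shows "((\<lambda>x. (cmod (w x))\<^sup>2) has_derivative (\<lambda>v. 2 * (w x \<bullet> w' v))) (at x)"
  using has_derivative_inner[OF assms assms]
  by (simp add: power2_norm_eq_inner inner_commute)

text \<open>The assumption on the real part holds for a real function times a phase whose gradient
  matches \<open>A\<close>. It makes half the derivative of \<open>|w|^2\<close>, times
  \<open>i w\<close>, equal to \<open>|w|^2\<close> times the magnetic derivative of
  \<open>w\<close>, so both terms of the product rule are real multiples of that derivative.\<close>

lemma magnetic_deriv_radial:
  assumes w: "(w has_derivative w') (at x)"
    and h: "(h has_real_derivative h') (at ((cmod (w x))\<^sup>2))"
    and im: "Re (cnj (w x) * magnetic_deriv A e w x) = 0"
  shows "magnetic_deriv A e (\<lambda>x. of_real (h ((cmod (w x))\<^sup>2)) * w x) x =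
    of_real (h ((cmod (w x))\<^sup>2) + 2 * (cmod (w x))\<^sup>2 * h') * magnetic_deriv A e w x"
proof -
  let ?n = "(cmod (w x))\<^sup>2" and ?a = "A x \<bullet> e"
  have "((\<lambda>x. h ((cmod (w x))\<^sup>2)) has_derivative (\<lambda>v. 2 * (w x \<bullet> w' v) * h')) (at x)"
    by (rule has_derivative_compose[OF has_derivative_cmod_square[OF w], of h "\<lambda>t. t * h'"])
      (use h in \<open>simp add: has_field_derivative_def mult_commute_abs\<close>)
  note d = has_derivative_mult[OF has_derivative_of_real[OF this] w]
  have D: "magnetic_deriv A e w x = \<i> * w' e + of_real ?a * w x"
    by (rule magnetic_deriv_eq[OF w])
  have "Re (w x) * Im (w' e) - Im (w x) * Re (w' e) = ?a * ?n"
    using im unfolding D cmod_power2 by (simp add: algebra_simps power2_eq_square)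
  then have k: "\<i> * of_real (w x \<bullet> w' e) * w x = of_real ?n * (\<i> * w' e + of_real ?a * w x)"
    unfolding complex_eq_iff cmod_power2 inner_complex_def
    by simp algebra
  have "magnetic_deriv A e (\<lambda>x. of_real (h ((cmod (w x))\<^sup>2)) * w x) x =
      of_real (h ?n) * magnetic_deriv A e w x + 2 * of_real h' * (\<i> * of_real (w x \<bullet> w' e) * w x)"
    unfolding magnetic_deriv_eq[OF d] D by (simp add: algebra_simps)
  then show ?thesis
    unfolding k D[symmetric] by (simp add: algebra_simps)
qed

lemma smooth_on_cmod_square:
  "smooth_on S w \<Longrightarrow> open S \<Longrightarrow> smooth_on S (\<lambda>x. (cmod (w x))\<^sup>2)"
  by (simp add: power2_norm_eq_inner smooth_on_bilinear[OF _ bounded_bilinear_inner])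

text \<open>With \<open>t = |w|^2 / \<epsilon>^2\<close>, the first expression contains the
  multiplier that \<open>magnetic_deriv_radial\<close> gives for the truncation error, and the
  second is the size of that error divided by \<epsilon>. The constant is \<open>11 = 3 + 8\<close>,
  from the two bounds in \<open>*\<close>.\<close>

lemma flat_cutoff_bounds:
  assumes "0 \<le> t"
  shows "(1 + t) * \<bar>1 - flat (t - 1) - 2 * t * (flat (t - 1) / (t - 1)\<^sup>2)\<bar> \<le> 11"
    and "sqrt t * (1 - flat (t - 1)) \<le> 3"
proof -
  have *: "(1 + t) * (1 - flat (t - 1)) \<le> 3 \<and> (1 + t) * (2 * t * (flat (t - 1) / (t - 1)\<^sup>2)) \<le> 8"
  proof (cases "t \<le> 1")
    case True
    then show ?thesis by (simp add: flat_def)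
  next
    case False
    \<comment> \<open>In this variable the flat function is \<open>exp (- y)\<close>.\<close>
    define y where "y = 1 / (t - 1)"
    have y: "y > 0" and t: "t = 1 + 1 / y" using False by (auto simp: y_def)
    have fl: "flat (t - 1) = exp (- y)" using False by (simp add: flat_def y_def)
    have "(1 + t) * (1 - flat (t - 1)) \<le> 3"
    proof (cases "y \<le> 1")
      case True
      have "(1 + t) * (1 - flat (t - 1)) \<le> (2 + 1 / y) * y"
        using exp_ge_add_one_self[of "- y"] y unfolding fl by (intro mult_mono) (auto simp: t)
      also have "\<dots> = 2 * y + 1" using y by (simp add: field_simps)
      finally show ?thesis using True by simp
    next
      case False
      have "(1 + t) * (1 - flat (t - 1)) \<le> (1 + t) * 1"
        using assms by (intro mult_left_mono) (auto simp: flat_bounds)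
      also have "\<dots> \<le> 3" using False y by (simp add: t)
      finally show ?thesis .
    qed
    moreover have "(1 + t) * (2 * t * (flat (t - 1) / (t - 1)\<^sup>2)) = 2 * ((2 * y + 1) * (y + 1)) * exp (- y)"
      unfolding fl using y by (simp add: t power2_eq_square field_simps)
    moreover have "(2 * y + 1) * (y + 1) * exp (- y) \<le> 4"
    proof -
      \<comment> \<open>Coefficientwise comparison with four times the quadratic Taylor polynomial
        of \<open>exp\<close>.\<close>
      have "(2 * y + 1) * (y + 1) \<le> 4 * (1 + y + y\<^sup>2 / 2)"
        using y by (simp add: power2_eq_square algebra_simps)
      also have "\<dots> \<le> 4 * exp y" using exp_lower_Taylor_quadratic[of y] y by simp
      finally show ?thesis by (simp add: exp_minus field_simps)
    qed
    ultimately show ?thesis by linarith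
  qed
  have "0 \<le> (1 + t) * (1 - flat (t - 1))" "0 \<le> (1 + t) * (2 * t * (flat (t - 1) / (t - 1)\<^sup>2))"
    using assms flat_bounds[of "t - 1"] by auto
  then have "\<bar>(1 + t) * (1 - flat (t - 1)) - (1 + t) * (2 * t * (flat (t - 1) / (t - 1)\<^sup>2))\<bar> \<le> 11"
    using * by linarith
  moreover have "(1 + t) * \<bar>p - q\<bar> = \<bar>(1 + t) * p - (1 + t) * q\<bar>" for p q
    using assms by (simp add: right_diff_distrib[symmetric] abs_mult)
  ultimately show "(1 + t) * \<bar>1 - flat (t - 1) - 2 * t * (flat (t - 1) / (t - 1)\<^sup>2)\<bar> \<le> 11"
    by (simp only:)
  have "sqrt t \<le> 1 + t"
    using assms by (intro real_le_lsqrt) (auto simp: power2_eq_square algebra_simps)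
  then have "sqrt t * (1 - flat (t - 1)) \<le> (1 + t) * (1 - flat (t - 1))"
    using flat_bounds[of "t - 1"] by (intro mult_right_mono) auto
  then show "sqrt t * (1 - flat (t - 1)) \<le> 3" using * by linarith
qed

text \<open>The shift by -1 makes it vanish where \<open>|w| <= \<epsilon>\<close>, so its support
  stays off the zero set of \<open>w\<close>. Where \<open>|w|\<close> is large compared with
  \<epsilon> it is close to \<open>w\<close> without being equal to it.\<close>

definition truncation :: "real \<Rightarrow> (plane \<Rightarrow> complex) \<Rightarrow> plane \<Rightarrow> complex" where
  "truncation \<epsilon> w x = of_real (flat ((cmod (w x))\<^sup>2 / \<epsilon>\<^sup>2 - 1)) * w x"

lemma test_functions_truncation:
  assumes w: "w \<in> test_functions S" and \<epsilon>: "\<epsilon> > 0"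
  shows "truncation \<epsilon> w \<in> test_functions S"
    and "closure {x. truncation \<epsilon> w x \<noteq> 0} \<subseteq> closure {x. w x \<noteq> 0} \<inter> {x. \<epsilon> \<le> cmod (w x)}"
proof -
  have "smooth_on UNIV (\<lambda>x. (cmod (w x))\<^sup>2 * (1 / \<epsilon>\<^sup>2) + (- 1))"
    by (intro smooth_on_add smooth_on_mult smooth_on_const smooth_on_cmod_square
        test_functions_smooth[OF w] open_UNIV)
  then have "smooth_on UNIV (\<lambda>x. (cmod (w x))\<^sup>2 / \<epsilon>\<^sup>2 - 1)" by simp
  then have "smooth_on UNIV (\<lambda>x. complex_of_real (flat ((cmod (w x))\<^sup>2 / \<epsilon>\<^sup>2 - 1)))"
    by (intro smooth_on_of_real smooth_on_compose_real[OF _ smooth_on_flat]) auto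
  then show "truncation \<epsilon> w \<in> test_functions S"
    unfolding truncation_def[abs_def] by (rule test_functions_smooth_mult[OF w subset_UNIV open_UNIV])
  have sub: "{x. truncation \<epsilon> w x \<noteq> 0} \<subseteq> {x. w x \<noteq> 0} \<inter> {x. \<epsilon> \<le> cmod (w x)}"
  proof safe
    fix x assume "truncation \<epsilon> w x \<noteq> 0"
    then have "(cmod (w x))\<^sup>2 / \<epsilon>\<^sup>2 - 1 > 0" by (auto simp: truncation_def flat_def split: if_splits)
    then have "\<epsilon>\<^sup>2 < (cmod (w x))\<^sup>2" using \<epsilon> by (simp add: field_simps)
    then show "\<epsilon> \<le> cmod (w x)" using \<epsilon> by (meson less_imp_le norm_ge_zero power_less_imp_less_base)
  qed (auto simp: truncation_def)
  have "closed {x. \<epsilon> \<le> cmod (w x)}"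
    by (intro closed_Collect_le continuous_on_norm continuous_on_const test_functions_continuous[OF w])
  then show "closure {x. truncation \<epsilon> w x \<noteq> 0} \<subseteq> closure {x. w x \<noteq> 0} \<inter> {x. \<epsilon> \<le> cmod (w x)}"
    using sub closure_subset[of "{x. w x \<noteq> 0}"] by (intro closure_minimal closed_Int) auto
qed

lemma truncation_diff:
  "w x - truncation \<epsilon> w x = of_real (1 - flat ((cmod (w x))\<^sup>2 / \<epsilon>\<^sup>2 - 1)) * w x"
  by (simp add: truncation_def algebra_simps)

lemma truncation_error:
  assumes "\<epsilon> > 0" shows "cmod (w x - truncation \<epsilon> w x) \<le> 3 * \<epsilon>"
proof -
  let ?t = "(cmod (w x))\<^sup>2 / \<epsilon>\<^sup>2"
  have "cmod (w x - truncation \<epsilon> w x) = (1 - flat (?t - 1)) * cmod (w x)"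
    unfolding truncation_diff norm_mult norm_of_real using flat_bounds(2)[of "?t - 1"] by simp
  also have "\<dots> = \<epsilon> * (sqrt ?t * (1 - flat (?t - 1)))"
    using assms by (simp add: real_sqrt_divide field_simps)
  also have "\<dots> \<le> \<epsilon> * 3"
    using assms flat_cutoff_bounds(2)[of ?t] by (intro mult_left_mono) auto
  finally show ?thesis by simp
qed

text \<open>Testing the equation with \<open>w / sqrt (1 + \<bar>w\<bar>\<^sup>2 / \<epsilon>\<^sup>2)\<close>, which is bounded by \<open>\<epsilon>\<close>, controls the energy
  of \<open>w\<close> where \<open>\<bar>w\<bar>\<close> is of order \<open>\<epsilon>\<close>; this energy dominates that of the truncation error.\<close>
lemma truncation_energy:
  assumes w: "w \<in> test_functions S" and W: "S \<subseteq> W" "open W" "smooth_on W A" and \<epsilon>: "\<epsilon> > 0"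
    and im: "\<And>x e. Re (cnj (w x) * magnetic_deriv A e w x) = 0"
  shows "(\<Sum>e\<in>Basis. \<integral>x. (cmod (magnetic_deriv A e (\<lambda>x. w x - truncation \<epsilon> w x) x))\<^sup>2 \<partial>lborel)
    \<le> 121 * \<epsilon> * (\<integral>x. cmod (magnetic_laplace A w x) \<partial>lborel)"
proof -
  let ?D = "magnetic_deriv A"
  define t where "t x = (cmod (w x))\<^sup>2 / \<epsilon>\<^sup>2" for x
  have t: "t x \<ge> 0" for x by (simp add: t_def)
  have D: "?D e f \<in> test_functions S" if "f \<in> test_functions S" for e f
    by (rule test_functions_magnetic_deriv[OF that W])
  note int = test_functions_integrable_mult_cnj[of _ S]
  define z where "z x = of_real ((1 + t x) powr (- 1 / 2)) * w x" for x
  have "smooth_on UNIV (\<lambda>x. 1 + (cmod (w x))\<^sup>2 * (1 / \<epsilon>\<^sup>2))"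
    by (intro smooth_on_add smooth_on_mult smooth_on_const smooth_on_cmod_square
        test_functions_smooth[OF w] open_UNIV)
  then have "smooth_on UNIV (\<lambda>x. 1 + t x)" by (simp add: t_def)
  then have "smooth_on UNIV (\<lambda>x. complex_of_real ((1 + t x) powr (- 1 / 2)))"
    by (intro smooth_on_of_real smooth_on_compose_real[OF _ smooth_on_powr])
      (use t in \<open>auto intro: add_pos_nonneg\<close>)
  then have z: "z \<in> test_functions S"
    unfolding z_def[abs_def] by (rule test_functions_smooth_mult[OF w subset_UNIV open_UNIV])
  have zbound: "cmod (z x) \<le> \<epsilon>" for x
  proof -
    have pos: "1 + t x > 0" using t[of x] by simp
    have "(1 + t x) powr (- 1 / 2) = inverse (sqrt (1 + t x))"
      using powr_minus[of "1 + t x" "1 / 2"] pos by (simp add: powr_half_sqrt)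
    moreover have "cmod (z x) = (1 + t x) powr (- 1 / 2) * cmod (w x)"
      unfolding z_def norm_mult norm_of_real by (simp only: abs_of_nonneg powr_ge_zero)
    ultimately have eq: "cmod (z x) = inverse (sqrt (1 + t x)) * cmod (w x)"
      by (simp only:)
    have "cmod (w x) = \<epsilon> * sqrt (t x)" using \<epsilon> by (simp add: t_def real_sqrt_divide)
    also have "\<dots> \<le> \<epsilon> * sqrt (1 + t x)" using \<epsilon> by (intro mult_left_mono) auto
    finally have "inverse (sqrt (1 + t x)) * cmod (w x) \<le> inverse (sqrt (1 + t x)) * (\<epsilon> * sqrt (1 + t x))"
      using pos by (intro mult_left_mono) auto
    also have "\<dots> = \<epsilon>"
      using pos by (simp add: field_simps)
    finally show ?thesis unfolding eq .
  qed
  define y where "y x = w x - truncation \<epsilon> w x" for x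
  have y: "y \<in> test_functions S"
    using test_functions_add[OF w test_functions_const_mult[OF test_functions_truncation(1)[OF w \<epsilon>], of "- 1"]]
    by (simp add: y_def[abs_def])
  \<comment> \<open>The multiplier in \<open>magnetic_deriv_radial\<close> is
    \<open>(1 + t) powr (-1/2) - t * (1 + t) powr (-3/2)\<close>, which collapses to a single
    power.\<close>
  have Dz: "?D e z x = of_real ((1 + t x) powr (- 3 / 2)) * ?D e w x" for e x
  proof -
    let ?h = "\<lambda>s. (1 + s / \<epsilon>\<^sup>2) powr (- 1 / 2)"
    have pos: "1 + t x > 0" using t[of x] by simp
    have h: "(?h has_real_derivative (- 1 / 2) * (1 + t x) powr (- 3 / 2) / \<epsilon>\<^sup>2) (at ((cmod (w x))\<^sup>2))"
    proof -
      have "((\<lambda>s. 1 + s / \<epsilon>\<^sup>2) has_real_derivative 1 / \<epsilon>\<^sup>2) (at ((cmod (w x))\<^sup>2))"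
        using DERIV_add[OF DERIV_const DERIV_cdivide[OF DERIV_ident]] by simp
      from DERIV_chain2[OF has_real_derivative_powr this, of "- 1 / 2"] pos
      show ?thesis by (simp add: t_def)
    qed
    have z': "z = (\<lambda>x. of_real (?h ((cmod (w x))\<^sup>2)) * w x)"
      by (simp add: z_def t_def fun_eq_iff)
    have "(1 + t x) powr (- 1 / 2) = (1 + t x) * (1 + t x) powr (- 3 / 2)"
      using pos by (simp add: powr_mult_base)
    then have "?h ((cmod (w x))\<^sup>2) + 2 * (cmod (w x))\<^sup>2 * ((- 1 / 2) * (1 + t x) powr (- 3 / 2) / \<epsilon>\<^sup>2)
        = (1 + t x) powr (- 3 / 2)"
      unfolding t_def by (simp add: distrib_right)
    then show ?thesis
      unfolding z' magnetic_deriv_radial[OF test_functions_has_derivative[OF w] h im] by (simp only:)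
  qed
  have Dy: "?D e y x = of_real (1 - flat (t x - 1) - 2 * t x * (flat (t x - 1) / (t x - 1)\<^sup>2)) * ?D e w x"
    for e x
  proof -
    let ?h = "\<lambda>s. 1 - flat (s / \<epsilon>\<^sup>2 - 1)"
    have "((\<lambda>s. s / \<epsilon>\<^sup>2 - 1) has_real_derivative 1 / \<epsilon>\<^sup>2) (at ((cmod (w x))\<^sup>2))"
      using DERIV_diff[OF DERIV_cdivide[OF DERIV_ident] DERIV_const] by simp
    from DERIV_chain2[OF flat_deriv this]
    have h: "(?h has_real_derivative - (flat (t x - 1) / (t x - 1)\<^sup>2 * (1 / \<epsilon>\<^sup>2))) (at ((cmod (w x))\<^sup>2))"
      unfolding t_def by (auto intro!: derivative_eq_intros)
    have y': "y = (\<lambda>x. of_real (?h ((cmod (w x))\<^sup>2)) * w x)"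
      by (simp only: y_def fun_eq_iff truncation_diff) simp
    have "?h ((cmod (w x))\<^sup>2) + 2 * (cmod (w x))\<^sup>2 * - (flat (t x - 1) / (t x - 1)\<^sup>2 * (1 / \<epsilon>\<^sup>2))
        = 1 - flat (t x - 1) - 2 * t x * (flat (t x - 1) / (t x - 1)\<^sup>2)"
      by (simp add: t_def)
    then show ?thesis
      unfolding y' magnetic_deriv_radial[OF test_functions_has_derivative[OF w] h im] by (simp only:)
  qed
  \<comment> \<open>The multiplier of the error is at most \<open>11 / (1 + t)\<close>; its square
    \<open>121 / (1 + t)^2\<close> is dominated by \<open>121 * (1 + t) powr (-3/2)\<close>, the
    multiplier for \<open>z\<close>.\<close>
  have pointwise: "(cmod (?D e y x))\<^sup>2 \<le> 121 * Re (?D e z x * cnj (?D e w x))" for e x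
  proof -
    define c where "c = 1 - flat (t x - 1) - 2 * t x * (flat (t x - 1) / (t x - 1)\<^sup>2)"
    have pos: "1 + t x \<ge> 1" using t[of x] by simp
    have "((1 + t x) * \<bar>c\<bar>)\<^sup>2 \<le> 11\<^sup>2"
      unfolding c_def using flat_cutoff_bounds(1)[OF t[of x]] t[of x] by (intro power_mono) auto
    then have "c\<^sup>2 \<le> 121 / (1 + t x)\<^sup>2"
      using pos by (simp add: power_mult_distrib pos_le_divide_eq mult.commute)
    also have "\<dots> = 121 * (1 + t x) powr (- 2)"
      using pos by (simp add: powr_minus powr_realpow divide_inverse flip: powr_numeral)
    also have "\<dots> \<le> 121 * (1 + t x) powr (- 3 / 2)"
      using pos by (intro mult_left_mono powr_mono) auto
    finally have c: "c\<^sup>2 \<le> 121 * (1 + t x) powr (- 3 / 2)" .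
    have "(cmod (?D e y x))\<^sup>2 = c\<^sup>2 * (cmod (?D e w x))\<^sup>2"
      unfolding Dy c_def[symmetric] by (simp add: norm_mult power_mult_distrib)
    also have "\<dots> \<le> 121 * (1 + t x) powr (- 3 / 2) * (cmod (?D e w x))\<^sup>2"
      using c by (intro mult_right_mono) auto
    also have "\<dots> = 121 * Re (?D e z x * cnj (?D e w x))"
      unfolding Dz mult.assoc complex_mult_cnj by (simp add: cmod_power2)
    finally show ?thesis .
  qed
  have "(\<Sum>e\<in>Basis. \<integral>x. (cmod (?D e y x))\<^sup>2 \<partial>lborel)
      \<le> (\<Sum>e\<in>Basis. \<integral>x. 121 * Re (?D e z x * cnj (?D e w x)) \<partial>lborel)"
  proof (intro sum_mono integral_mono pointwise)
    fix e show "integrable lborel (\<lambda>x. (cmod (?D e y x))\<^sup>2)"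
      using square_int_test_functions[OF D[OF y]] by (simp add: square_int_def)
    show "integrable lborel (\<lambda>x. 121 * Re (?D e z x * cnj (?D e w x)))"
      by (intro integrable_mult_right integrable_Re int D z w)
  qed
  also have "\<dots> = 121 * Re (\<Sum>e\<in>Basis. \<integral>x. ?D e z x * cnj (?D e w x) \<partial>lborel)"
    by (simp only: integral_mult_right_zero integral_Re[OF int[OF D[OF z] D[OF w]]] Re_sum
        sum_distrib_left[symmetric])
  \<comment> \<open>Integration by parts moves all derivatives to \<open>w\<close>, and only the
    bound on \<open>|z|\<close> is left to use.\<close>
  also have "\<dots> = 121 * Re (\<integral>x. z x * cnj (magnetic_laplace A w x) \<partial>lborel)"
    using integral_magnetic_laplace[OF z w W] by simp
  also have "\<dots> \<le> 121 * (\<epsilon> * (\<integral>x. cmod (magnetic_laplace A w x) \<partial>lborel))"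
  proof (rule mult_left_mono)
    have Lw: "magnetic_laplace A w \<in> test_functions S"
      by (rule test_functions_magnetic_laplace[OF w W])
    have "Re (\<integral>x. z x * cnj (magnetic_laplace A w x) \<partial>lborel)
        \<le> cmod (\<integral>x. z x * cnj (magnetic_laplace A w x) \<partial>lborel)"
      by (rule complex_Re_le_cmod)
    also have "\<dots> \<le> (\<integral>x. cmod (z x * cnj (magnetic_laplace A w x)) \<partial>lborel)"
      by (rule integral_norm_bound)
    also have "\<dots> \<le> (\<integral>x. \<epsilon> * cmod (magnetic_laplace A w x) \<partial>lborel)"
      using zbound
      by (intro integral_mono integrable_norm int z Lw integrable_mult_right
          test_functions_integrable[OF Lw]) (auto simp: norm_mult intro: mult_right_mono)
    finally show "Re (\<integral>x. z x * cnj (magnetic_laplace A w x) \<partial>lborel)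
        \<le> \<epsilon> * (\<integral>x. cmod (magnetic_laplace A w x) \<partial>lborel)" by simp
  qed simp
  finally show ?thesis by (simp add: y_def[abs_def] mult.assoc)
qed

section \<open>Test functions are dense\<close>

text \<open>Open boxes form an intersection stable generator of the Borel sets. For complements the
  total integral must vanish too, which holds because \<open>f\<close> lives in one box.\<close>

lemma set_integral_eq_0_imp_AE_eq_0:
  fixes f :: "'a::euclidean_space \<Rightarrow> real"
  assumes f: "integrable lborel f" and Q: "\<And>x. x \<notin> box p q \<Longrightarrow> f x = 0"
    and box: "\<And>c d. (\<integral>x\<in>box c d. f x \<partial>lborel) = 0"
  shows "AE x in lborel. f x = 0"
proof (rule density_unique_real[OF f])
  have si: "set_integrable lborel A f" if "A \<in> sets borel" for A
    unfolding set_integrable_def by (rule integrable_mult_indicator[OF _ f]) (simp add: that)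
  have total: "(\<integral>x. f x \<partial>lborel) = 0"
  proof -
    have "(\<lambda>x. indicator (box p q) x *\<^sub>R f x) = f" using Q by (auto simp: fun_eq_iff indicator_def)
    then show ?thesis using box[of p q] by (simp add: set_lebesgue_integral_def)
  qed
  have Int_stable: "Int_stable (range (\<lambda>(a, b). box a b :: 'a set))"
    by (auto simp: Int_stable_def box_Int_box)
  have subset: "range (\<lambda>(a, b). box a b :: 'a set) \<subseteq> Pow UNIV" by simp
  fix A :: "'a set" assume "A \<in> sets lborel"
  then have "A \<in> sigma_sets UNIV (range (\<lambda>(a, b). box a b))"
    by (simp add: borel_eq_box)
  with Int_stable subset have "(\<integral>x\<in>A. f x \<partial>lborel) = 0"
  proof (induction rule: sigma_sets_induct_disjoint)
    case (basic A)
    then show ?case using box by auto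
  next
    case (compl A)
    then have A: "A \<in> sets borel" by (simp add: borel_eq_box)
    have "(\<integral>x. f x \<partial>lborel) = (\<integral>x\<in>A. f x \<partial>lborel) + (\<integral>x\<in>UNIV - A. f x \<partial>lborel)"
      using A by (subst set_integral_Un[symmetric]) (auto simp: si set_lebesgue_integral_def)
    then show ?case using compl total by simp
  next
    case (union F)
    then have F: "F i \<in> sets borel" for i by (auto simp: borel_eq_box)
    have "(\<integral>x\<in>(\<Union>i. F i). f x \<partial>lborel) = (\<Sum>i. \<integral>x\<in>F i. f x \<partial>lborel)"
      using F union by (intro lebesgue_integral_countable_add si) (auto simp: disjoint_family_on_def)
    then show ?case using union by simp
  qed (simp add: set_lebesgue_integral_def)
  then show "(\<integral>x\<in>A. f x \<partial>lborel) = (\<integral>x\<in>A. 0 \<partial>lborel)" by simp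
qed simp

text \<open>Inside the open box the growing scale sends each factor to the limit 1 of
  \<open>flat\<close> at infinity; outside, some factor is zero for every \<open>n\<close>.\<close>

definition box_bump :: "plane \<Rightarrow> plane \<Rightarrow> nat \<Rightarrow> plane \<Rightarrow> real" where
  "box_bump c d n x = flat (real (Suc n) * (fst x - fst c)) * flat (real (Suc n) * (fst d - fst x)) *
     (flat (real (Suc n) * (snd x - snd c)) * flat (real (Suc n) * (snd d - snd x)))"

lemma mem_box_plane:
  fixes c d x :: plane
  shows "x \<in> box c d \<longleftrightarrow> fst c < fst x \<and> fst x < fst d \<and> snd c < snd x \<and> snd x < snd d"
  by (cases c; cases d; cases x) (auto simp: box_def Basis_prod_def)

lemma box_bump_outside: "x \<notin> box c d \<Longrightarrow> box_bump c d n x = 0"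
  by (auto simp: box_bump_def mem_box_plane flat_def zero_less_mult_iff)

lemma box_bump_bounds: "0 \<le> box_bump c d n x" "box_bump c d n x \<le> 1"
  unfolding box_bump_def by (auto intro!: mult_le_one mult_nonneg_nonneg flat_bounds)

lemma test_functions_box_bump:
  assumes "cbox c d \<subseteq> S"
  shows "(\<lambda>x. complex_of_real (box_bump c d n x)) \<in> test_functions S"
proof -
  have sm: "smooth_on UNIV (\<lambda>x::plane. flat (r * L x + s))" if "bounded_linear L" for L r s
    by (intro smooth_on_compose_real[OF open_UNIV smooth_on_flat] smooth_on_add smooth_on_mult
        smooth_on_const smooth_on_linear[OF _ that]) auto
  have "smooth_on UNIV (\<lambda>x. complex_of_real (box_bump c d n x))"
    unfolding box_bump_def right_diff_distrib
    using sm[OF bounded_linear_fst, of "real (Suc n)" "- real (Suc n) * fst c"]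
      sm[OF bounded_linear_fst, of "- real (Suc n)" "real (Suc n) * fst d"]
      sm[OF bounded_linear_snd, of "real (Suc n)" "- real (Suc n) * snd c"]
      sm[OF bounded_linear_snd, of "- real (Suc n)" "real (Suc n) * snd d"]
    by (intro smooth_on_of_real smooth_on_mult open_UNIV) (simp_all add: algebra_simps)
  moreover have "{x. complex_of_real (box_bump c d n x) \<noteq> 0} \<subseteq> cbox c d"
    using box_bump_outside[of _ c d n] box_subset_cbox by fastforce
  from compact_closure_subset[OF compact_cbox this] assms
  have "compact (closure {x. complex_of_real (box_bump c d n x) \<noteq> 0})"
    "closure {x. complex_of_real (box_bump c d n x) \<noteq> 0} \<subseteq> S" by auto
  ultimately show ?thesis by (simp add: test_functions_def)
qed

lemma box_bump_tendsto: "(\<lambda>n. box_bump c d n x) \<longlonglongrightarrow> indicator (box c d) x"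
proof (cases "x \<in> box c d")
  case True
  have lim: "(\<lambda>n. flat (real (Suc n) * s)) \<longlonglongrightarrow> 1" if "s > 0" for s
  proof -
    have "(\<lambda>n. inverse (real (Suc n)) * (- 1 / s)) \<longlonglongrightarrow> 0 * (- 1 / s)"
      by (intro tendsto_mult LIMSEQ_inverse_real_of_nat tendsto_const)
    then have "(\<lambda>n. exp (inverse (real (Suc n)) * (- 1 / s))) \<longlonglongrightarrow> exp 0"
      by (intro tendsto_exp) simp
    moreover have "exp (inverse (real (Suc n)) * (- 1 / s)) = flat (real (Suc n) * s)" for n
      using that by (simp add: flat_def field_simps del: of_nat_Suc)
    ultimately show ?thesis by simp
  qed
  have "(\<lambda>n. box_bump c d n x) \<longlonglongrightarrow> 1 * 1 * (1 * 1)"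
    unfolding box_bump_def using True by (intro tendsto_mult lim) (auto simp: mem_box_plane)
  then show ?thesis using True by simp
qed (simp add: box_bump_outside)

section \<open>Square integrable classes and the totality of test functions\<close>

lemma l2_of_eq_iff:
  assumes "square_int f" "square_int g"
  shows "l2_of f = l2_of g \<longleftrightarrow> (AE x in lborel. f x = g x)"
  using Quotient3_rel[OF Quotient3_l2, of f g] assms by (auto simp: square_int_rel_def)

lemma l2_of_add: "square_int f \<Longrightarrow> square_int g \<Longrightarrow> l2_of f + l2_of g = l2_of (\<lambda>x. f x + g x)"
  by (rule plus_l2.abs_eq) (auto simp: square_int_rel_def)

lemma l2_of_scaleR: "square_int f \<Longrightarrow> r *\<^sub>R l2_of f = l2_of (\<lambda>x. r *\<^sub>R f x)"
  by (rule scaleR_l2.abs_eq) (auto simp: square_int_rel_def)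

lemma cinner_of:
  "square_int f \<Longrightarrow> square_int g \<Longrightarrow> cinner (l2_of f) (l2_of g) = (\<integral>x. f x * cnj (g x) \<partial>lborel)"
  by (rule cinner.abs_eq) (auto simp: square_int_rel_def)

lemma cinner_rep: "square_int g \<Longrightarrow> cinner u (l2_of g) = (\<integral>x. l2_rep u x * cnj (g x) \<partial>lborel)"
  using cinner_of[OF l2_rep_square_int, of g u] by (simp add: l2_of_rep)

lemma square_int_cong_AE:
  assumes "square_int f" "AE x in lborel. cmod (g x) = cmod (f x)" "g \<in> borel_measurable borel"
  shows "square_int g"
proof -
  have "integrable lborel (\<lambda>x. (cmod (g x))\<^sup>2)"
    by (rule integrable_cong_AE_imp[of lborel "\<lambda>x. (cmod (f x))\<^sup>2"])
      (use assms in \<open>auto simp: square_int_def\<close>)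
  then show ?thesis using assms by (simp add: square_int_def)
qed

text \<open>Smooth bumps converge boundedly to indicators of boxes, so orthogonality gives zero
  integrals over boxes and hence zero values almost everywhere on each closed box in
  \<open>S\<close>. Countably many such boxes exhaust \<open>S\<close>.\<close>

lemma l2_test_functions_dense:
  assumes \<Omega>: "open S" and null: "AE x in lborel. x \<in> \<Omega> \<longrightarrow> x \<in> S"
    and f: "f \<in> l2_on \<Omega>" and orth: "\<And>w. w \<in> test_functions S \<Longrightarrow> f \<bullet> l2_of w = 0"
  shows "f = 0"
proof -
  define F where "F = l2_rep f"
  have F: "square_int F" by (simp add: F_def l2_rep_square_int)
  then have meas [measurable]: "F \<in> borel_measurable borel" by (simp add: square_int_def)
  have fF: "f = l2_of F" by (simp add: F_def l2_of_rep)
  have loc: "integrable lborel (\<lambda>x. indicator (cbox c d) x *\<^sub>R F x)" for c d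
  proof -
    have "(\<lambda>x. (cmod (indicator (cbox c d) x))\<^sup>2) = (\<lambda>x. indicator (cbox c d) x *\<^sub>R (1::real))"
      by (auto simp: indicator_def fun_eq_iff)
    then have "square_int (\<lambda>x. indicator (cbox c d) x)"
      using borel_integrable_compact[OF compact_cbox continuous_on_const[of _ "1::real"], of c d]
      by (simp add: square_int_def)
    from square_int_mult[OF F this] show ?thesis
      by (rule Bochner_Integration.integrable_cong[THEN iffD1, rotated 2])
        (auto simp: indicator_def)
  qed
  have int0: "(\<integral>x. F x * cnj (w x) \<partial>lborel) = 0" if w: "w \<in> test_functions S" for w
  proof -
    have "Re (\<integral>x. F x * cnj (w x) \<partial>lborel) = 0"
      using orth[OF w] square_int_test_functions[OF w] F by (simp add: inner_l2_def fF cinner_of)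
    \<comment> \<open>The real inner product sees only real parts; the imaginary part comes from the
      multiple \<open>i w\<close>.\<close>
    moreover have w': "(\<lambda>x. \<i> * w x) \<in> test_functions S" by (rule test_functions_const_mult[OF w])
    have "Re (\<integral>x. F x * cnj (\<i> * w x) \<partial>lborel) = 0"
      using orth[OF w'] square_int_test_functions[OF w'] F by (simp add: inner_l2_def fF cinner_of)
    then have "Re (\<integral>x. - \<i> * (F x * cnj (w x)) \<partial>lborel) = 0" by (simp add: mult_ac)
    then have "Im (\<integral>x. F x * cnj (w x) \<partial>lborel) = 0"
      by (simp only: integral_mult_right_zero) simp
    ultimately show ?thesis by (simp add: complex_eq_iff)
  qed
  have box0: "(\<integral>x. indicator (box c d) x *\<^sub>R F x \<partial>lborel) = 0" if "cbox c d \<subseteq> S" for c d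
  proof -
    have "(\<lambda>n. \<integral>x. box_bump c d n x *\<^sub>R F x \<partial>lborel) \<longlonglongrightarrow> (\<integral>x. indicator (box c d) x *\<^sub>R F x \<partial>lborel)"
    proof (rule integral_dominated_convergence)
      show "integrable lborel (\<lambda>x. norm (indicator (cbox c d) x *\<^sub>R F x))"
        by (rule integrable_norm[OF loc])
      show "AE x in lborel. (\<lambda>n. box_bump c d n x *\<^sub>R F x) \<longlonglongrightarrow> indicator (box c d) x *\<^sub>R F x"
        by (intro AE_I2 tendsto_scaleR box_bump_tendsto tendsto_const)
      show "AE x in lborel. norm (box_bump c d n x *\<^sub>R F x) \<le> norm (indicator (cbox c d) x *\<^sub>R F x)" for n
      proof (intro AE_I2)
        fix x show "norm (box_bump c d n x *\<^sub>R F x) \<le> norm (indicator (cbox c d) x *\<^sub>R F x)"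
          using box_bump_bounds[of c d n x] box_bump_outside[of x c d n] box_subset_cbox[of c d]
          by (cases "x \<in> box c d") (auto simp: mult_left_le_one_le)
      qed
      show "(\<lambda>x. box_bump c d n x *\<^sub>R F x) \<in> borel_measurable lborel" for n
      proof -
        have "(\<lambda>x. Re (complex_of_real (box_bump c d n x))) \<in> borel_measurable borel"
          using test_functions_measurable[OF test_functions_box_bump[OF that]] by measurable
        then show ?thesis by simp
      qed
    qed simp
    moreover have "(\<integral>x. box_bump c d n x *\<^sub>R F x \<partial>lborel) = 0" for n
      using int0[OF test_functions_box_bump[OF that, of n]]
      by (simp add: scaleR_conv_of_real mult.commute)
    ultimately show ?thesis by (simp add: LIMSEQ_const_iff)
  qed
  have AE_box: "AE x in lborel. x \<in> box p q \<longrightarrow> F x = 0" if pq: "cbox p q \<subseteq> S" for p q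
  proof -
    have zero: "AE x in lborel. L (indicator (box p q) x *\<^sub>R F x) = 0"
      if L: "bounded_linear L" for L :: "complex \<Rightarrow> real"
    proof (rule set_integral_eq_0_imp_AE_eq_0[of _ p q])
      have int: "integrable lborel (\<lambda>x. indicator (box p q) x *\<^sub>R F x)"
        by (rule Bochner_Integration.integrable_bound[OF loc[of p q]])
          (use box_subset_cbox[of p q] in \<open>auto simp: indicator_def\<close>)
      then show "integrable lborel (\<lambda>x. L (indicator (box p q) x *\<^sub>R F x))"
        by (rule integrable_bounded_linear[OF L])
      show "L (indicator (box p q) x *\<^sub>R F x) = 0" if "x \<notin> box p q" for x
        using that linear_0[OF bounded_linear.linear[OF L]] by simp
      fix c d :: plane
      obtain c' d' where cd: "box c d \<inter> box p q = box c' d'" by (simp add: box_Int_box)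
      \<comment> \<open>An empty open box can have a nonempty closed box with the same corners,
        possibly outside \<open>S\<close>; hence the condition.\<close>
      have "cbox c' d' \<subseteq> S" if "box c' d' \<noteq> {}"
      proof -
        have "cbox c' d' = closure (box c' d')" using closure_box[OF that] by simp
        also have "\<dots> \<subseteq> closure (box p q)" using cd by (intro closure_mono) auto
        also have "\<dots> \<subseteq> cbox p q" by (intro closure_minimal box_subset_cbox closed_cbox)
        finally show ?thesis using pq by simp
      qed
      then have "(\<integral>x. indicator (box c' d') x *\<^sub>R F x \<partial>lborel) = 0"
        using box0[of c' d'] by (cases "box c' d' = {}") auto
      then have "L (\<integral>x. indicator (box c' d') x *\<^sub>R F x \<partial>lborel) = 0"
        using linear_0[OF bounded_linear.linear[OF L]] by simp
      moreover have eq: "indicator (box c' d') x *\<^sub>R F x = indicator (box c d) x *\<^sub>R indicator (box p q) x *\<^sub>R F x" for x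
        unfolding cd[symmetric] by (simp add: indicator_inter_arith)
      moreover have "integrable lborel (\<lambda>x. indicator (box c d) x *\<^sub>R indicator (box p q) x *\<^sub>R F x)"
        by (rule integrable_mult_indicator[OF _ int]) simp
      ultimately have "(\<integral>x. L (indicator (box c d) x *\<^sub>R indicator (box p q) x *\<^sub>R F x) \<partial>lborel) = 0"
        by (subst integral_bounded_linear[OF L]) auto
      then show "(\<integral>x\<in>box c d. L (indicator (box p q) x *\<^sub>R F x) \<partial>lborel) = 0"
        by (simp add: set_lebesgue_integral_def mult.assoc linear_scale[OF bounded_linear.linear[OF L]])
    qed
    from zero[OF bounded_linear_Re] zero[OF bounded_linear_Im] show ?thesis
      by eventually_elim (auto simp: complex_eq_iff)
  qed
  have "AE x in lborel. x \<in> S \<longrightarrow> F x = 0"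
  proof -
    define B where "B = {box p q |p q :: plane. cbox p q \<subseteq> S}"
    have "\<Union>B = S"
    proof
      show "\<Union>B \<subseteq> S" using box_subset_cbox by (force simp: B_def)
      show "S \<subseteq> \<Union>B"
      proof
        fix x assume "x \<in> S"
        then obtain p q where "cbox p q \<subseteq> S" "x \<in> box p q"
          using open_contains_cbox[OF \<Omega>] by metis
        then show "x \<in> \<Union>B" unfolding B_def by blast
      qed
    qed
    have "openin (top_of_set UNIV) X" if "X \<in> B" for X
      using that by (auto simp: B_def)
    \<comment> \<open>A union of null sets is controlled only for countable families, so the cover
      is thinned out by the Lindelof property.\<close>
    then obtain B' where B': "B' \<subseteq> B" "countable B'" "\<Union>B' = \<Union>B"
      by (rule Lindelof_openin) blast
    have "AE x in lborel. x \<in> X \<longrightarrow> F x = 0" if X: "X \<in> B'" for X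
    proof -
      obtain p q where "X = box p q" "cbox p q \<subseteq> S"
        using X B'(1) unfolding B_def by blast
      then show ?thesis using AE_box by simp
    qed
    then have "AE x in lborel. \<forall>X\<in>B'. x \<in> X \<longrightarrow> F x = 0"
      unfolding AE_ball_countable[OF B'(2)] by blast
    then show ?thesis
    proof (rule eventually_mono)
      fix x assume "\<forall>X\<in>B'. x \<in> X \<longrightarrow> F x = 0"
      then show "x \<in> S \<longrightarrow> F x = 0" using \<open>\<Union>B = S\<close> B'(3) by blast
    qed
  qed
  moreover have "AE x in lborel. x \<notin> \<Omega> \<longrightarrow> F x = 0" using f by (simp add: l2_on_def F_def)
  ultimately have "AE x in lborel. F x = 0" using null by eventually_elim auto
  then show ?thesis
    using l2_of_eq_iff[OF F square_int_zero] by (simp add: fF zero_l2_def)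
qed

section \<open>Graphs of magnetic Laplacians\<close>

text \<open>The potential 0 yields minus the Laplacian, so the same estimates serve both sides of
  the equivalence.\<close>

definition magnetic_graph ::
  "(plane \<Rightarrow> plane) \<Rightarrow> (plane \<Rightarrow> complex) set \<Rightarrow> (l2 \<times> l2) set" where
  "magnetic_graph A X = {(l2_of u, l2_of (magnetic_laplace A u)) |u. u \<in> X}"

lemma l2_of_zero: "l2_of (\<lambda>x. 0) = 0"
  by (simp add: zero_l2_def)

lemma l2_of_diff:
  assumes "square_int f" "square_int g" shows "l2_of f - l2_of g = l2_of (\<lambda>x. f x - g x)"
proof -
  have "l2_of f - l2_of g = l2_of f + (- 1) *\<^sub>R l2_of g" by simp
  also have "\<dots> = l2_of (\<lambda>x. f x + (- 1) *\<^sub>R g x)"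
    by (simp only: l2_of_scaleR[OF assms(2)] l2_of_add[OF assms(1) square_int_scaleR[OF assms(2)]])
  finally show ?thesis by simp
qed

lemma inner_of:
  "square_int f \<Longrightarrow> square_int g \<Longrightarrow> l2_of f \<bullet> l2_of g = Re (\<integral>x. f x * cnj (g x) \<partial>lborel)"
  by (simp add: inner_l2_def cinner_of)

context
  fixes S W :: "plane set" and A :: "plane \<Rightarrow> plane"
  assumes W: "S \<subseteq> W" "open W" "smooth_on W A"
begin

lemma square_int_magnetic_laplace: "u \<in> test_functions S \<Longrightarrow> square_int (magnetic_laplace A u)"
  by (rule square_int_test_functions[OF test_functions_magnetic_laplace[OF _ W]])

lemma cinner_magnetic_laplace:
  assumes "u \<in> test_functions S" "v \<in> test_functions S"
  shows "cinner (l2_of u) (l2_of (magnetic_laplace A v)) =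
    (\<Sum>e\<in>Basis. \<integral>x. magnetic_deriv A e u x * cnj (magnetic_deriv A e v x) \<partial>lborel)"
  by (simp add: cinner_of square_int_test_functions[OF assms(1)] square_int_magnetic_laplace[OF assms(2)]
      integral_magnetic_laplace[OF assms W])

lemma cinner_magnetic_laplace_self:
  assumes "u \<in> test_functions S"
  shows "cinner (l2_of u) (l2_of (magnetic_laplace A u)) =
    of_real (\<Sum>e\<in>Basis. \<integral>x. (cmod (magnetic_deriv A e u x))\<^sup>2 \<partial>lborel)"
  by (simp add: cinner_magnetic_laplace[OF assms assms] complex_norm_square[symmetric] flip: integral_of_real of_real_power)

lemma nonneg_op_magnetic_graph:
  assumes X: "X \<subseteq> test_functions S" "(\<lambda>x. 0) \<in> X"
    and add: "\<And>u v. u \<in> X \<Longrightarrow> v \<in> X \<Longrightarrow> (\<lambda>x. u x + v x) \<in> X"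
    and scale: "\<And>u r. u \<in> X \<Longrightarrow> (\<lambda>x. of_real r * u x) \<in> X"
  shows "nonneg_op (magnetic_graph A X)"
proof -
  have test: "u \<in> test_functions S" if "u \<in> X" for u using X that by auto
  note sq = square_int_test_functions[OF test] square_int_magnetic_laplace[OF test]
  have "subspace (magnetic_graph A X)"
  proof (rule subspaceI)
    have "magnetic_laplace A (\<lambda>x. 0) = (\<lambda>x. 0)"
      using magnetic_laplace_const_mult[OF test_functions_zero W, of 0] by simp
    then show "0 \<in> magnetic_graph A X"
      using X(2) by (force simp: magnetic_graph_def zero_prod_def l2_of_zero)
    fix p assume "p \<in> magnetic_graph A X"
    then obtain u where u: "u \<in> X" "p = (l2_of u, l2_of (magnetic_laplace A u))"
      by (auto simp: magnetic_graph_def)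
    show "r *\<^sub>R p \<in> magnetic_graph A X" for r
      using scale[OF u(1), of r] sq[OF u(1)] magnetic_laplace_const_mult[OF test[OF u(1)] W, of "of_real r"]
      by (auto simp: magnetic_graph_def u(2) l2_of_scaleR scaleR_conv_of_real
          intro!: exI[of _ "\<lambda>x. of_real r * u x"])
    fix q assume "q \<in> magnetic_graph A X"
    then obtain v where v: "v \<in> X" "q = (l2_of v, l2_of (magnetic_laplace A v))"
      by (auto simp: magnetic_graph_def)
    show "p + q \<in> magnetic_graph A X"
      using add[OF u(1) v(1)] sq[OF u(1)] sq[OF v(1)]
        magnetic_laplace_add[OF test[OF u(1)] test[OF v(1)] W]
      by (auto simp: magnetic_graph_def u(2) v(2) l2_of_add intro!: exI[of _ "\<lambda>x. u x + v x"])
  qed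
  moreover have "l2_of u \<bullet> l2_of (magnetic_laplace A v) = l2_of (magnetic_laplace A u) \<bullet> l2_of v"
    if "u \<in> X" "v \<in> X" for u v
  proof -
    have int: "integrable lborel (\<lambda>x. magnetic_deriv A e f x * cnj (magnetic_deriv A e g x))"
      if "f \<in> X" "g \<in> X" for e f g
      using that by (intro square_int_mult square_int_test_functions[of _ S]
          test_functions_magnetic_deriv[OF test W])
    have "l2_of u \<bullet> l2_of (magnetic_laplace A v) =
        (\<Sum>e\<in>Basis. Re (\<integral>x. magnetic_deriv A e u x * cnj (magnetic_deriv A e v x) \<partial>lborel))"
      by (simp add: inner_l2_def cinner_magnetic_laplace test that)
    also have "\<dots> = (\<Sum>e\<in>Basis. Re (\<integral>x. magnetic_deriv A e v x * cnj (magnetic_deriv A e u x) \<partial>lborel))"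
    proof (intro sum.cong refl)
      fix e :: plane
      show "Re (\<integral>x. magnetic_deriv A e u x * cnj (magnetic_deriv A e v x) \<partial>lborel) =
          Re (\<integral>x. magnetic_deriv A e v x * cnj (magnetic_deriv A e u x) \<partial>lborel)"
        unfolding integral_Re[OF int[OF that], symmetric] integral_Re[OF int[OF that(2,1)], symmetric]
        by (intro Bochner_Integration.integral_cong) (auto simp: algebra_simps)
    qed
    also have "\<dots> = l2_of v \<bullet> l2_of (magnetic_laplace A u)"
      by (simp add: inner_l2_def cinner_magnetic_laplace test that)
    finally show ?thesis by (simp add: inner_commute)
  qed
  moreover have "0 \<le> l2_of u \<bullet> l2_of (magnetic_laplace A u)" if "u \<in> X" for u
    by (simp add: inner_l2_def cinner_magnetic_laplace_self test that sum_nonneg)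
  ultimately show ?thesis
    unfolding nonneg_op_def by (auto simp: magnetic_graph_def)
qed

text \<open>The error is at most \<open>3 \<epsilon>\<close> on the compact support of
  \<open>w\<close>, which bounds its norm, and \<open>truncation_energy\<close> bounds its energy;
  both are of order \<epsilon> for fixed \<open>w\<close>.\<close>

lemma form_dense_truncation:
  assumes X: "X \<subseteq> test_functions S"
    and im: "\<And>w x e. w \<in> X \<Longrightarrow> Re (cnj (w x) * magnetic_deriv A e w x) = 0"
    and Y: "\<And>w \<epsilon>. w \<in> X \<Longrightarrow> \<epsilon> > 0 \<Longrightarrow> truncation \<epsilon> w \<in> Y"
  shows "form_dense (magnetic_graph A Y) (magnetic_graph A X)"
  unfolding form_dense_def
proof (clarify)
  fix v g and \<delta> :: real assume "(v, g) \<in> magnetic_graph A X" and \<delta>: "\<delta> > 0"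
  then obtain w where w: "w \<in> X" and vg: "v = l2_of w" "g = l2_of (magnetic_laplace A w)"
    by (auto simp: magnetic_graph_def)
  have wS: "w \<in> test_functions S" using w X by auto
  let ?K = "closure {x. w x \<noteq> 0}"
  define m where "m = sqrt (measure lborel ?K)"
  define I where "I = (\<integral>x. cmod (magnetic_laplace A w x) \<partial>lborel)"
  have nn: "m \<ge> 0" "I \<ge> 0" by (simp_all add: m_def I_def)
  \<comment> \<open>The norm error is at most \<open>3 \<epsilon> m\<close> and the energy error at
    most \<open>121 \<epsilon> I\<close>; the summand 1 keeps the denominator positive and the
    bounds strict.\<close>
  define \<epsilon> where "\<epsilon> = \<delta> / (1 + 3 * m + 121 * I)"
  have \<epsilon>: "\<epsilon> > 0" using \<delta> nn by (simp add: \<epsilon>_def add_pos_nonneg)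
  have "\<epsilon> * (1 + 3 * m + 121 * I) = \<delta>" using nn by (simp add: \<epsilon>_def add_nonneg_eq_0_iff)
  moreover have "\<epsilon> * m \<ge> 0" "\<epsilon> * I \<ge> 0" using \<epsilon> nn by auto
  ultimately have small: "3 * (\<epsilon> * m) < \<delta>" "121 * (\<epsilon> * I) < \<delta>"
    using \<epsilon> unfolding distrib_left by linarith+
  let ?w = "truncation \<epsilon> w"
  have tS: "?w \<in> test_functions S" by (rule test_functions_truncation(1)[OF wS \<epsilon>])
  define y where "y x = w x - ?w x" for x
  have yS: "y \<in> test_functions S"
    using test_functions_add[OF wS test_functions_const_mult[OF tS, of "- 1"]]
    by (simp add: y_def[abs_def])
  have v: "v - l2_of ?w = l2_of y"
    unfolding vg y_def[abs_def] by (intro l2_of_diff square_int_test_functions[of _ S] wS tS)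
  have "magnetic_laplace A y = (\<lambda>x. magnetic_laplace A w x - magnetic_laplace A ?w x)"
    using magnetic_laplace_add[OF wS test_functions_const_mult[OF tS, of "- 1"] W]
      magnetic_laplace_const_mult[OF tS W, of "- 1"] by (simp add: y_def[abs_def])
  then have g: "g - l2_of (magnetic_laplace A ?w) = l2_of (magnetic_laplace A y)"
    unfolding vg by (simp add: l2_of_diff square_int_magnetic_laplace wS tS)
  have "(norm (l2_of y))\<^sup>2 = Re (\<integral>x. y x * cnj (y x) \<partial>lborel)"
    by (simp add: power2_norm_eq_inner inner_of square_int_test_functions[OF yS])
  also have "\<dots> = Re (\<integral>x. of_real ((cmod (y x))\<^sup>2) \<partial>lborel)"
    by (simp only: complex_norm_square)
  also have "\<dots> = (\<integral>x. (cmod (y x))\<^sup>2 \<partial>lborel)"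
    by (simp only: integral_complex_of_real Re_complex_of_real)
  also have "\<dots> \<le> (\<integral>x. indicator ?K x *\<^sub>R (3 * \<epsilon>)\<^sup>2 \<partial>lborel)"
  proof (rule integral_mono)
    show "integrable lborel (\<lambda>x. (cmod (y x))\<^sup>2)"
      using square_int_test_functions[OF yS] by (simp add: square_int_def)
    show "integrable lborel (\<lambda>x. indicator ?K x *\<^sub>R (3 * \<epsilon>)\<^sup>2)"
      by (rule borel_integrable_compact[OF test_functions_compact[OF wS]]) simp
    fix x show "(cmod (y x))\<^sup>2 \<le> indicator ?K x *\<^sub>R (3 * \<epsilon>)\<^sup>2"
    proof (cases "x \<in> ?K")
      case True
      then show ?thesis
        using power_mono[OF truncation_error[OF \<epsilon>, of w x] norm_ge_zero, of 2] by (simp add: y_def)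
    next
      case False
      then have "w x = 0" using closure_subset[of "{x. w x \<noteq> 0}"] by auto
      then show ?thesis by (simp add: y_def truncation_def)
    qed
  qed
  also have "\<dots> = (3 * (\<epsilon> * m))\<^sup>2"
    by (simp add: m_def power_mult_distrib)
  finally have "norm (l2_of y) \<le> 3 * (\<epsilon> * m)"
    by (rule power2_le_imp_le) (use \<epsilon> nn in simp)
  then have 1: "norm (v - l2_of ?w) < \<delta>" unfolding v using small by simp
  have "(v - l2_of ?w) \<bullet> (g - l2_of (magnetic_laplace A ?w)) =
      (\<Sum>e\<in>Basis. \<integral>x. (cmod (magnetic_deriv A e y x))\<^sup>2 \<partial>lborel)"
    unfolding v g inner_l2_def cinner_magnetic_laplace_self[OF yS] by simp
  also have "\<dots> \<le> 121 * \<epsilon> * I"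
    unfolding y_def[abs_def] I_def by (rule truncation_energy[OF wS W \<epsilon> im[OF w]])
  finally have 2: "(v - l2_of ?w) \<bullet> (g - l2_of (magnetic_laplace A ?w)) < \<delta>"
    using small by (simp add: mult.assoc)
  show "\<exists>(wa, h)\<in>magnetic_graph A Y. norm (v - wa) < \<delta> \<and> (v - wa) \<bullet> (g - h) < \<delta>"
    using Y[OF w \<epsilon>] 1 2
    by (intro bexI[of _ "(l2_of ?w, l2_of (magnetic_laplace A ?w))"]) (auto simp: magnetic_graph_def)
qed

end

text \<open>On the graph the form is real, so the form domains agree. Passing from the real to the
  complex adjoint relation is left to \<open>adj\<close>, as the reason differs: multiplication by
  \<open>i\<close> in the complex space, reality of \<open>cinner\<close> in the real one.\<close>

lemma friedrichs_eq_real_friedrichs: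
  assumes T: "\<And>v g w h. (v, g) \<in> T \<Longrightarrow> (w, h) \<in> T \<Longrightarrow> (v - w, g - h) \<in> T"
    and pos: "\<And>v g. (v, g) \<in> T \<Longrightarrow> cinner v g = of_real (v \<bullet> g) \<and> 0 \<le> v \<bullet> g"
    and adj: "\<And>u f. u \<in> H \<Longrightarrow> f \<in> H \<Longrightarrow> (\<forall>(v, g)\<in>T. u \<bullet> g = f \<bullet> v) \<Longrightarrow> (\<forall>(v, g)\<in>T. cinner u g = cinner f v)"
  shows "friedrichs H T = real_friedrichs H T"
proof -
  have "form_domain T = real_form_domain T"
    unfolding form_domain_def real_form_domain_def
  proof (intro Collect_cong ex_cong1 conj_cong refl)
    fix s g :: "nat \<Rightarrow> l2" assume "\<forall>n. (s n, g n) \<in> T"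
    then have "(s m - s n, g m - g n) \<in> T" for m n using T by blast
    from pos[OF this] have "cmod (cinner (s m - s n) (g m - g n)) = (s m - s n) \<bullet> (g m - g n)" for m n
      by simp
    then show "(\<forall>\<epsilon>>0. \<exists>N. \<forall>m\<ge>N. \<forall>n\<ge>N. cmod (cinner (s m - s n) (g m - g n)) < \<epsilon>) \<longleftrightarrow>
        (\<forall>\<epsilon>>0. \<exists>N. \<forall>m\<ge>N. \<forall>n\<ge>N. (s m - s n) \<bullet> (g m - g n) < \<epsilon>)" by simp
  qed
  moreover have "(\<forall>(v, g)\<in>T. cinner u g = cinner f v) \<longleftrightarrow> (\<forall>(v, g)\<in>T. u \<bullet> g = f \<bullet> v)"
    if "u \<in> H" "f \<in> H" for u f
    using adj[OF that] by (auto simp: inner_l2_def)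
  ultimately have "(u, f) \<in> friedrichs H T \<longleftrightarrow> (u, f) \<in> real_friedrichs H T" for u f
    unfolding friedrichs_def real_friedrichs_def adjoint_in_def mem_Collect_eq prod.case by blast
  then show ?thesis by auto
qed

section \<open>Pointwise operators on square integrable functions\<close>

definition l2_map :: "((plane \<Rightarrow> complex) \<Rightarrow> plane \<Rightarrow> complex) \<Rightarrow> l2 \<Rightarrow> l2" where
  "l2_map \<Phi> u = l2_of (\<Phi> (l2_rep u))"

definition l2_respects :: "((plane \<Rightarrow> complex) \<Rightarrow> plane \<Rightarrow> complex) \<Rightarrow> bool" where
  "l2_respects \<Phi> \<longleftrightarrow> (\<forall>f g. square_int_rel f g \<longrightarrow> square_int_rel (\<Phi> f) (\<Phi> g))"

lemma l2_respects_square_int: "l2_respects \<Phi> \<Longrightarrow> square_int f \<Longrightarrow> square_int (\<Phi> f)"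
  unfolding l2_respects_def by (drule spec[of _ f], drule spec[of _ f]) (simp add: square_int_rel_def)

lemma l2_map_of:
  assumes "l2_respects \<Phi>" "square_int f" shows "l2_map \<Phi> (l2_of f) = l2_of (\<Phi> f)"
proof -
  have "square_int_rel (l2_rep (l2_of f)) f"
    by (simp add: square_int_rel_def l2_rep_square_int assms l2_rep_of)
  then have "square_int_rel (\<Phi> (l2_rep (l2_of f))) (\<Phi> f)"
    using assms(1) by (simp add: l2_respects_def)
  then show ?thesis unfolding l2_map_def by (rule Quotient3_rel_abs[OF Quotient3_l2])
qed

lemma l2_cases: obtains f where "square_int f" "u = l2_of f"
  using l2_rep_square_int l2_of_rep by metis

lemma linear_l2_map:
  assumes \<Phi>: "l2_respects \<Phi>"
    and add: "\<And>f g. \<Phi> (\<lambda>x. f x + g x) = (\<lambda>x. \<Phi> f x + \<Phi> g x)"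
    and scale: "\<And>f r. \<Phi> (\<lambda>x. r *\<^sub>R f x) = (\<lambda>x. r *\<^sub>R \<Phi> f x)"
  shows "linear (l2_map \<Phi>)"
proof (rule linearI)
  fix u v :: l2 and r :: real
  obtain f g where f: "square_int f" "u = l2_of f" and g: "square_int g" "v = l2_of g"
    by (metis l2_cases)
  note sq = l2_respects_square_int[OF \<Phi> f(1)] l2_respects_square_int[OF \<Phi> g(1)]
  show "l2_map \<Phi> (u + v) = l2_map \<Phi> u + l2_map \<Phi> v"
    by (simp add: f g l2_of_add l2_map_of[OF \<Phi>] square_int_add sq add)
  show "l2_map \<Phi> (r *\<^sub>R u) = r *\<^sub>R l2_map \<Phi> u"
    by (simp only: f l2_of_scaleR l2_map_of[OF \<Phi>] square_int_scaleR sq scale)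
qed

lemma borel_measurable_cnj: "f \<in> borel_measurable M \<Longrightarrow> (\<lambda>x. cnj (f x)) \<in> borel_measurable M"
  using borel_measurable_continuous_onI[OF continuous_on_cnj[OF continuous_on_id]]
  by (auto intro: measurable_compose[where f = f])

section \<open>Invariance of Lebesgue measure under the reflection\<close>

lemma distr_reflect: "distr lborel borel reflect = (lborel :: plane measure)"
proof -
  let ?c = "\<lambda>j::plane. if j = (1, 0) then 1 else - 1 :: real"
  have "(\<lambda>x::plane. 0 + (\<Sum>j\<in>Basis. (?c j * (x \<bullet> j)) *\<^sub>R j)) = reflect"
    by (auto simp: fun_eq_iff reflect_def Basis_prod_def sum.union_disjoint)
  moreover have "(\<Prod>j\<in>Basis. \<bar>?c j\<bar>) = 1"
    by (intro prod.neutral) auto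
  moreover have "lborel = density (distr lborel borel (\<lambda>x::plane. 0 + (\<Sum>j\<in>Basis. (?c j * (x \<bullet> j)) *\<^sub>R j)))
      (\<lambda>_. (\<Prod>j\<in>Basis. \<bar>?c j\<bar>))"
    by (rule lborel_affine_euclidean) auto
  ultimately show ?thesis by (simp add: density_1)
qed

lemma measurable_reflect: "reflect \<in> borel_measurable borel"
  by (rule borel_measurable_continuous_onI[OF linear_continuous_on[OF bounded_linear_reflect]])

lemma measurable_reflect': "reflect \<in> measurable lborel borel"
  using measurable_reflect by simp

lemma AE_reflect:
  assumes "AE x in lborel. P x" shows "AE x in lborel. P (reflect x)"
proof -
  obtain N where N: "N \<in> null_sets lborel" "{x \<in> space lborel. \<not> P x} \<subseteq> N"
    using assms by (auto elim: AE_E simp: null_sets_def)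
  have "emeasure lborel (reflect -` N \<inter> space lborel) = emeasure (distr lborel borel reflect) N"
    using N by (subst emeasure_distr) (auto simp: measurable_reflect)
  also have "\<dots> = 0" using N by (simp add: distr_reflect null_sets_def)
  finally have "reflect -` N \<in> null_sets lborel"
    using N measurable_sets[OF measurable_reflect', of N] by (auto simp: null_sets_def)
  then show ?thesis by (rule AE_I') (use N in auto)
qed

lemma integral_reflect:
  fixes f :: "plane \<Rightarrow> 'b::{banach, second_countable_topology}"
  assumes "f \<in> borel_measurable borel"
  shows "(\<integral>x. f (reflect x) \<partial>lborel) = (\<integral>x. f x \<partial>lborel)"
  using integral_distr[OF measurable_reflect' assms] by (simp add: distr_reflect)

lemma square_int_reflect:
  assumes "square_int f" shows "square_int (\<lambda>x. f (reflect x))"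
proof -
  have meas: "f \<in> borel_measurable borel" using assms by (simp add: square_int_def)
  then have m2: "(\<lambda>x. (cmod (f x))\<^sup>2) \<in> borel_measurable borel" by measurable
  have "integrable (distr lborel borel reflect) (\<lambda>x. (cmod (f x))\<^sup>2)"
    using assms by (simp add: distr_reflect square_int_def)
  then have "integrable lborel (\<lambda>x. (cmod (f (reflect x)))\<^sup>2)"
    by (rule integrable_distr_eq[OF measurable_reflect' m2, THEN iffD1])
  then show ?thesis
    using measurable_compose[OF measurable_reflect meas] by (simp add: square_int_def)
qed

abbreviation conj_reflect :: "(plane \<Rightarrow> complex) \<Rightarrow> plane \<Rightarrow> complex" where
  "conj_reflect f \<equiv> \<lambda>x. cnj (f (reflect x))"

lemma square_int_cnj: "square_int f \<Longrightarrow> square_int (\<lambda>x. cnj (f x))"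
  by (auto simp: square_int_def intro: borel_measurable_cnj)

lemma l2_respects_conj_reflect: "l2_respects conj_reflect"
  unfolding l2_respects_def square_int_rel_def
proof (intro allI impI conjI)
  fix f g :: "plane \<Rightarrow> complex"
  assume fg: "square_int f \<and> square_int g \<and> (AE x in lborel. f x = g x)"
  then show "square_int (conj_reflect f)" "square_int (conj_reflect g)"
    by (intro square_int_cnj square_int_reflect; simp)+
  from fg have "AE x in lborel. f x = g x" by simp
  from AE_reflect[OF this] show "AE x in lborel. cnj (f (reflect x)) = cnj (g (reflect x))" by simp
qed

text \<open>Modulus one is asked only almost everywhere: \<psi> is unspecified at the poles, and
  \<phi> vanishes on the cut away from them.\<close>

lemma l2_respects_unimodular:
  assumes \<phi>: "\<phi> \<in> borel_measurable borel" "AE x in lborel. cmod (\<phi> x) = 1"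
  shows "l2_respects (\<lambda>f x. \<phi> x * f x)" "l2_respects (\<lambda>f x. \<phi> x * cnj (f x))"
proof -
  have sq: "square_int (\<lambda>x. \<phi> x * f x)" if "square_int f" for f
  proof (rule square_int_cong_AE[OF that])
    show "AE x in lborel. cmod (\<phi> x * f x) = cmod (f x)"
      using \<phi>(2) by eventually_elim (simp add: norm_mult)
    show "(\<lambda>x. \<phi> x * f x) \<in> borel_measurable borel"
      using \<phi>(1) that by (auto simp: square_int_def)
  qed
  then show "l2_respects (\<lambda>f x. \<phi> x * f x)"
    unfolding l2_respects_def square_int_rel_def by (auto elim: eventually_mono)
  show "l2_respects (\<lambda>f x. \<phi> x * cnj (f x))"
    unfolding l2_respects_def square_int_rel_def
    by (auto intro: sq square_int_cnj elim: eventually_mono)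
qed

section \<open>The gauge function\<close>

text \<open>On the circle, \<open>sgn z\<close> is \<open>exp (i \<theta>)\<close> for the angle
  \<theta> of \<open>z\<close>, and the real factor is the differential of \<theta>. No branch of
  the angle has to be chosen.\<close>

lemma has_derivative_sgn_complex:
  fixes z :: complex
  assumes "z \<noteq> 0"
  shows "(sgn has_derivative (\<lambda>h. \<i> * sgn z * of_real (Im (cnj z * h) / (cmod z)\<^sup>2))) (at z)"
proof -
  define n where "n = cmod z"
  have n: "n > 0" "n\<^sup>2 = (Re z)\<^sup>2 + (Im z)\<^sup>2" using assms by (auto simp: n_def cmod_power2)
  have norm: "(cmod has_derivative (\<lambda>h. h \<bullet> sgn z)) (at z)"
    by (rule has_derivative_norm[OF assms])
  have "((\<lambda>z. inverse (cmod z) *\<^sub>R z) has_derivative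
      (\<lambda>h. inverse n *\<^sub>R h + (- (inverse n * (h \<bullet> sgn z) * inverse n)) *\<^sub>R z)) (at z)"
    using has_derivative_scaleR[OF Deriv.has_derivative_inverse[OF _ norm] has_derivative_ident] assms
    by (simp add: n_def)
  moreover have "(\<lambda>z. inverse (cmod z) *\<^sub>R z) = sgn"
    by (simp add: fun_eq_iff sgn_div_norm)
  moreover have "inverse n *\<^sub>R h + (- (inverse n * (h \<bullet> sgn z) * inverse n)) *\<^sub>R z =
      \<i> * sgn z * of_real (Im (cnj z * h) / n\<^sup>2)" for h
  proof -
    have h: "h = of_real (1 / n\<^sup>2) * (of_real ((Re z)\<^sup>2 + (Im z)\<^sup>2) * h)"
      using n by (simp add: n(2)[symmetric])
    \<comment> \<open>The decomposition of \<open>h\<close> into a radial and an angular component;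
      normalising \<open>z\<close> cancels the radial one.\<close>
    have "of_real ((Re z)\<^sup>2 + (Im z)\<^sup>2) * h = of_real (h \<bullet> z) * z + \<i> * z * of_real (Im (cnj z * h))"
      by (simp add: complex_eq_iff inner_complex_def power2_eq_square algebra_simps)
    then have "n\<^sup>2 *\<^sub>R h = (h \<bullet> z) *\<^sub>R z + Im (cnj z * h) *\<^sub>R (\<i> * z)"
      unfolding n(2) by (simp add: scaleR_conv_of_real mult_ac)
    moreover have "(1 / n) *\<^sub>R h = (1 / n ^ 3) *\<^sub>R (n\<^sup>2 *\<^sub>R h)"
      using n(1) by (simp add: power2_eq_square power3_eq_cube)
    ultimately have "(1 / n) *\<^sub>R h - ((h \<bullet> z) / n ^ 3) *\<^sub>R z = (Im (cnj z * h) / n ^ 3) *\<^sub>R (\<i> * z)"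
      by (simp add: scaleR_add_right)
    moreover have sgn: "sgn z = (1 / n) *\<^sub>R z" by (simp add: sgn_div_norm n_def inverse_eq_divide)
    moreover have inner: "h \<bullet> sgn z = (h \<bullet> z) / n" unfolding sgn by simp
    ultimately show ?thesis
      unfolding inner unfolding sgn
      by (simp add: inverse_eq_divide scaleR_conv_of_real power2_eq_square power3_eq_cube mult_ac)
  qed
  ultimately show ?thesis by (simp add: n_def)
qed

definition pole_coord :: "real \<Rightarrow> plane \<Rightarrow> complex" where
  "pole_coord c x = Complex (fst x - c) (snd x)"

lemma pole_coord_nonzero: "x \<noteq> (c, 0) \<Longrightarrow> pole_coord c x \<noteq> 0"
  by (cases x) (auto simp: pole_coord_def complex_eq_iff)

text \<open>The vector field is the gradient of the angle around the pole \<open>(c, 0)\<close>;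
  twice the potential is the difference of two such gradients.\<close>

lemma has_derivative_sgn_pole_coord:
  assumes "x \<noteq> (c, 0)"
  shows "((\<lambda>x. sgn (pole_coord c x)) has_derivative (\<lambda>h. \<i> * sgn (pole_coord c x) *
    of_real (((1 / ((fst x - c)\<^sup>2 + (snd x)\<^sup>2)) *\<^sub>R (- snd x, fst x - c)) \<bullet> h))) (at x)"
proof -
  have "(pole_coord c has_derivative (\<lambda>h. Complex (fst h) (snd h))) (at x)"
    unfolding pole_coord_def[abs_def] Complex_eq
    by (auto intro!: derivative_eq_intros)
  note d = has_derivative_compose[OF this has_derivative_sgn_complex[OF pole_coord_nonzero[OF assms]]]
  have "Im (cnj (pole_coord c x) * Complex (fst h) (snd h)) / (cmod (pole_coord c x))\<^sup>2 =
      ((1 / ((fst x - c)\<^sup>2 + (snd x)\<^sup>2)) *\<^sub>R (- snd x, fst x - c)) \<bullet> h" for h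
    by (simp add: pole_coord_def cmod_power2 inner_prod_def algebra_simps add_divide_distrib[symmetric]
        diff_divide_distrib[symmetric])
  then show ?thesis using d by simp
qed

locale gauge =
  fixes a b :: real and \<psi> :: "plane \<Rightarrow> complex"
  assumes ab: "a < b" and gauge: "gauge_function a b \<psi>"
begin

text \<open>Both sides solve the same linear equation on a connected set and agree on the slit.\<close>
lemma gauge_function_eq:
  assumes x: "x \<notin> {(a, 0), (b, 0)}"
  shows "\<psi> x = sgn (pole_coord b x * cnj (pole_coord a x))"
proof -
  let ?W = "- {(a, 0), (b, 0)} :: plane set"
  let ?A = "\<lambda>c (x::plane). (1 / ((fst x - c)\<^sup>2 + (snd x)\<^sup>2)) *\<^sub>R (- snd x, fst x - c)"
  let ?q = "\<lambda>x. \<psi> x * (cnj (sgn (pole_coord b x)) * sgn (pole_coord a x))"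
  have "connected (UNIV - {(a, 0), (b, 0)} :: plane set)"
    by (rule connected_open_diff_countable) auto
  then have conn: "connected ?W" by (simp add: Compl_eq_Diff_UNIV)
  have deriv: "(?q has_derivative (\<lambda>h. 0)) (at x)" if "x \<in> ?W" for x
  proof -
    have ne: "x \<noteq> (a, 0)" "x \<noteq> (b, 0)" using that by auto
    have "(\<psi> has_derivative (\<lambda>h. 2 * \<i> * \<psi> x * of_real (AB_potential a b x \<bullet> h))) (at x)"
      using gauge that by (simp add: gauge_function_def)
    note d = has_derivative_mult[OF this has_derivative_mult[OF
          has_derivative_cnj[OF has_derivative_sgn_pole_coord[OF ne(2)]]
          has_derivative_sgn_pole_coord[OF ne(1)]]]
    have "2 * ((- (1 / 2) *\<^sub>R u + (1 / 2) *\<^sub>R v) \<bullet> h) = v \<bullet> h - u \<bullet> h" for u v h :: plane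
      by (simp add: inner_diff_left)
    then have "2 * (AB_potential a b x \<bullet> h) = ?A b x \<bullet> h - ?A a x \<bullet> h" for h
      unfolding AB_potential_def .
    then have "2 * complex_of_real (AB_potential a b x \<bullet> h) = of_real (?A b x \<bullet> h) - of_real (?A a x \<bullet> h)" for h
      by (metis of_real_diff of_real_mult of_real_numeral)
    then have eq: "2 * \<i> * \<psi> x * complex_of_real (AB_potential a b x \<bullet> h) =
        \<i> * \<psi> x * (of_real (?A b x \<bullet> h) - of_real (?A a x \<bullet> h))" for h
      by (metis mult.assoc mult.commute)
    show ?thesis
      by (rule has_derivative_eq_rhs[OF d], rule ext, unfold eq) (simp add: algebra_simps)
  qed
  \<comment> \<open>At the midpoint of the slit both pole coordinates are real with opposite signs,
    which agrees with the normalisation -1 of \<psi>.\<close>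
  define p where "p = ((a + b) / 2, 0::real)"
  have p: "p \<in> ?W" using ab by (auto simp: p_def)
  have "?q x = ?q p"
    by (rule has_derivative_zero_unique_connected[OF _ conn deriv]) (use x p in auto)
  also have "\<dots> = 1"
  proof -
    have "\<psi> p = - 1" using gauge ab by (simp add: gauge_function_def p_def field_simps)
    moreover have "pole_coord a p = of_real ((b - a) / 2)" "pole_coord b p = of_real (- ((b - a) / 2))"
      by (simp_all add: p_def pole_coord_def complex_eq_iff field_simps)
    ultimately show ?thesis using ab by (simp only: sgn_of_real) simp
  qed
  finally have q: "?q x = 1" .
  have "pole_coord a x \<noteq> 0" "pole_coord b x \<noteq> 0"
    using x pole_coord_nonzero by auto
  then have u: "sgn (pole_coord b x) * cnj (sgn (pole_coord b x)) = 1"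
    "sgn (pole_coord a x) * cnj (sgn (pole_coord a x)) = 1"
    by (simp_all add: complex_norm_square[symmetric] norm_sgn)
  have "\<psi> x = \<psi> x * ((sgn (pole_coord b x) * cnj (sgn (pole_coord b x))) *
      (sgn (pole_coord a x) * cnj (sgn (pole_coord a x))))"
    unfolding u by simp
  also have "\<dots> = ?q x * (sgn (pole_coord b x) * cnj (sgn (pole_coord a x)))"
    by (simp only: mult_ac)
  finally have "\<psi> x = ?q x * (sgn (pole_coord b x) * cnj (sgn (pole_coord a x)))" .
  then show ?thesis unfolding q by (simp add: sgn_mult) (simp add: sgn_div_norm)
qed

lemma pole_product:
  "pole_coord b x * cnj (pole_coord a x) =
    Complex ((fst x - b) * (fst x - a) + (snd x)\<^sup>2) (snd x * (b - a))"
  by (simp add: pole_coord_def complex_eq_iff algebra_simps power2_eq_square)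

lemma gauge_function_reflect:
  assumes "x \<notin> {(a, 0), (b, 0)}"
  shows "\<psi> (reflect x) = cnj (\<psi> x)"
proof -
  have "reflect x \<notin> {(a, 0), (b, 0)}" using assms by (cases x) (auto simp: reflect_def)
  moreover have "pole_coord b (reflect x) * cnj (pole_coord a (reflect x)) =
      cnj (pole_coord b x * cnj (pole_coord a x))"
    by (simp add: pole_coord_def reflect_def complex_eq_iff algebra_simps)
  ultimately show ?thesis
    using assms by (simp add: gauge_function_eq sgn_div_norm del: complex_cnj_mult)
qed

text \<open>By \<open>pole_product\<close> the imaginary part of the product vanishes only on the
  axis, where the sign of \<open>(x1 - a) (x1 - b)\<close> decides.\<close>

lemma gauge_function_values:
  assumes "x \<notin> {(a, 0), (b, 0)}"
  shows "\<psi> x = - 1 \<longleftrightarrow> snd x = 0 \<and> a < fst x \<and> fst x < b"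
    and "\<psi> x = 1 \<longleftrightarrow> snd x = 0 \<and> (fst x < a \<or> b < fst x)"
proof -
  let ?N = "pole_coord b x * cnj (pole_coord a x)"
  have N: "?N \<noteq> 0" using assms pole_coord_nonzero by auto
  have psi: "\<psi> x = sgn ?N" by (rule gauge_function_eq[OF assms])
  have Re: "Re ?N = (fst x - b) * (fst x - a)" if "snd x = 0"
    using that by (simp add: pole_product)
  have r: "sgn ?N = of_real (sgn (Re ?N))" if "snd x = 0"
  proof -
    have "?N = of_real (Re ?N)" using that by (simp add: pole_product complex_eq_iff)
    then show ?thesis by (metis sgn_of_real)
  qed
  have im: "snd x = 0" if "Im (\<psi> x) = 0"
  proof -
    have "Im ?N = 0" using that N unfolding psi by (simp add: sgn_div_norm del: times_complex.sel)
    then show ?thesis using ab by (simp add: pole_product)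
  qed
  have "snd x = 0 \<Longrightarrow> fst x \<noteq> a \<and> fst x \<noteq> b" using assms by (cases x) auto
  then have sg: "snd x = 0 \<Longrightarrow> sgn (Re ?N) = - 1 \<longleftrightarrow> a < fst x \<and> fst x < b"
    "snd x = 0 \<Longrightarrow> sgn (Re ?N) = 1 \<longleftrightarrow> fst x < a \<or> b < fst x"
    using ab Re by (auto simp: sgn_if mult_less_0_iff zero_less_mult_iff simp del: times_complex.sel)
  have key: "\<psi> x = complex_of_real t \<longleftrightarrow> snd x = 0 \<and> sgn (Re ?N) = t" for t
  proof
    assume t: "\<psi> x = complex_of_real t"
    then have 0: "snd x = 0" by (intro im) simp
    then have "complex_of_real (sgn (Re ?N)) = complex_of_real t" using r psi t by metis
    then show "snd x = 0 \<and> sgn (Re ?N) = t" using 0 by (simp only: of_real_eq_iff)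
  next
    assume "snd x = 0 \<and> sgn (Re ?N) = t"
    then show "\<psi> x = complex_of_real t" using r psi by metis
  qed
  show "\<psi> x = - 1 \<longleftrightarrow> snd x = 0 \<and> a < fst x \<and> fst x < b"
    using key[of "- 1"] sg(1) by (simp only: of_real_minus of_real_1) blast
  show "\<psi> x = 1 \<longleftrightarrow> snd x = 0 \<and> (fst x < a \<or> b < fst x)"
    using key[of 1] sg(2) by (simp only: of_real_1) blast
qed

end

section \<open>The potential under the reflection\<close>

lemma smooth_on_AB_potential: "smooth_on (- {(a, 0), (b, 0)}) (AB_potential a b)"
proof -
  let ?W = "- {(a, 0), (b, 0)} :: plane set"
  have op: "open ?W" by (intro open_Compl finite_imp_closed) simp
  have sub: "smooth_on ?W (\<lambda>x. fst x - c)" for c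
    using smooth_on_add[OF op smooth_on_linear[OF op bounded_linear_fst] smooth_on_const[of _ "- c"]] by simp
  have part: "smooth_on ?W (\<lambda>x. k *\<^sub>R ((1 / ((fst x - c)\<^sup>2 + (snd x)\<^sup>2)) *\<^sub>R (- snd x, fst x - c)))"
    if "c = a \<or> c = b" for c k
  proof -
    have q: "smooth_on ?W (\<lambda>x. (fst x - c)\<^sup>2 + (snd x)\<^sup>2)"
      unfolding power2_eq_square
      by (intro smooth_on_add smooth_on_mult sub op smooth_on_linear bounded_linear_snd)
    have pos: "(fst x - c)\<^sup>2 + (snd x)\<^sup>2 > 0" if "x \<in> ?W" for x
      using that \<open>c = a \<or> c = b\<close> by (cases x) (auto simp: sum_power2_gt_zero_iff)
    have "smooth_on ?W (\<lambda>x. ((fst x - c)\<^sup>2 + (snd x)\<^sup>2) powr (- 1))"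
      by (rule smooth_on_compose_real[OF op smooth_on_powr q]) (use pos in auto)
    then have i: "smooth_on ?W (\<lambda>x. 1 / ((fst x - c)\<^sup>2 + (snd x)\<^sup>2))"
      by (rule smooth_on_cong[OF _ op]) (use pos in \<open>simp add: powr_minus_divide less_imp_le\<close>)
    have "bounded_linear (\<lambda>x::plane. (- snd x, fst x))"
      by (intro bounded_linear_Pair bounded_linear_minus bounded_linear_snd bounded_linear_fst)
    from smooth_on_add[OF op smooth_on_linear[OF op this] smooth_on_const[of _ "(0, - c)"]]
    have "smooth_on ?W (\<lambda>x. (- snd x, fst x - c))" by simp
    then show ?thesis by (intro smooth_on_scaleR[OF op] smooth_on_const i)
  qed
  show ?thesis
    unfolding AB_potential_def[abs_def] by (intro smooth_on_add[OF op] part) auto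
qed

text \<open>The angle around a pole on the axis changes sign under the reflection, hence so does its
  gradient.\<close>

lemma AB_potential_reflect: "AB_potential a b (reflect x) \<bullet> reflect e = - (AB_potential a b x \<bullet> e)"
proof -
  have r: "((1 / ((fst (reflect x) - c)\<^sup>2 + (snd (reflect x))\<^sup>2)) *\<^sub>R (- snd (reflect x), fst (reflect x) - c)) \<bullet> reflect e
      = - (((1 / ((fst x - c)\<^sup>2 + (snd x)\<^sup>2)) *\<^sub>R (- snd x, fst x - c)) \<bullet> e)" for c
  proof -
    have q: "(fst (reflect x) - c)\<^sup>2 + (snd (reflect x))\<^sup>2 = (fst x - c)\<^sup>2 + (snd x)\<^sup>2"
      by (simp add: reflect_def)
    have i: "(- snd (reflect x), fst (reflect x) - c) \<bullet> reflect e = - ((- snd x, fst x - c) \<bullet> e)"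
      by (simp add: reflect_def inner_prod_def)
    show ?thesis unfolding q inner_scaleR_left i by (rule mult_minus_right)
  qed
  show ?thesis
    unfolding AB_potential_def inner_add_left inner_scaleR_left[of "- (1 / 2)"] inner_scaleR_left[of "1 / 2"] r
    by simp
qed

lemma magnetic_deriv_neg:
  assumes "u \<in> test_functions S"
  shows "magnetic_deriv A (- e) u = (\<lambda>x. - magnetic_deriv A e u x)"
proof
  fix x
  show "magnetic_deriv A (- e) u x = - magnetic_deriv A e u x"
    unfolding magnetic_deriv_eq[OF test_functions_has_derivative[OF assms]]
    using linear_neg[OF has_derivative_linear[OF test_functions_has_derivative[OF assms]], of x e] by simp
qed

text \<open>Conjugation reverses the sign of \<open>i\<close> and the reflection that of the
  potential; together they give one overall sign, which drops out of second derivatives.\<close>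

lemma magnetic_deriv_conj_reflect:
  assumes u: "u \<in> test_functions S"
  shows "magnetic_deriv (AB_potential a b) e (conj_reflect u) =
    (\<lambda>x. - conj_reflect (magnetic_deriv (AB_potential a b) (reflect e) u) x)"
proof
  fix x
  have "(conj_reflect u has_derivative (\<lambda>h. cnj (frechet_derivative u (at (reflect x)) (reflect h)))) (at x)"
    by (intro has_derivative_cnj has_derivative_compose[OF
        bounded_linear_imp_has_derivative[OF bounded_linear_reflect] test_functions_has_derivative[OF u]])
  then show "magnetic_deriv (AB_potential a b) e (conj_reflect u) x =
      - conj_reflect (magnetic_deriv (AB_potential a b) (reflect e) u) x"
    by (simp add: magnetic_deriv_eq magnetic_deriv_eq[OF test_functions_has_derivative[OF u]]
        AB_potential_reflect)
qed

lemma test_functions_conj_reflect: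
  "u \<in> test_functions S \<Longrightarrow> reflect ` S = S \<Longrightarrow> conj_reflect u \<in> test_functions S"
  by (intro test_functions_cnj test_functions_reflect)

lemma magnetic_laplace_conj_reflect:
  assumes u: "u \<in> test_functions S" and S: "reflect ` S = S" "S \<subseteq> - {(a, 0), (b, 0)}"
  shows "magnetic_laplace (AB_potential a b) (conj_reflect u) =
    conj_reflect (magnetic_laplace (AB_potential a b) u)"
proof
  fix x
  let ?D = "magnetic_deriv (AB_potential a b)"
  have D: "?D e f \<in> test_functions S" if "f \<in> test_functions S" for e f
    by (rule test_functions_magnetic_deriv[OF that S(2) _ smooth_on_AB_potential])
      (intro open_Compl finite_imp_closed, simp)
  have "?D e (?D e (conj_reflect u)) x = conj_reflect (?D e (?D e u)) x" if "e \<in> Basis" for e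
  proof -
    have c: "conj_reflect (?D (reflect e) u) \<in> test_functions S"
      by (intro test_functions_conj_reflect D u S(1))
    have "reflect e = e \<or> reflect e = - e"
      using that by (auto simp: reflect_def Basis_prod_def)
    then have "?D (reflect e) (?D (reflect e) u) = ?D e (?D e u)"
    proof
      assume neg: "reflect e = - e"
      show ?thesis
        unfolding neg magnetic_deriv_neg[OF u, of _ e]
        using magnetic_deriv_const_mult[OF D[OF u], of "AB_potential a b" "- e" "- 1" e]
        by (simp add: magnetic_deriv_neg[OF D[OF u], of _ e])
    qed simp
    moreover have "?D e (?D e (conj_reflect u)) = conj_reflect (?D (reflect e) (?D (reflect e) u))"
      unfolding magnetic_deriv_conj_reflect[OF u]
      using magnetic_deriv_const_mult[OF c, of "AB_potential a b" e "- 1"]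
      by (simp add: magnetic_deriv_conj_reflect[OF D[OF u]])
    ultimately show ?thesis by simp
  qed
  then show "magnetic_laplace (AB_potential a b) (conj_reflect u) x =
      conj_reflect (magnetic_laplace (AB_potential a b) u) x"
    by (simp add: magnetic_laplace_def)
qed

lemma real_axis_null: "AE x in lborel. x \<notin> real_axis"
proof -
  have "AE x::plane in lborel. x \<bullet> (0, 1) \<noteq> 0"
    by (rule AE_lborel_inner_neq) (auto simp: Basis_prod_def)
  then show ?thesis by (simp add: real_axis_def inner_prod_def)
qed

section \<open>The antilinear symmetry given by \<psi>\<close>

context gauge
begin

lemma open_gauge_domain: "open (- {(a, 0), (b, 0)} :: plane set)"
  by (intro open_Compl finite_imp_closed) simp

lemma gauge_function_norm: "x \<notin> {(a, 0), (b, 0)} \<Longrightarrow> cmod (\<psi> x) = 1"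
  using gauge by (simp add: gauge_function_def)

lemma gauge_function_smooth: "smooth_on (- {(a, 0), (b, 0)}) \<psi>"
  using gauge by (simp add: gauge_function_def)

lemma gauge_function_derivative:
  "x \<notin> {(a, 0), (b, 0)} \<Longrightarrow>
    (\<psi> has_derivative (\<lambda>h. 2 * \<i> * \<psi> x * of_real (AB_potential a b x \<bullet> h))) (at x)"
  using gauge by (simp add: gauge_function_def)

lemma borel_measurable_off_poles:
  fixes f :: "plane \<Rightarrow> complex"
  assumes "open W" "continuous_on W f" "\<And>x. x \<notin> W \<Longrightarrow> x \<notin> {(a, 0), (b, 0)} \<Longrightarrow> f x = 0"
  shows "f \<in> borel_measurable borel"
proof (rule measurable_discrete_difference[where X = "{(a, 0), (b, 0)}"])
  show "(\<lambda>x. indicator W x *\<^sub>R f x) \<in> borel_measurable borel"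
    using assms by (intro borel_measurable_continuous_on_indicator) auto
qed (use assms(3) in \<open>auto simp: indicator_def\<close>)

lemma gauge_function_measurable: "\<psi> \<in> borel_measurable borel"
  by (rule borel_measurable_off_poles[OF open_gauge_domain smooth_on_continuous_on[OF gauge_function_smooth]])
    simp

lemma gauge_function_AE: "AE x in lborel. cmod (\<psi> x) = 1"
  using real_axis_null by eventually_elim (auto simp: real_axis_def intro!: gauge_function_norm)

abbreviation gauge_conj :: "(plane \<Rightarrow> complex) \<Rightarrow> plane \<Rightarrow> complex" where
  "gauge_conj f \<equiv> \<lambda>x. \<psi> x * cnj (f x)"

lemma test_functions_gauge_conj:
  "u \<in> test_functions S \<Longrightarrow> S \<subseteq> - {(a, 0), (b, 0)} \<Longrightarrow> gauge_conj u \<in> test_functions S"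
  by (rule test_functions_smooth_mult[OF test_functions_cnj _ open_gauge_domain gauge_function_smooth])

text \<open>The derivative of \<psi> contributes \<open>-2 A\<close>, turning \<open>A\<close> into
  \<open>-A\<close>, which matches the sign change of \<open>i\<close> under conjugation.\<close>

lemma magnetic_deriv_gauge_conj:
  assumes u: "u \<in> test_functions S" and S: "S \<subseteq> - {(a, 0), (b, 0)}"
  shows "magnetic_deriv (AB_potential a b) e (gauge_conj u) =
    (\<lambda>x. - gauge_conj (magnetic_deriv (AB_potential a b) e u) x)"
proof
  fix x
  let ?D = "magnetic_deriv (AB_potential a b)"
  have D: "?D e f \<in> test_functions S" if "f \<in> test_functions S" for e f
    by (rule test_functions_magnetic_deriv[OF that S open_gauge_domain smooth_on_AB_potential])
  show "?D e (gauge_conj u) x = - gauge_conj (?D e u) x"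
  proof (cases "x \<in> S")
    case True
    then have "x \<notin> {(a, 0), (b, 0)}" using S by auto
    from has_derivative_mult[OF gauge_function_derivative[OF this]
        has_derivative_cnj[OF test_functions_has_derivative[OF u]]]
    show ?thesis
      by (simp add: magnetic_deriv_eq magnetic_deriv_eq[OF test_functions_has_derivative[OF u]]
          algebra_simps)
  next
    case False
    then show ?thesis
      using test_functions_outside[OF D[OF u]]
        test_functions_outside[OF D[OF test_functions_gauge_conj[OF u S]]] by simp
  qed
qed

lemma magnetic_laplace_gauge_conj:
  assumes u: "u \<in> test_functions S" and S: "S \<subseteq> - {(a, 0), (b, 0)}"
  shows "magnetic_laplace (AB_potential a b) (gauge_conj u) =
    gauge_conj (magnetic_laplace (AB_potential a b) u)"
proof
  fix x
  let ?D = "magnetic_deriv (AB_potential a b)"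
  have D: "?D e f \<in> test_functions S" if "f \<in> test_functions S" for e f
    by (rule test_functions_magnetic_deriv[OF that S open_gauge_domain smooth_on_AB_potential])
  have "?D e (?D e (gauge_conj u)) = gauge_conj (?D e (?D e u))" for e
    unfolding magnetic_deriv_gauge_conj[OF u S]
    using magnetic_deriv_const_mult[OF test_functions_gauge_conj[OF D[OF u] S], of "AB_potential a b" e "- 1"]
    by (simp add: magnetic_deriv_gauge_conj[OF D[OF u] S])
  then show "magnetic_laplace (AB_potential a b) (gauge_conj u) x =
      gauge_conj (magnetic_laplace (AB_potential a b) u) x"
    by (simp add: magnetic_laplace_def sum_distrib_left)
qed

text \<open>The magnetic derivative anticommutes with \<open>gauge_conj\<close>, so for a fixed
  \<open>u\<close> the product \<open>cnj u * D u\<close> is the negative of its conjugate. This is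
  the hypothesis of the truncation estimate.\<close>

lemma gauge_conj_fixed_deriv:
  assumes u: "u \<in> test_functions S" and S: "S \<subseteq> - {(a, 0), (b, 0)}" and inv: "gauge_conj u = u"
  shows "Re (cnj (u x) * magnetic_deriv (AB_potential a b) e u x) = 0"
proof -
  let ?d = "magnetic_deriv (AB_potential a b) e u x"
  have ux: "u x = \<psi> x * cnj (u x)" using fun_cong[OF inv, of x] by simp
  have "?d = - (\<psi> x * cnj ?d)"
    using fun_cong[OF magnetic_deriv_gauge_conj[OF u S, of e], of x] unfolding inv .
  then have "cnj (u x) * ?d = - ((\<psi> x * cnj (u x)) * cnj ?d)" by (metis mult.assoc mult.commute mult_minus_right)
  also have "\<dots> = - cnj (cnj (u x) * ?d)" unfolding ux[symmetric] by simp
  finally have "Re (cnj (u x) * ?d) = Re (- cnj (cnj (u x) * ?d))" by metis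
  then show ?thesis by simp
qed

end

section \<open>Square roots of the gauge function\<close>

text \<open>As \<open>\<bar>\<psi>\<bar> = 1\<close>, \<open>(1 + s \<psi>)\<^sup>2 = s \<psi> \<bar>1 + s \<psi>\<bar>\<^sup>2\<close> for \<open>s = \<plusminus>1\<close>, so with \<open>\<kappa>\<^sup>2 = s\<close> this squares to \<open>\<psi>\<close>.
  The sign \<open>s = 1\<close> (\<open>\<kappa> = 1\<close>) belongs to \<open>\<Sigma>\<^sup>c u = u\<close>, and \<open>s = -1\<close> (\<open>\<kappa> = i\<close>) to \<open>\<Sigma>\<^sup>c u = -u\<close>.\<close>
definition half_gauge :: "complex \<Rightarrow> real \<Rightarrow> (plane \<Rightarrow> complex) \<Rightarrow> plane \<Rightarrow> complex" where
  "half_gauge \<kappa> s \<psi> x = \<kappa> * (1 + of_real s * \<psi> x) *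
     of_real ((cmod (1 + of_real s * \<psi> x))\<^sup>2 powr (- 1 / 2))"

text \<open>The zeros of \<open>1 + s \<psi>\<close>, where the formula for the root breaks down,
  and the poles, where \<psi> is unspecified. For \<open>s = 1\<close> this is the slit, for
  \<open>s = - 1\<close> the closure of the rest of the axis.\<close>

definition branch_cut :: "real \<Rightarrow> real \<Rightarrow> real \<Rightarrow> (plane \<Rightarrow> complex) \<Rightarrow> plane set" where
  "branch_cut a b s \<psi> = {(a, 0), (b, 0)} \<union> {x. \<psi> x = - of_real s}"

text \<open>The first condition on \<kappa> gives \<open>\<phi>^2 = \<psi>\<close>; the second
  produces the sign \<open>s\<close> when \<phi> is reflected and conjugated.\<close>

locale gauge_root = gauge +
  fixes s :: real and \<kappa> :: complex
  assumes s: "s = 1 \<or> s = - 1" and \<kappa>: "\<kappa> * \<kappa> = of_real s" "cnj \<kappa> = of_real s * \<kappa>"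
begin

lemma s_square: "s * s = 1" "complex_of_real s * of_real s = 1"
  using s by auto

abbreviation "B \<equiv> branch_cut a b s \<psi>"
abbreviation "\<phi> \<equiv> half_gauge \<kappa> s \<psi>"

lemma branch_cut_poles: "{(a, 0), (b, 0)} \<subseteq> B"
  by (simp add: branch_cut_def)

lemma not_in_branch_cut:
  assumes "x \<notin> B"
  shows "x \<notin> {(a, 0), (b, 0)}" "1 + of_real s * \<psi> x \<noteq> 0"
proof -
  show "x \<notin> {(a, 0), (b, 0)}" using assms branch_cut_poles by auto
  show "1 + of_real s * \<psi> x \<noteq> 0"
  proof
    assume "1 + of_real s * \<psi> x = 0"
    then have "\<psi> x = - of_real s" using s by (auto simp: add_eq_0_iff)
    then show False using assms by (simp add: branch_cut_def)
  qed
qed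

lemma open_branch_cut_compl: "open (- B)"
proof -
  let ?W = "- {(a, 0), (b, 0)} :: plane set"
  have "open (?W \<inter> \<psi> -` (- {- of_real s}))"
    by (rule continuous_open_preimage[OF smooth_on_continuous_on[OF gauge_function_smooth]
          open_gauge_domain]) auto
  also have "?W \<inter> \<psi> -` (- {- of_real s}) = - B" by (auto simp: branch_cut_def)
  finally show ?thesis .
qed

lemma branch_cut_subset_axis: "B \<subseteq> real_axis"
proof
  fix x assume x: "x \<in> B"
  show "x \<in> real_axis"
  proof (cases "x \<in> {(a, 0), (b, 0)}")
    case False
    then have "\<psi> x = - 1 \<or> \<psi> x = 1" using x s by (auto simp: branch_cut_def)
    then show ?thesis
      using gauge_function_values[OF False] by (auto simp: real_axis_def)
  qed (auto simp: real_axis_def)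
qed

lemma branch_cut_null: "AE x in lborel. x \<notin> B"
  using real_axis_null by eventually_elim (use branch_cut_subset_axis in blast)

lemma reflect_branch_cut: "reflect x \<in> B \<longleftrightarrow> x \<in> B"
proof -
  have "x \<in> B \<longrightarrow> reflect x = x" for x
    using branch_cut_subset_axis by (auto simp: real_axis_def reflect_def prod_eq_iff subset_eq)
  then show ?thesis by (metis reflect_reflect)
qed

text \<open>The definition uses \<open>powr\<close> because real powers of a positive smooth
  function are known to be smooth; algebra is easier with \<open>sgn\<close>.\<close>

lemma half_gauge_eq:
  assumes "x \<notin> B"
  shows "\<phi> x = \<kappa> * sgn (1 + of_real s * \<psi> x)"
proof -
  let ?c = "1 + of_real s * \<psi> x"
  have c: "cmod ?c > 0" using not_in_branch_cut[OF assms] by simp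
  have "(cmod ?c)\<^sup>2 powr (- 1 / 2) = inverse (cmod ?c)"
    using powr_minus[of "(cmod ?c)\<^sup>2" "1 / 2"] c by (simp add: powr_half_sqrt)
  then show ?thesis
    by (simp only: half_gauge_def) (simp add: sgn_div_norm scaleR_conv_of_real mult_ac)
qed

lemma half_gauge_norm:
  assumes "x \<notin> B" shows "cmod (\<phi> x) = 1"
proof -
  have "cmod \<kappa> * cmod \<kappa> = 1" using arg_cong[OF \<kappa>(1), of cmod] s by (auto simp: norm_mult)
  then have "cmod \<kappa> = 1" using norm_ge_zero[of \<kappa>] by (simp add: power2_eq_1_iff flip: power2_eq_square)
  then show ?thesis
    using not_in_branch_cut[OF assms] by (simp add: half_gauge_eq[OF assms] norm_mult norm_sgn)
qed

lemma half_gauge_mult_cnj: "x \<notin> B \<Longrightarrow> \<phi> x * cnj (\<phi> x) = 1"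
  using half_gauge_norm[of x] complex_norm_square[of "\<phi> x"] by simp

lemma half_gauge_square:
  assumes "x \<notin> B" shows "\<phi> x * \<phi> x = \<psi> x"
proof -
  let ?c = "1 + of_real s * \<psi> x"
  have "\<psi> x * cnj (\<psi> x) = 1"
    using gauge_function_norm[OF not_in_branch_cut(1)[OF assms]] complex_norm_square[of "\<psi> x"] by simp
  then have "of_real s * \<psi> x * cnj ?c = of_real s * \<psi> x + (of_real s * of_real s) * (\<psi> x * cnj (\<psi> x))"
    by (simp add: algebra_simps)
  then have c: "of_real s * \<psi> x * cnj ?c = ?c"
    using \<open>\<psi> x * cnj (\<psi> x) = 1\<close> s_square(2) by simp
  have u: "sgn ?c * cnj (sgn ?c) = 1"
    using not_in_branch_cut[OF assms] complex_norm_square[of "sgn ?c"] by (simp add: norm_sgn)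
  have "sgn ?c = of_real s * \<psi> x * cnj (sgn ?c)"
    by (subst (1) c[symmetric])
      (simp add: sgn_div_norm scaleR_conv_of_real c[unfolded mult.assoc, simplified] mult_ac)
  then have "sgn ?c * sgn ?c = of_real s * \<psi> x * (sgn ?c * cnj (sgn ?c))"
    by (metis mult.assoc mult.commute)
  then have "sgn ?c * sgn ?c = of_real s * \<psi> x" using u by simp
  moreover have "\<phi> x * \<phi> x = (\<kappa> * \<kappa>) * (sgn ?c * sgn ?c)"
    by (simp add: half_gauge_eq[OF assms] mult_ac)
  ultimately show ?thesis using \<kappa>(1) s_square(2) by (simp add: mult.assoc[symmetric])
qed

text \<open>The two sides are conjugate to each other: once \<phi> is divided out, a value fixed by
  the antilinear symmetry is real.\<close>

lemma half_gauge_swap: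
  assumes "x \<notin> B" "\<psi> x * cnj z = z" shows "cnj (\<phi> x) * z = \<phi> x * cnj z"
proof -
  have "cnj (\<phi> x) * z = cnj (\<phi> x) * (\<psi> x * cnj z)" by (simp only: assms(2))
  also have "\<dots> = (\<phi> x * cnj (\<phi> x)) * (\<phi> x * cnj z)"
    unfolding half_gauge_square[OF assms(1), symmetric] by (simp only: mult_ac)
  finally show ?thesis by (simp add: half_gauge_mult_cnj[OF assms(1)])
qed

text \<open>Reflection conjugates \<psi>, so the normalised factor is unchanged and only \<kappa>
  contributes a sign.\<close>

lemma half_gauge_reflect:
  assumes "x \<notin> B" shows "cnj (\<phi> (reflect x)) = of_real s * \<phi> x"
proof -
  have x': "reflect x \<notin> B" using assms reflect_branch_cut by simp
  have "cnj (1 + of_real s * \<psi> (reflect x)) = 1 + of_real s * \<psi> x"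
    using gauge_function_reflect[OF not_in_branch_cut(1)[OF assms]] by simp
  then have "cnj (sgn (1 + of_real s * \<psi> (reflect x))) = sgn (1 + of_real s * \<psi> x)"
    by (metis complex_cnj_scaleR complex_mod_cnj sgn_div_norm)
  then show ?thesis
    by (simp add: half_gauge_eq[OF assms] half_gauge_eq[OF x'] \<kappa>(2) mult_ac)
qed

lemma half_gauge_smooth: "smooth_on (- B) \<phi>"
proof -
  note op = open_branch_cut_compl
  have "- B \<subseteq> - {(a, 0), (b, 0)}" using branch_cut_poles by auto
  then have c: "smooth_on (- B) (\<lambda>x. 1 + of_real s * \<psi> x)"
    by (intro smooth_on_add op smooth_on_const smooth_on_mult
        smooth_on_subset[OF gauge_function_smooth])
  have "smooth_on (- B) (\<lambda>x. (cmod (1 + of_real s * \<psi> x))\<^sup>2 powr (- 1 / 2))"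
    by (rule smooth_on_compose_real[OF op smooth_on_powr smooth_on_cmod_square[OF c op]])
      (use not_in_branch_cut in auto)
  then show ?thesis
    unfolding half_gauge_def[abs_def]
    by (intro smooth_on_mult op smooth_on_const c smooth_on_of_real)
qed

text \<open>Differentiating \<open>\<phi>^2 = \<psi>\<close> and dividing by \<open>2 \<phi>\<close>
  avoids differentiating the explicit formula.\<close>

lemma half_gauge_derivative:
  assumes x: "x \<notin> B"
  shows "(\<phi> has_derivative (\<lambda>h. \<i> * \<phi> x * of_real (AB_potential a b x \<bullet> h))) (at x)"
proof -
  let ?\<phi>' = "frechet_derivative \<phi> (at x)"
  have d: "(\<phi> has_derivative ?\<phi>') (at x)"
    using smooth_on_differentiable[OF half_gauge_smooth, of x] x by (simp add: frechet_derivative_works)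
  have "((\<lambda>x. \<phi> x * \<phi> x) has_derivative (\<lambda>h. 2 * \<i> * \<psi> x * of_real (AB_potential a b x \<bullet> h))) (at x)"
    by (rule has_derivative_transform_within_open[OF gauge_function_derivative[OF not_in_branch_cut(1)[OF x]]
          open_branch_cut_compl]) (use x half_gauge_square in auto)
  from has_derivative_unique[OF has_derivative_mult[OF d d] this]
  have "\<phi> x * ?\<phi>' h + ?\<phi>' h * \<phi> x = 2 * \<i> * (\<phi> x * \<phi> x) * of_real (AB_potential a b x \<bullet> h)" for h
    unfolding half_gauge_square[OF x] by (rule fun_cong)
  then have "2 * \<phi> x * ?\<phi>' h = 2 * \<phi> x * (\<i> * \<phi> x * of_real (AB_potential a b x \<bullet> h))" for h
    by (simp add: algebra_simps)
  moreover have "\<phi> x \<noteq> 0" using half_gauge_norm[OF x] by auto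
  ultimately have "?\<phi>' = (\<lambda>h. \<i> * \<phi> x * of_real (AB_potential a b x \<bullet> h))" by auto
  then show ?thesis using d by simp
qed

lemma half_gauge_measurable: "\<phi> \<in> borel_measurable borel"
proof (rule borel_measurable_off_poles[OF open_branch_cut_compl smooth_on_continuous_on[OF half_gauge_smooth]])
  fix x assume "x \<notin> - B" "x \<notin> {(a, 0), (b, 0)}"
  then have "1 + of_real s * \<psi> x = 0" using s_square(2) by (auto simp: branch_cut_def)
  then show "\<phi> x = 0" by (simp add: half_gauge_def)
qed

lemma half_gauge_AE: "AE x in lborel. cmod (\<phi> x) = 1"
  using branch_cut_null by eventually_elim (rule half_gauge_norm)

lemma test_functions_half_gauge:
  assumes u: "u \<in> test_functions S" and S: "S \<subseteq> - B"
  shows "(\<lambda>x. \<phi> x * u x) \<in> test_functions S"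
  by (rule test_functions_smooth_mult[OF u S open_branch_cut_compl half_gauge_smooth])

lemma magnetic_deriv_half_gauge:
  assumes u: "u \<in> test_functions S" and S: "S \<subseteq> - B"
  shows "magnetic_deriv (AB_potential a b) e (\<lambda>x. \<phi> x * u x) = (\<lambda>x. \<phi> x * magnetic_deriv (\<lambda>_. 0) e u x)"
proof
  fix x
  show "magnetic_deriv (AB_potential a b) e (\<lambda>x. \<phi> x * u x) x = \<phi> x * magnetic_deriv (\<lambda>_. 0) e u x"
  proof (cases "x \<in> S")
    case True
    then have "x \<notin> B" using S by auto
    from has_derivative_mult[OF half_gauge_derivative[OF this] test_functions_has_derivative[OF u]]
    show ?thesis
      by (simp add: magnetic_deriv_eq magnetic_deriv_eq[OF test_functions_has_derivative[OF u]]
          algebra_simps)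
  next
    case False
    have W: "S \<subseteq> - {(a, 0), (b, 0)}" using S branch_cut_poles by auto
    show ?thesis
      using test_functions_outside[OF test_functions_magnetic_deriv[OF test_functions_half_gauge[OF u S]
            W open_gauge_domain smooth_on_AB_potential] False]
        test_functions_outside[OF test_functions_magnetic_deriv[OF u subset_UNIV open_UNIV smooth_on_const] False]
      by simp
  qed
qed

lemma magnetic_laplace_half_gauge:
  assumes u: "u \<in> test_functions S" and S: "S \<subseteq> - B"
  shows "magnetic_laplace (AB_potential a b) (\<lambda>x. \<phi> x * u x) = (\<lambda>x. \<phi> x * magnetic_laplace (\<lambda>_. 0) u x)"
proof -
  have "magnetic_deriv (\<lambda>_. 0) e u \<in> test_functions S" for e
    by (rule test_functions_magnetic_deriv[OF u subset_UNIV open_UNIV smooth_on_const])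
  from magnetic_deriv_half_gauge[OF this S] show ?thesis
    by (simp add: magnetic_laplace_def[abs_def] magnetic_deriv_half_gauge[OF u S] sum_distrib_left)
qed

end

section \<open>The free Laplacian on real functions\<close>

lemma magnetic_laplace_zero:
  assumes u: "u \<in> test_functions S"
  shows "magnetic_laplace (\<lambda>_. 0) u = (\<lambda>x. - laplace u x)"
proof -
  have "magnetic_deriv (\<lambda>_. 0) e (magnetic_deriv (\<lambda>_. 0) e u) = (\<lambda>x. - partial_deriv e (partial_deriv e u) x)" for e
  proof -
    have z: "magnetic_deriv (\<lambda>_. 0) e f = (\<lambda>x. \<i> * partial_deriv e f x)" for f
      by (simp add: magnetic_deriv_def fun_eq_iff)
    have "magnetic_deriv (\<lambda>_. 0) e (\<lambda>x. \<i> * partial_deriv e u x) = (\<lambda>x. \<i> * magnetic_deriv (\<lambda>_. 0) e (partial_deriv e u) x)"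
      by (rule magnetic_deriv_const_mult[OF test_functions_partial_deriv[OF u]])
    then show ?thesis unfolding z by (simp add: mult.assoc[symmetric])
  qed
  then show ?thesis
    by (simp add: magnetic_laplace_def laplace_def fun_eq_iff sum_negf)
qed

lemma partial_deriv_real:
  assumes u: "u \<in> test_functions S" and real: "range u \<subseteq> \<real>"
  shows "range (partial_deriv e u) \<subseteq> \<real>"
proof safe
  fix x
  note d = test_functions_has_derivative[OF u, of x]
  have "u x \<in> \<real>" for x using real by auto
  then have "(\<lambda>x. cnj (u x)) = u" by (simp only: fun_eq_iff Reals_cnj_iff[symmetric]) simp
  then have "(u has_derivative (\<lambda>h. cnj (frechet_derivative u (at x) h))) (at x)"
    using has_derivative_cnj[OF d] by simp
  from partial_deriv_eq[OF this, of e] show "partial_deriv e u x \<in> \<real>"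
    by (simp add: partial_deriv_def Reals_cnj_iff)
qed

lemma laplace_real:
  assumes u: "u \<in> test_functions S" and real: "range u \<subseteq> \<real>"
  shows "laplace u x \<in> \<real>"
  unfolding laplace_def
  by (intro sum_in_Reals subsetD[OF partial_deriv_real[OF test_functions_partial_deriv[OF u]
          partial_deriv_real[OF assms]] rangeI])

lemma free_deriv_real:
  assumes u: "u \<in> test_functions S" and real: "range u \<subseteq> \<real>"
  shows "Re (cnj (u x) * magnetic_deriv (\<lambda>_. 0) e u x) = 0"
proof -
  have "u x \<in> \<real>" using real by auto
  moreover have "partial_deriv e u x \<in> \<real>" using partial_deriv_real[OF assms, of e] by blast
  ultimately show ?thesis by (simp add: magnetic_deriv_def complex_is_Real_iff)
qed

section \<open>Averaging over involutions\<close>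

text \<open>For a self-adjoint involution this is the orthogonal projection onto its fixed
  vectors.\<close>

definition average :: "('a::real_inner \<Rightarrow> 'a) \<Rightarrow> 'a \<Rightarrow> 'a" where
  "average X u = (1 / 2) *\<^sub>R (u + X u)"

definition symmetry :: "('a::real_inner \<Rightarrow> 'a) \<Rightarrow> bool" where
  "symmetry X \<longleftrightarrow> linear X \<and> (\<forall>u. X (X u) = u) \<and> (\<forall>u v. X u \<bullet> v = u \<bullet> X v)"

lemma average_symmetry:
  assumes "symmetry X"
  shows "linear (average X)" "average X (average X u) = average X u"
    "average X u \<bullet> v = u \<bullet> average X v" "average X u = u \<longleftrightarrow> X u = u"
proof -
  have X: "linear X" "\<And>u. X (X u) = u" "\<And>u v. X u \<bullet> v = u \<bullet> X v"
    using assms by (auto simp: symmetry_def)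
  show "linear (average X)"
    unfolding average_def[abs_def]
    by (intro linear_compose_scale_right linear_compose_add linear_id[unfolded id_def] X)
  have fixed: "average X w = w" if "X w = w" for w
    using that by (simp add: average_def scaleR_2[symmetric])
  have "X (average X u) = average X u"
    by (simp add: average_def linear_add[OF X(1)] linear_scale[OF X(1)] X(2) add.commute)
  then show "average X (average X u) = average X u" by (rule fixed)
  show "average X u \<bullet> v = u \<bullet> average X v"
    by (simp add: average_def inner_add_left inner_add_right X(3))
  have "X u = u" if "average X u = u"
  proof -
    from that have "2 *\<^sub>R average X u = 2 *\<^sub>R u" by simp
    then show ?thesis by (simp add: average_def scaleR_2)
  qed
  then show "average X u = u \<longleftrightarrow> X u = u" using fixed by blast
qed

lemma average_commuting:
  assumes X: "symmetry X" and Y: "symmetry Y" and comm: "\<And>u. X (Y u) = Y (X u)"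
  shows "linear (\<lambda>u. average X (average Y u))"
    "average X (average Y (average X (average Y u))) = average X (average Y u)"
    "average X (average Y u) \<bullet> v = u \<bullet> average X (average Y v)"
    "average X (average Y u) = u \<longleftrightarrow> X u = u \<and> Y u = u"
proof -
  have lin: "linear X" "linear Y" using X Y by (auto simp: symmetry_def)
  have c: "average X (average Y u) = average Y (average X u)" for u
    by (simp add: average_def linear_add[OF lin(1)] linear_scale[OF lin(1)] linear_add[OF lin(2)]
        linear_scale[OF lin(2)] comm scaleR_add_right add_ac)
  show "linear (\<lambda>u. average X (average Y u))"
    using linear_compose[OF average_symmetry(1)[OF Y] average_symmetry(1)[OF X]] by (simp add: o_def)
  show "average X (average Y (average X (average Y u))) = average X (average Y u)"
    by (metis c average_symmetry(2)[OF X] average_symmetry(2)[OF Y])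
  show "average X (average Y u) \<bullet> v = u \<bullet> average X (average Y v)"
    unfolding c[of v] by (simp add: average_symmetry(3)[OF X] average_symmetry(3)[OF Y])
  show "average X (average Y u) = u \<longleftrightarrow> X u = u \<and> Y u = u"
    by (metis c average_symmetry(2,4)[OF X] average_symmetry(2,4)[OF Y])
qed

section \<open>The unitary equivalence\<close>

lemma eventually_cong_AE:
  "AE x in M. P x \<longleftrightarrow> Q x \<Longrightarrow> (AE x in M. P x) \<longleftrightarrow> (AE x in M. Q x)"
  by (auto elim: eventually_elim2)

lemma l2_on_of:
  assumes "square_int f"
  shows "l2_of f \<in> l2_on \<Omega> \<longleftrightarrow> (AE x in lborel. x \<notin> \<Omega> \<longrightarrow> f x = 0)"
  unfolding l2_on_def mem_Collect_eq using l2_rep_of[OF assms]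
  by (intro eventually_cong_AE) (auto elim: eventually_mono)

lemma l2_real_sym_of:
  assumes "square_int f"
  shows "l2_of f \<in> l2_real_sym \<Omega> \<longleftrightarrow> (AE x in lborel. x \<notin> \<Omega> \<longrightarrow> f x = 0) \<and>
    (AE x in lborel. f x \<in> \<real>) \<and> (AE x in lborel. f (reflect x) = f x)"
proof -
  have *: "AE x in lborel. l2_rep (l2_of f) x = f x" by (rule l2_rep_of[OF assms])
  have **: "AE x in lborel. l2_rep (l2_of f) (reflect x) = f (reflect x)" by (rule AE_reflect[OF *])
  have "(AE x in lborel. l2_rep (l2_of f) x \<in> \<real>) \<longleftrightarrow> (AE x in lborel. f x \<in> \<real>)"
    by (rule eventually_cong_AE) (use * in eventually_elim, simp)
  moreover have "(AE x in lborel. l2_rep (l2_of f) (reflect x) = l2_rep (l2_of f) x) \<longleftrightarrow>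
      (AE x in lborel. f (reflect x) = f x)"
    by (rule eventually_cong_AE) (use * ** in eventually_elim, simp)
  ultimately show ?thesis
    unfolding l2_real_sym_def mem_Collect_eq l2_on_of[OF assms] by blast
qed

lemma subspace_l2_on: "subspace (l2_on \<Omega>)"
proof (rule subspaceI)
  show "0 \<in> l2_on \<Omega>"
    using l2_on_of[OF square_int_zero] by (simp add: l2_of_zero)
  fix u v assume u: "u \<in> l2_on \<Omega>" and v: "v \<in> l2_on \<Omega>"
  obtain f g where f: "square_int f" "u = l2_of f" and g: "square_int g" "v = l2_of g"
    by (metis l2_cases)
  have a: "AE x in lborel. x \<notin> \<Omega> \<longrightarrow> f x = 0" "AE x in lborel. x \<notin> \<Omega> \<longrightarrow> g x = 0"
    using u v l2_on_of[OF f(1)] l2_on_of[OF g(1)] by (simp_all add: f g)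
  then have "AE x in lborel. x \<notin> \<Omega> \<longrightarrow> f x + g x = 0" by eventually_elim simp
  then show "u + v \<in> l2_on \<Omega>"
    by (simp add: f g l2_of_add l2_on_of square_int_add)
  fix r :: real
  have "AE x in lborel. x \<notin> \<Omega> \<longrightarrow> r *\<^sub>R f x = 0" using a(1) by eventually_elim simp
  then show "r *\<^sub>R u \<in> l2_on \<Omega>"
    using square_int_scaleR[OF f(1), of r] by (simp only: f l2_of_scaleR l2_on_of)
qed

lemma test_functions_l2_on:
  assumes "u \<in> test_functions S" "S \<subseteq> \<Omega>" shows "l2_of u \<in> l2_on \<Omega>"
  using test_functions_outside[OF assms(1)] assms(2)
  by (subst l2_on_of[OF square_int_test_functions[OF assms(1)]]) (auto intro!: AE_I2)

lemma K_op_eq_l2_map: "K_op \<psi> = l2_map (\<lambda>f x. \<psi> x * cnj (f x))"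
  by (simp add: K_op_def l2_map_def fun_eq_iff)

lemma Sigma_op_eq_l2_map: "Sigma_op = l2_map conj_reflect"
  by (simp add: Sigma_op_def l2_map_def fun_eq_iff)

lemma symmetry_Sigma_op: "symmetry Sigma_op"
  unfolding symmetry_def
proof (intro conjI allI)
  note R = l2_respects_conj_reflect
  show "linear Sigma_op"
    unfolding Sigma_op_eq_l2_map by (rule linear_l2_map[OF R]) auto
  fix u v :: l2
  obtain f g where f: "square_int f" "u = l2_of f" and g: "square_int g" "v = l2_of g"
    by (metis l2_cases)
  note sq = l2_respects_square_int[OF R f(1)] l2_respects_square_int[OF R g(1)]
  show "Sigma_op (Sigma_op u) = u"
    unfolding Sigma_op_eq_l2_map by (simp add: f l2_map_of[OF R] sq)
  have "(\<integral>x. cnj (f (reflect x)) * cnj (g x) \<partial>lborel) = (\<integral>x. cnj (f x) * cnj (g (reflect x)) \<partial>lborel)"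
    using integral_reflect[of "\<lambda>x. cnj (f x) * cnj (g (reflect x))"] sq(2) f(1)
    by (simp add: square_int_def borel_measurable_cnj borel_measurable_times)
  also have "\<dots> = cnj (\<integral>x. f x * cnj (cnj (g (reflect x))) \<partial>lborel)"
    using Bochner_Integration.integral_cnj[of lborel "\<lambda>x. f x * g (reflect x)"] by simp
  finally show "Sigma_op u \<bullet> v = u \<bullet> Sigma_op v"
    unfolding Sigma_op_eq_l2_map f(2) g(2) l2_map_of[OF R f(1)] l2_map_of[OF R g(1)]
      inner_of[OF sq(1) g(1)] inner_of[OF f(1) sq(2)] by simp
qed

lemma symmetry_scaled:
  assumes "symmetry X" "s * s = 1" shows "symmetry (\<lambda>u. s *\<^sub>R X u)"
  using assms unfolding symmetry_def
  by (auto simp: linear_scale intro: linear_compose_scale_right)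

section \<open>The symmetry classes and the unitary map\<close>

locale symmetric_domain = gauge_root +
  fixes \<Omega> :: "plane set"
  assumes \<Omega>: "open \<Omega>" "reflect ` \<Omega> = \<Omega>"
begin

abbreviation "A \<equiv> AB_potential a b"
abbreviation "\<Omega>' \<equiv> \<Omega> - {(a, 0), (b, 0)}"
abbreviation "K \<equiv> K_op \<psi>"
text \<open>With the factor \<open>s\<close> the antisymmetric class is a space of fixed vectors
  too, so that both classes are ranges of a projection \<open>P\<close>.\<close>

abbreviation "\<Sigma> \<equiv> \<lambda>u. s *\<^sub>R Sigma_op u"
abbreviation "P \<equiv> \<lambda>u. average K (average \<Sigma> u)"
abbreviation "L \<equiv> {u \<in> l2_K \<Omega> \<psi>. Sigma_op u = s *\<^sub>R u}"
abbreviation "U \<equiv> l2_map (\<lambda>f x. \<phi> x * f x)"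

lemma respects_K: "l2_respects (\<lambda>f x. \<psi> x * cnj (f x))"
  by (rule l2_respects_unimodular(2)[OF gauge_function_measurable gauge_function_AE])

lemma respects_U: "l2_respects (\<lambda>f x. \<phi> x * f x)"
  by (rule l2_respects_unimodular(1)[OF half_gauge_measurable
        half_gauge_AE])

lemma off_poles_AE: "AE x::plane in lborel. x \<notin> {(a, 0), (b, 0)}"
  using real_axis_null by eventually_elim (auto simp: real_axis_def)

lemma symmetry_K: "symmetry K"
  unfolding symmetry_def
proof (intro conjI allI)
  note R = respects_K
  show "linear K"
    unfolding K_op_eq_l2_map by (rule linear_l2_map[OF R]) (auto simp: algebra_simps)
  fix u v :: l2
  obtain f g where f: "square_int f" "u = l2_of f" and g: "square_int g" "v = l2_of g"
    by (metis l2_cases)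
  note sq = l2_respects_square_int[OF R f(1)] l2_respects_square_int[OF R g(1)]
  have "AE x in lborel. \<psi> x * cnj (\<psi> x * cnj (f x)) = f x"
    using gauge_function_AE
  proof eventually_elim
    case (elim x)
    have "\<psi> x * cnj (\<psi> x * cnj (f x)) = (\<psi> x * cnj (\<psi> x)) * f x" by simp
    then show ?case using elim by (simp add: complex_norm_square[symmetric])
  qed
  then show "K (K u) = u"
    unfolding K_op_eq_l2_map f(2) l2_map_of[OF R f(1)] l2_map_of[OF R sq(1)]
    by (subst l2_of_eq_iff[OF l2_respects_square_int[OF R sq(1)] f(1)])
  have "(\<integral>x. \<psi> x * cnj (f x) * cnj (g x) \<partial>lborel) = cnj (\<integral>x. f x * cnj (\<psi> x * cnj (g x)) \<partial>lborel)"
    using Bochner_Integration.integral_cnj[of lborel "\<lambda>x. f x * cnj (\<psi> x * cnj (g x))"] by (simp add: mult_ac)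
  then show "K u \<bullet> v = u \<bullet> K v"
    unfolding K_op_eq_l2_map f(2) g(2) l2_map_of[OF R f(1)] l2_map_of[OF R g(1)]
      inner_of[OF sq(1) g(1)] inner_of[OF f(1) sq(2)] by simp
qed

lemma symmetry_\<Sigma>: "symmetry \<Sigma>"
  by (rule symmetry_scaled[OF symmetry_Sigma_op]) (use s in auto)

text \<open>Reflecting \<psi> conjugates it, which is exactly what the conjugation in
  \<open>Sigma_op\<close> undoes.\<close>

lemma K_\<Sigma>_commute: "K (\<Sigma> u) = \<Sigma> (K u)"
proof -
  obtain f where f: "square_int f" "u = l2_of f" by (metis l2_cases)
  note R = respects_K l2_respects_conj_reflect
  note sq = l2_respects_square_int[OF R(1) f(1)] l2_respects_square_int[OF R(2) f(1)]
  have lin: "linear K" using symmetry_K by (simp add: symmetry_def)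
  have "AE x in lborel. \<psi> x * cnj (cnj (f (reflect x))) = cnj (\<psi> (reflect x) * cnj (f (reflect x)))"
    using off_poles_AE by eventually_elim (simp add: gauge_function_reflect)
  then have "K (Sigma_op u) = Sigma_op (K u)"
    unfolding K_op_eq_l2_map Sigma_op_eq_l2_map f(2) l2_map_of[OF R(1) f(1)] l2_map_of[OF R(2) f(1)]
      l2_map_of[OF R(1) sq(2)] l2_map_of[OF R(2) sq(1)]
    by (subst l2_of_eq_iff[OF l2_respects_square_int[OF R(1) sq(2)] l2_respects_square_int[OF R(2) sq(1)]])
  then show ?thesis by (simp add: linear_scale[OF lin])
qed

lemmas P_facts = average_commuting[OF symmetry_K symmetry_\<Sigma> K_\<Sigma>_commute]

lemma L_eq: "L = {u \<in> l2_on \<Omega>. P u = u}"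
proof -
  have "\<Sigma> u = u \<longleftrightarrow> Sigma_op u = s *\<^sub>R u" for u
  proof
    assume "\<Sigma> u = u"
    then have "s *\<^sub>R \<Sigma> u = s *\<^sub>R u" by simp
    then show "Sigma_op u = s *\<^sub>R u" using s by auto
  qed (use s in auto)
  then show ?thesis unfolding P_facts(4) by (auto simp: l2_K_def)
qed

lemma P_l2_on: "P ` l2_on \<Omega> \<subseteq> l2_on \<Omega>"
proof -
  have K: "K u \<in> l2_on \<Omega>" and S: "Sigma_op u \<in> l2_on \<Omega>" if u: "u \<in> l2_on \<Omega>" for u
  proof -
    obtain f where f: "square_int f" "u = l2_of f" by (metis l2_cases)
    have z: "AE x in lborel. x \<notin> \<Omega> \<longrightarrow> f x = 0" using u l2_on_of[OF f(1)] by (simp add: f)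
    then have "AE x in lborel. x \<notin> \<Omega> \<longrightarrow> \<psi> x * cnj (f x) = 0" by eventually_elim simp
    then show "K u \<in> l2_on \<Omega>"
      unfolding K_op_eq_l2_map f(2) l2_map_of[OF respects_K f(1)]
      by (simp only: l2_on_of[OF l2_respects_square_int[OF respects_K f(1)]])
    have out: "reflect x \<notin> \<Omega>" if "x \<notin> \<Omega>" for x
      using that \<Omega>(2) by (metis image_eqI reflect_reflect)
    have "AE x in lborel. x \<notin> \<Omega> \<longrightarrow> cnj (f (reflect x)) = 0"
      using AE_reflect[OF z] by eventually_elim (use out in auto)
    then show "Sigma_op u \<in> l2_on \<Omega>"
      unfolding Sigma_op_eq_l2_map f(2) l2_map_of[OF l2_respects_conj_reflect f(1)]
      by (simp only: l2_on_of[OF l2_respects_square_int[OF l2_respects_conj_reflect f(1)]])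
  qed
  show ?thesis
    unfolding average_def
    by (intro image_subsetI subspace_scale subspace_add subspace_l2_on K S)
qed

lemma linear_U: "linear U"
  by (rule linear_l2_map[OF respects_U]) (auto simp: algebra_simps)

lemma inner_U: "U u \<bullet> U v = u \<bullet> v"
proof -
  obtain f g where f: "square_int f" "u = l2_of f" and g: "square_int g" "v = l2_of g"
    by (metis l2_cases)
  note sq = l2_respects_square_int[OF respects_U f(1)] l2_respects_square_int[OF respects_U g(1)]
  have "(\<integral>x. \<phi> x * f x * cnj (\<phi> x * g x) \<partial>lborel) = (\<integral>x. f x * cnj (g x) \<partial>lborel)"
  proof (rule integral_cong_AE)
    show "AE x in lborel. \<phi> x * f x * cnj (\<phi> x * g x) = f x * cnj (g x)"
      using half_gauge_AE
    proof eventually_elim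
      case (elim x)
      have "\<phi> x * f x * cnj (\<phi> x * g x) = (\<phi> x * cnj (\<phi> x)) * (f x * cnj (g x))" by simp
      then show ?case using elim by (simp add: complex_norm_square[symmetric])
    qed
  qed (use square_int_mult[OF sq] square_int_mult[OF f(1) g(1)] in auto)
  then show ?thesis
    unfolding f(2) g(2) l2_map_of[OF respects_U f(1)] l2_map_of[OF respects_U g(1)]
      inner_of[OF sq] inner_of[OF f(1) g(1)] by simp
qed

lemma square_int_cnj_half_gauge: "square_int f \<Longrightarrow> square_int (\<lambda>x. cnj (\<phi> x) * f x)"
  by (rule l2_respects_square_int[OF l2_respects_unimodular(1)])
    (use half_gauge_AE half_gauge_measurable
      borel_measurable_cnj in auto)

lemma U_cnj_half_gauge:
  assumes f: "square_int f" shows "U (l2_of (\<lambda>x. cnj (\<phi> x) * f x)) = l2_of f"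
proof -
  note sq = square_int_cnj_half_gauge[OF f]
  have "AE x in lborel. \<phi> x * (cnj (\<phi> x) * f x) = f x"
    using half_gauge_AE
  proof eventually_elim
    case (elim x)
    have "\<phi> x * (cnj (\<phi> x) * f x) = (\<phi> x * cnj (\<phi> x)) * f x" by simp
    then show ?case using elim by (simp add: complex_norm_square[symmetric])
  qed
  then show ?thesis
    unfolding l2_map_of[OF respects_U sq]
    by (subst l2_of_eq_iff[OF l2_respects_square_int[OF respects_U sq] f])
qed

lemma surj_U: "surj U"
proof
  show "UNIV \<subseteq> range U"
  proof
    fix u :: l2
    obtain f where f: "square_int f" "u = l2_of f" by (metis l2_cases)
    show "u \<in> range U"
      using rangeI[of U "l2_of (\<lambda>x. cnj (\<phi> x) * f x)"] unfolding U_cnj_half_gauge[OF f(1)] f(2) .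
  qed
qed simp

lemma L_of:
  assumes f: "square_int f"
  shows "l2_of f \<in> L \<longleftrightarrow> (AE x in lborel. x \<notin> \<Omega> \<longrightarrow> f x = 0) \<and>
    (AE x in lborel. \<psi> x * cnj (f x) = f x) \<and> (AE x in lborel. cnj (f (reflect x)) = of_real s * f x)"
proof -
  have "K (l2_of f) = l2_of f \<longleftrightarrow> (AE x in lborel. \<psi> x * cnj (f x) = f x)"
    unfolding K_op_eq_l2_map l2_map_of[OF respects_K f]
    by (rule l2_of_eq_iff[OF l2_respects_square_int[OF respects_K f] f])
  moreover have "Sigma_op (l2_of f) = s *\<^sub>R l2_of f \<longleftrightarrow>
      (AE x in lborel. cnj (f (reflect x)) = of_real s * f x)"
    unfolding Sigma_op_eq_l2_map l2_map_of[OF l2_respects_conj_reflect f] l2_of_scaleR[OF f]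
    by (subst l2_of_eq_iff[OF l2_respects_square_int[OF l2_respects_conj_reflect f] square_int_scaleR[OF f]])
      (simp add: scaleR_conv_of_real)
  ultimately show ?thesis
    by (simp add: l2_K_def l2_on_of[OF f])
qed

text \<open>The inverse of \<open>U\<close> is multiplication by \<open>cnj \<phi>\<close>. It turns
  fixed vectors of \<open>K\<close> into real functions, and the sign \<open>s\<close> from
  reflecting \<phi> cancels the one in the symmetry class.\<close>

lemma U_image: "U ` l2_real_sym \<Omega> = L"
proof (intro set_eqI iffI)
  fix u assume "u \<in> U ` l2_real_sym \<Omega>"
  then obtain v where v: "v \<in> l2_real_sym \<Omega>" "u = U v" by auto
  obtain f where f: "square_int f" "v = l2_of f" by (metis l2_cases)
  have ae: "AE x in lborel. x \<notin> \<Omega> \<longrightarrow> f x = 0" "AE x in lborel. f x \<in> \<real>"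
    "AE x in lborel. f (reflect x) = f x"
    using v(1) l2_real_sym_of[OF f(1)] by (simp_all add: f(2))
  have "AE x in lborel. x \<notin> \<Omega> \<longrightarrow> \<phi> x * f x = 0" using ae(1) by eventually_elim simp
  moreover have "AE x in lborel. \<psi> x * cnj (\<phi> x * f x) = \<phi> x * f x"
    using ae(2) branch_cut_null
  proof eventually_elim
    case (elim x)
    have "\<psi> x * cnj (\<phi> x * f x) = \<phi> x * (\<phi> x * cnj (\<phi> x)) * cnj (f x)"
      unfolding half_gauge_square[OF elim(2), symmetric] by (simp add: mult_ac)
    then show ?case
      using elim half_gauge_mult_cnj[OF elim(2)] by (simp add: Reals_cnj_iff)
  qed
  moreover have "AE x in lborel. cnj (\<phi> (reflect x) * f (reflect x)) = of_real s * (\<phi> x * f x)"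
    using ae(2,3) branch_cut_null
    by eventually_elim (simp add: half_gauge_reflect Reals_cnj_iff)
  ultimately show "u \<in> L"
    unfolding v(2) f(2) l2_map_of[OF respects_U f(1)] L_of[OF l2_respects_square_int[OF respects_U f(1)]]
    by blast
next
  fix u assume u: "u \<in> L"
  obtain f where f: "square_int f" "u = l2_of f" by (metis l2_cases)
  have ae: "AE x in lborel. x \<notin> \<Omega> \<longrightarrow> f x = 0" "AE x in lborel. \<psi> x * cnj (f x) = f x"
    "AE x in lborel. cnj (f (reflect x)) = of_real s * f x"
    using u unfolding f(2) L_of[OF f(1)] by auto
  have "AE x in lborel. x \<notin> \<Omega> \<longrightarrow> cnj (\<phi> x) * f x = 0" using ae(1) by eventually_elim simp
  moreover have "AE x in lborel. cnj (\<phi> x) * f x \<in> \<real>"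
    using ae(2) branch_cut_null
    by eventually_elim (simp add: Reals_cnj_iff half_gauge_swap)
  moreover have "AE x in lborel. cnj (\<phi> (reflect x)) * f (reflect x) = cnj (\<phi> x) * f x"
    using ae(2,3) branch_cut_null
  proof eventually_elim
    case (elim x)
    have "f (reflect x) = of_real s * cnj (f x)"
      using arg_cong[OF elim(2), of cnj] by simp
    then have "cnj (\<phi> (reflect x)) * f (reflect x) = (of_real s * of_real s) * (\<phi> x * cnj (f x))"
      by (simp add: half_gauge_reflect[OF elim(3)])
    then show ?case using half_gauge_swap[OF elim(3,1)] s by auto
  qed
  ultimately have "l2_of (\<lambda>x. cnj (\<phi> x) * f x) \<in> l2_real_sym \<Omega>"
    unfolding l2_real_sym_of[OF square_int_cnj_half_gauge[OF f(1)]] by blast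
  then have "U (l2_of (\<lambda>x. cnj (\<phi> x) * f x)) \<in> U ` l2_real_sym \<Omega>" by (rule imageI)
  then show "u \<in> U ` l2_real_sym \<Omega>"
    unfolding U_cnj_half_gauge[OF f(1)] f(2) .
qed

lemma cinner_i_mult: "square_int h \<Longrightarrow> cinner u (l2_of (\<lambda>x. \<i> * h x)) = - \<i> * cinner u (l2_of h)"
proof -
  assume h: "square_int h"
  have "square_int (\<lambda>x. \<i> * h x)"
    by (rule square_int_cong_AE[OF h]) (use h in \<open>auto simp: norm_mult square_int_def\<close>)
  moreover have "(\<integral>x. l2_rep u x * cnj (\<i> * h x) \<partial>lborel) = - \<i> * (\<integral>x. l2_rep u x * cnj (h x) \<partial>lborel)"
    using integral_mult_right_zero[of lborel "- \<i>" "\<lambda>x. l2_rep u x * cnj (h x)"] by (simp add: mult_ac)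
  ultimately show ?thesis by (simp add: cinner_rep h)
qed

section \<open>The Aharonov-Bohm operator and its symmetric core\<close>

lemma potential_domain: "\<Omega>' \<subseteq> - {(a, 0), (b, 0)}"
  by auto

lemmas potential_facts = potential_domain open_gauge_domain smooth_on_AB_potential[of a b]

lemma nonneg_op_H_A: "nonneg_op (magnetic_graph A (test_functions \<Omega>'))"
  by (rule nonneg_op_magnetic_graph[OF potential_facts])
    (auto intro: test_functions_zero test_functions_add test_functions_const_mult)

text \<open>The core is closed under multiplication by \<open>i\<close>, so the real adjoint
  relation tested with \<open>i w\<close> supplies the imaginary part of the complex one.\<close>

lemma H_A_eq: "H_A \<Omega> a b = real_friedrichs (l2_on \<Omega>) (magnetic_graph A (test_functions \<Omega>'))"
  unfolding H_A_def magnetic_graph_def[symmetric]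
proof (rule friedrichs_eq_real_friedrichs)
  let ?T = "magnetic_graph A (test_functions \<Omega>')"
  show "(v - w, g - h) \<in> ?T" if "(v, g) \<in> ?T" "(w, h) \<in> ?T" for v g w h
    by (rule nonneg_op_diff[OF nonneg_op_H_A that])
  show "cinner v g = of_real (v \<bullet> g) \<and> 0 \<le> v \<bullet> g" if "(v, g) \<in> ?T" for v g
    using that nonneg_op_nonneg[OF nonneg_op_H_A that]
    by (auto simp: magnetic_graph_def inner_l2_def cinner_magnetic_laplace_self[OF potential_facts])
  fix u f :: l2
  assume adj: "\<forall>(v, g)\<in>?T. u \<bullet> g = f \<bullet> v"
  show "\<forall>(v, g)\<in>?T. cinner u g = cinner f v"
  proof clarify
    fix v g assume "(v, g) \<in> ?T"
    then obtain w where w: "w \<in> test_functions \<Omega>'" "v = l2_of w" "g = l2_of (magnetic_laplace A w)"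
      by (auto simp: magnetic_graph_def)
    have sq: "square_int w" "square_int (magnetic_laplace A w)"
      using square_int_test_functions[OF w(1)] square_int_magnetic_laplace[OF potential_facts w(1)] by auto
    have iw: "(\<lambda>x. \<i> * w x) \<in> test_functions \<Omega>'" by (rule test_functions_const_mult[OF w(1)])
    have adj': "Re (cinner u (l2_of (magnetic_laplace A y))) = Re (cinner f (l2_of y))"
      if "y \<in> test_functions \<Omega>'" for y
      using adj that by (auto simp: magnetic_graph_def inner_l2_def)
    have "Im (cinner u g) = Im (cinner f v)"
      using adj'[OF iw] unfolding magnetic_laplace_const_mult[OF w(1) potential_facts]
      by (simp add: cinner_i_mult sq w)
    then show "cinner u g = cinner f v"
      using adj'[OF w(1)] by (simp add: complex_eq_iff w)
  qed
qed

text \<open>The symmetries are imposed at every point, not almost everywhere: this gives information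
  on the cut, a null set.\<close>

definition fixed_functions :: "(plane \<Rightarrow> complex) set" where
  "fixed_functions = {w \<in> test_functions \<Omega>'. gauge_conj w = w \<and> conj_reflect w = (\<lambda>x. of_real s * w x)}"

lemma reflect_\<Omega>': "reflect ` \<Omega>' = \<Omega>'"
proof -
  have p: "reflect ` {(a, 0), (b, 0)} = {(a, 0), (b, 0)}" by (simp add: reflect_def)
  have "inj reflect" by (rule injI) (metis reflect_reflect)
  then show ?thesis using \<Omega>(2) p by (metis image_set_diff)
qed

text \<open>A test function whose class lies in \<open>L\<close> is replaced by its average over
  both symmetries. The average is fixed at every point, and neither its class nor the class of its
  image changes, since the symmetries commute with \<open>magnetic_laplace\<close>.\<close>

lemma magnetic_graph_fixed:
  "magnetic_graph A (test_functions \<Omega>') \<inter> L \<times> L = magnetic_graph A fixed_functions"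
proof (intro set_eqI iffI)
  fix p assume p: "p \<in> magnetic_graph A (test_functions \<Omega>') \<inter> L \<times> L"
  then obtain w where w: "w \<in> test_functions \<Omega>'" "p = (l2_of w, l2_of (magnetic_laplace A w))"
    by (auto simp: magnetic_graph_def)
  \<comment> \<open>Averaging over the second symmetry preserves the first, as the two commute on
    test functions.\<close>
  define w1 where "w1 x = of_real (1 / 2) * (w x + gauge_conj w x)" for x
  define w2 where "w2 x = of_real (1 / 2) * (w1 x + of_real s * conj_reflect w1 x)" for x
  note G = test_functions_gauge_conj[OF _ potential_domain]
  note C = test_functions_conj_reflect[OF _ reflect_\<Omega>']
  have Gw: "gauge_conj w \<in> test_functions \<Omega>'" by (rule G[OF w(1)])
  have w1: "w1 \<in> test_functions \<Omega>'"
    unfolding w1_def[abs_def] by (intro test_functions_const_mult test_functions_add w Gw)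
  have Cw: "conj_reflect w1 \<in> test_functions \<Omega>'" by (rule C[OF w1])
  have sCw: "(\<lambda>x. of_real s * conj_reflect w1 x) \<in> test_functions \<Omega>'"
    by (rule test_functions_const_mult[OF Cw])
  have w2: "w2 \<in> test_functions \<Omega>'"
    unfolding w2_def[abs_def] by (intro test_functions_const_mult test_functions_add w1 sCw)
  have gg: "gauge_conj (gauge_conj f) x = f x" if "f \<in> test_functions \<Omega>'" for f x
  proof (cases "x \<in> \<Omega>'")
    case True
    have "gauge_conj (gauge_conj f) x = (\<psi> x * cnj (\<psi> x)) * f x" by simp
    also have "\<psi> x * cnj (\<psi> x) = 1"
      using gauge_function_norm[of x] True complex_norm_square[of "\<psi> x"] by simp
    finally show ?thesis by simp
  qed (use test_functions_outside[OF that] in simp)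
  have gc: "gauge_conj (conj_reflect f) x = conj_reflect (gauge_conj f) x" if "f \<in> test_functions \<Omega>'" for f x
  proof (cases "x \<in> \<Omega>'")
    case True
    then show ?thesis using gauge_function_reflect[of x] by simp
  next
    case False
    then have "reflect x \<notin> \<Omega>'" using reflect_\<Omega>' by (metis image_eqI reflect_reflect)
    then show ?thesis using test_functions_outside[OF that] by simp
  qed
  have g1: "gauge_conj w1 x = w1 x" for x
    using gg[OF w(1), of x] by (simp add: w1_def algebra_simps)
  have "gauge_conj w2 x = w2 x" for x
    using g1[of x] gc[OF w1, of x] g1[of "reflect x"] by (simp add: w2_def algebra_simps)
  moreover have "conj_reflect w2 x = of_real s * w2 x" for x
    using s by (auto simp: w2_def algebra_simps)
  ultimately have fixed: "w2 \<in> fixed_functions"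
    using w2 by (simp add: fixed_functions_def fun_eq_iff)
  have avg: "l2_of f = l2_of (\<lambda>x. of_real (1 / 2) * (f x + g x))"
    if "f \<in> test_functions \<Omega>'" "g \<in> test_functions \<Omega>'" "l2_of g = l2_of f" for f g
  proof -
    note sq = square_int_test_functions[OF that(1)] square_int_test_functions[OF that(2)]
    have "AE x in lborel. g x = f x" using that(3) l2_of_eq_iff[OF sq(2,1)] by simp
    then have "AE x in lborel. f x = of_real (1 / 2) * (f x + g x)"
      by eventually_elim simp
    then show ?thesis
      by (subst l2_of_eq_iff[OF sq(1) square_int_test_functions[OF test_functions_const_mult[OF
              test_functions_add[OF that(1,2)]]]])
  qed
  have in_L: "l2_of w \<in> L" "l2_of (magnetic_laplace A w) \<in> L" using p w(2) by auto
  have KL: "l2_of (gauge_conj f) = l2_of f" if "f \<in> test_functions \<Omega>'" "l2_of f \<in> L" for f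
    using that(2) l2_map_of[OF respects_K square_int_test_functions[OF that(1)]]
    by (simp add: l2_K_def K_op_eq_l2_map)
  have SL: "l2_of (\<lambda>x. of_real s * conj_reflect f x) = l2_of f" if "f \<in> test_functions \<Omega>'" "l2_of f \<in> L" for f
  proof -
    note sq = square_int_test_functions[OF that(1)] square_int_test_functions[OF C[OF that(1)]]
    have "l2_of (conj_reflect f) = s *\<^sub>R l2_of f"
      using that(2) l2_map_of[OF l2_respects_conj_reflect sq(1)] by (simp add: Sigma_op_eq_l2_map)
    then have "s *\<^sub>R l2_of (conj_reflect f) = l2_of f" using s by auto
    then show ?thesis using l2_of_scaleR[OF sq(2), of s] by (simp add: scaleR_conv_of_real)
  qed
  have Lw: "magnetic_laplace A f \<in> test_functions \<Omega>'" if "f \<in> test_functions \<Omega>'" for f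
    by (rule test_functions_magnetic_laplace[OF that potential_facts])
  have v1: "l2_of w = l2_of w1"
    unfolding w1_def[abs_def] by (rule avg[OF w(1) Gw KL[OF w(1) in_L(1)]])
  have Lw1: "magnetic_laplace A w1 = (\<lambda>x. of_real (1 / 2) * (magnetic_laplace A w x + gauge_conj (magnetic_laplace A w) x))"
    unfolding w1_def[abs_def] magnetic_laplace_const_mult[OF test_functions_add[OF w(1) Gw] potential_facts]
      magnetic_laplace_add[OF w(1) Gw potential_facts] magnetic_laplace_gauge_conj[OF w(1) potential_domain] ..
  have g1: "l2_of (magnetic_laplace A w) = l2_of (magnetic_laplace A w1)"
    unfolding Lw1 by (rule avg[OF Lw[OF w(1)] G[OF Lw[OF w(1)]] KL[OF Lw[OF w(1)] in_L(2)]])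
  have v2: "l2_of w1 = l2_of w2"
    unfolding w2_def[abs_def] by (rule avg[OF w1 sCw SL[OF w1 in_L(1)[unfolded v1]]])
  have Lw2: "magnetic_laplace A w2 = (\<lambda>x. of_real (1 / 2) * (magnetic_laplace A w1 x + of_real s * conj_reflect (magnetic_laplace A w1) x))"
    unfolding w2_def[abs_def] magnetic_laplace_const_mult[OF test_functions_add[OF w1 sCw] potential_facts]
      magnetic_laplace_add[OF w1 sCw potential_facts] magnetic_laplace_const_mult[OF Cw potential_facts]
      magnetic_laplace_conj_reflect[OF w1 reflect_\<Omega>' potential_domain] ..
  have g2: "l2_of (magnetic_laplace A w1) = l2_of (magnetic_laplace A w2)"
    unfolding Lw2
    by (rule avg[OF Lw[OF w1] test_functions_const_mult[OF C[OF Lw[OF w1]]] SL[OF Lw[OF w1] in_L(2)[unfolded g1]]])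
  show "p \<in> magnetic_graph A fixed_functions"
    using fixed unfolding w(2) v1 v2 g1 g2 by (auto simp: magnetic_graph_def)
next
  fix p assume "p \<in> magnetic_graph A fixed_functions"
  then obtain w where w: "w \<in> fixed_functions" "p = (l2_of w, l2_of (magnetic_laplace A w))"
    by (auto simp: magnetic_graph_def)
  then have wt: "w \<in> test_functions \<Omega>'" and gw: "gauge_conj w = w"
    and cw: "conj_reflect w = (\<lambda>x. of_real s * w x)" by (auto simp: fixed_functions_def)
  have in_L: "l2_of f \<in> L" if "f \<in> test_functions \<Omega>'" "gauge_conj f = f" "conj_reflect f = (\<lambda>x. of_real s * f x)" for f
    unfolding L_of[OF square_int_test_functions[OF that(1)]]
    using fun_cong[OF that(2)] fun_cong[OF that(3)] test_functions_outside[OF that(1)] by auto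
  have "gauge_conj (magnetic_laplace A w) = magnetic_laplace A w"
    using magnetic_laplace_gauge_conj[OF wt potential_domain] gw by simp
  moreover have "conj_reflect (magnetic_laplace A w) = (\<lambda>x. of_real s * magnetic_laplace A w x)"
    using magnetic_laplace_conj_reflect[OF wt reflect_\<Omega>' potential_domain]
      magnetic_laplace_const_mult[OF wt potential_facts] cw by simp
  ultimately have "l2_of (magnetic_laplace A w) \<in> L"
    by (intro in_L test_functions_magnetic_laplace[OF wt potential_facts])
  then show "p \<in> magnetic_graph A (test_functions \<Omega>') \<inter> L \<times> L"
    using in_L[OF wt gw cw] wt by (auto simp: w(2) magnetic_graph_def)
qed

end

section \<open>The Laplacian on even real functions\<close>

definition even_real_functions :: "plane set \<Rightarrow> (plane \<Rightarrow> complex) set" where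
  "even_real_functions S = {u \<in> test_functions S. range u \<subseteq> \<real> \<and> u \<circ> reflect = u}"

lemma even_real_functions_test: "even_real_functions S \<subseteq> test_functions S"
  by (auto simp: even_real_functions_def)

lemma even_real_functionsD:
  assumes "u \<in> even_real_functions S"
  shows "u \<in> test_functions S" "u x \<in> \<real>" "u (reflect x) = u x"
proof -
  from assms have u: "u \<in> test_functions S" "range u \<subseteq> \<real>" "u \<circ> reflect = u"
    by (simp_all add: even_real_functions_def)
  show "u \<in> test_functions S" by (rule u(1))
  show "u x \<in> \<real>" using u(2) by blast
  show "u (reflect x) = u x" using fun_cong[OF u(3), of x] by simp
qed

lemma even_real_functionsI:
  "u \<in> test_functions S \<Longrightarrow> (\<And>x. u x \<in> \<real>) \<Longrightarrow> (\<And>x. u (reflect x) = u x) \<Longrightarrow> u \<in> even_real_functions S"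
  by (auto simp: even_real_functions_def)

lemma nonneg_op_even_real_functions: "nonneg_op (magnetic_graph (\<lambda>_. 0) (even_real_functions S))"
proof (rule nonneg_op_magnetic_graph[OF subset_UNIV open_UNIV smooth_on_const even_real_functions_test])
  show "(\<lambda>x. 0) \<in> even_real_functions S"
    by (auto simp: even_real_functions_def test_functions_zero)
  fix u v and r :: real assume u: "u \<in> even_real_functions S"
  note u = even_real_functionsD[OF u]
  show "(\<lambda>x. of_real r * u x) \<in> even_real_functions S"
    by (rule even_real_functionsI[OF test_functions_const_mult[OF u(1)]]) (simp_all add: u)
  assume v: "v \<in> even_real_functions S"
  note v = even_real_functionsD[OF v]
  show "(\<lambda>x. u x + v x) \<in> even_real_functions S"
    by (rule even_real_functionsI[OF test_functions_add[OF u(1) v(1)]]) (simp_all add: u v)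
qed

text \<open>Elements of the space and the test functions paired with them are real almost
  everywhere, so \<open>cinner\<close> has no imaginary part and the two adjoint relations
  coincide.\<close>

lemma sym_laplacian_eq:
  "sym_laplacian \<Omega> D =
    real_friedrichs (l2_real_sym \<Omega>) (magnetic_graph (\<lambda>_. 0) (even_real_functions (\<Omega> - D)))"
proof -
  let ?X = "even_real_functions (\<Omega> - D)"
  let ?T = "magnetic_graph (\<lambda>_. 0) ?X"
  note free = subset_UNIV open_UNIV smooth_on_const
  have "{(l2_of u, l2_of (\<lambda>x. - laplace u x)) |u.
      u \<in> test_functions (\<Omega> - D) \<and> range u \<subseteq> \<real> \<and> u \<circ> reflect = u} = ?T"
    unfolding magnetic_graph_def
    by (intro Collect_cong ex_cong1)
      (auto simp: even_real_functions_def magnetic_laplace_zero[of _ "\<Omega> - D"])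
  moreover have "friedrichs (l2_real_sym \<Omega>) ?T = real_friedrichs (l2_real_sym \<Omega>) ?T"
  proof (rule friedrichs_eq_real_friedrichs)
    show "(v - w, g - h) \<in> ?T" if "(v, g) \<in> ?T" "(w, h) \<in> ?T" for v g w h
      by (rule nonneg_op_diff[OF nonneg_op_even_real_functions that])
    show "cinner v g = of_real (v \<bullet> g) \<and> 0 \<le> v \<bullet> g" if "(v, g) \<in> ?T" for v g
      using that nonneg_op_nonneg[OF nonneg_op_even_real_functions that]
      by (auto simp: magnetic_graph_def inner_l2_def even_real_functions_def
          cinner_magnetic_laplace_self[OF free])
    have real: "cinner u (l2_of h) = of_real (u \<bullet> l2_of h)"
      if "u \<in> l2_real_sym \<Omega>" "square_int h" "\<And>x. h x \<in> \<real>" for u h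
    proof -
      have "AE x in lborel. l2_rep u x \<in> \<real>" using that(1) by (simp add: l2_real_sym_def)
      then have "AE x in lborel. Im (l2_rep u x * cnj (h x)) = 0"
        by eventually_elim (use that(3) in \<open>simp add: complex_is_Real_iff\<close>)
      then have "(\<integral>x. Im (l2_rep u x * cnj (h x)) \<partial>lborel) = 0"
        by (rule integral_eq_zero_AE)
      then have "Im (cinner u (l2_of h)) = 0"
        using integral_Im[OF square_int_mult[OF l2_rep_square_int that(2)], of u]
        by (simp add: cinner_rep that(2))
      then show ?thesis by (simp add: inner_l2_def complex_eq_iff)
    qed
    fix u f assume u: "u \<in> l2_real_sym \<Omega>" and f: "f \<in> l2_real_sym \<Omega>"
      and adj: "\<forall>(v, g)\<in>?T. u \<bullet> g = f \<bullet> v"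
    show "\<forall>(v, g)\<in>?T. cinner u g = cinner f v"
    proof clarify
      fix v g assume vg: "(v, g) \<in> ?T"
      then obtain w where w: "w \<in> ?X" "v = l2_of w" "g = l2_of (magnetic_laplace (\<lambda>_. 0) w)"
        by (auto simp: magnetic_graph_def)
      have wt: "w \<in> test_functions (\<Omega> - D)" and wr: "range w \<subseteq> \<real>"
        using w(1) by (auto simp: even_real_functions_def)
      have "cinner u g = of_real (u \<bullet> g)"
        unfolding w(3)
        by (rule real[OF u square_int_magnetic_laplace[OF free wt]])
          (use laplace_real[OF wt wr] in \<open>simp add: magnetic_laplace_zero[OF wt]\<close>)
      moreover have "cinner f v = of_real (f \<bullet> v)"
        unfolding w(2) by (rule real[OF f square_int_test_functions[OF wt]]) (use wr in auto)
      ultimately show "cinner u g = cinner f v" using adj vg by auto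
    qed
  qed
  ultimately show ?thesis unfolding sym_laplacian_def by simp
qed

lemma even_real_functions_truncation:
  assumes w: "w \<in> even_real_functions S" and \<epsilon>: "\<epsilon> > 0"
  shows "truncation \<epsilon> w \<in> even_real_functions S"
proof -
  note w = even_real_functionsD[OF w]
  show ?thesis
    by (rule even_real_functionsI[OF test_functions_truncation(1)[OF w(1) \<epsilon>]])
      (simp_all add: truncation_def w)
qed

text \<open>A test function vanishes on \<open>D\<close>, hence by continuity on its closure, which
  contains \<open>D'\<close>; the supports of its truncations therefore miss \<open>D'\<close>, even
  if its own support does not.\<close>

lemma even_real_functions_form_dense:
  assumes D: "D \<subseteq> D'" "D' \<subseteq> closure D"
  shows "form_dense (magnetic_graph (\<lambda>_. 0) (even_real_functions (\<Omega> - D')))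
    (magnetic_graph (\<lambda>_. 0) (even_real_functions (\<Omega> - D)))"
proof (rule form_dense_truncation[OF subset_UNIV open_UNIV smooth_on_const even_real_functions_test])
  fix w :: "plane \<Rightarrow> complex" assume w: "w \<in> even_real_functions (\<Omega> - D)"
  then have wt: "w \<in> test_functions (\<Omega> - D)" and wr: "range w \<subseteq> \<real>"
    by (auto simp: even_real_functions_def)
  show "Re (cnj (w x) * magnetic_deriv (\<lambda>_. 0) e w x) = 0" for x e
    by (rule free_deriv_real[OF wt wr])
  fix \<epsilon> :: real assume \<epsilon>: "\<epsilon> > 0"
  have zero: "w x = 0" if "x \<in> D'" for x
  proof -
    have "closure D \<subseteq> {x. w x = 0}"
      using test_functions_outside[OF wt]
      by (intro closure_minimal closed_Collect_eq test_functions_continuous[OF wt] continuous_on_const) auto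
    then show ?thesis using that D by auto
  qed
  have "closure {x. truncation \<epsilon> w x \<noteq> 0} \<subseteq> closure {x. w x \<noteq> 0} \<inter> {x. \<epsilon> \<le> cmod (w x)}"
    by (rule test_functions_truncation(2)[OF wt \<epsilon>])
  also have "\<dots> \<subseteq> \<Omega> - D'"
    using test_functions_support[OF wt] zero \<epsilon> by force
  finally show "truncation \<epsilon> w \<in> even_real_functions (\<Omega> - D')"
    using even_real_functions_truncation[OF w \<epsilon>]
    by (auto simp: even_real_functions_def test_functions_def)
qed

lemma l2_map_magnetic_graph:
  assumes R: "l2_respects \<Phi>" and sq: "\<And>w. w \<in> X \<Longrightarrow> square_int w \<and> square_int (magnetic_laplace A w)"
    and X: "\<And>w. w \<in> X \<Longrightarrow> \<Phi> w \<in> X" "\<And>w. w \<in> X \<Longrightarrow> magnetic_laplace A (\<Phi> w) = \<Phi> (magnetic_laplace A w)"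
    and vg: "(v, g) \<in> magnetic_graph A X"
  shows "(l2_map \<Phi> v, l2_map \<Phi> g) \<in> magnetic_graph A X"
proof -
  obtain w where w: "w \<in> X" "v = l2_of w" "g = l2_of (magnetic_laplace A w)"
    using vg by (auto simp: magnetic_graph_def)
  show ?thesis
    unfolding w(2,3) magnetic_graph_def mem_Collect_eq using sq[OF w(1)] X[OF w(1)]
    by (intro exI[of _ "\<Phi> w"]) (simp add: l2_map_of[OF R])
qed

lemma average_graph:
  assumes T: "nonneg_op T" and X: "\<And>v g. (v, g) \<in> T \<Longrightarrow> (X v, X g) \<in> T" and v: "(v, g) \<in> T"
  shows "(average X v, average X g) \<in> T"
  unfolding average_def by (intro nonneg_op_scaleR nonneg_op_add T X v)

section \<open>Reduction to a symmetry class and comparison of cores\<close>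

context symmetric_domain
begin

text \<open>Both symmetries preserve the test functions off the poles and commute with
  \<open>magnetic_laplace\<close>, so \<open>P\<close> reduces the operator; test functions remain
  total because the poles are a null set.\<close>

lemma restrict_H_A: "restrict_op (H_A \<Omega> a b) L = real_friedrichs L (magnetic_graph A fixed_functions)"
proof -
  let ?T = "magnetic_graph A (test_functions \<Omega>')"
  have TH: "?T \<subseteq> l2_on \<Omega> \<times> l2_on \<Omega>"
    unfolding magnetic_graph_def
    by (auto intro!: test_functions_l2_on test_functions_magnetic_laplace[OF _ potential_facts])
  have sq: "square_int w \<and> square_int (magnetic_laplace A w)" if "w \<in> test_functions \<Omega>'" for w
    using that square_int_test_functions square_int_magnetic_laplace[OF potential_facts] by blast
  have K: "(K v, K g) \<in> ?T" if "(v, g) \<in> ?T" for v g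
    unfolding K_op_eq_l2_map
    by (rule l2_map_magnetic_graph[OF respects_K sq _ _ that])
      (simp_all add: test_functions_gauge_conj[OF _ potential_domain]
        magnetic_laplace_gauge_conj[OF _ potential_domain])
  have "(Sigma_op v, Sigma_op g) \<in> ?T" if "(v, g) \<in> ?T" for v g
    unfolding Sigma_op_eq_l2_map
    by (rule l2_map_magnetic_graph[OF l2_respects_conj_reflect sq _ _ that])
      (simp_all add: test_functions_conj_reflect[OF _ reflect_\<Omega>']
        magnetic_laplace_conj_reflect[OF _ reflect_\<Omega>' potential_domain])
  then have S: "(\<Sigma> v, \<Sigma> g) \<in> ?T" if "(v, g) \<in> ?T" for v g
    using that by (intro nonneg_op_scaleR nonneg_op_H_A)
  have "{(u, f) \<in> real_friedrichs (l2_on \<Omega>) ?T. u \<in> L} = real_friedrichs L (?T \<inter> L \<times> L)"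
  proof (rule real_friedrichs_reduce[OF nonneg_op_H_A TH P_facts(1,3,2) P_l2_on subspace_l2_on _ _ L_eq])
    show "(P v, P g) \<in> ?T" if "(v, g) \<in> ?T" for v g
      by (intro average_graph[OF nonneg_op_H_A] K S that)
    fix f assume f: "f \<in> l2_on \<Omega>" and orth: "\<And>v g. (v, g) \<in> ?T \<Longrightarrow> f \<bullet> v = 0"
    show "f = 0"
    proof (rule l2_test_functions_dense[OF _ _ f])
      show "open \<Omega>'" using \<Omega>(1) by (intro open_Diff finite_imp_closed) auto
      show "AE x in lborel. x \<in> \<Omega> \<longrightarrow> x \<in> \<Omega>'" using off_poles_AE by eventually_elim auto
      show "f \<bullet> l2_of w = 0" if "w \<in> test_functions \<Omega>'" for w
        using that by (intro orth[of _ "l2_of (magnetic_laplace A w)"]) (auto simp: magnetic_graph_def)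
    qed
  qed
  then show ?thesis
    unfolding restrict_op_def H_A_eq magnetic_graph_fixed .
qed

abbreviation "gauged_functions \<equiv> (\<lambda>u x. \<phi> x * u x) ` even_real_functions (\<Omega> - B)"

lemma cut_domain: "\<Omega> - B \<subseteq> - B" "\<Omega> - B \<subseteq> \<Omega>'"
  using branch_cut_poles by auto

lemma U_graph:
  "map_prod U U ` magnetic_graph (\<lambda>_. 0) (even_real_functions (\<Omega> - B)) = magnetic_graph A gauged_functions"
proof -
  have "map_prod U U (l2_of u, l2_of (magnetic_laplace (\<lambda>_. 0) u)) =
      (l2_of (\<lambda>x. \<phi> x * u x), l2_of (magnetic_laplace A (\<lambda>x. \<phi> x * u x)))"
    if "u \<in> even_real_functions (\<Omega> - B)" for u
  proof -
    have u: "u \<in> test_functions (\<Omega> - B)" using that by (auto simp: even_real_functions_def)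
    show ?thesis
      unfolding magnetic_laplace_half_gauge[OF u cut_domain(1)] map_prod_simp
        l2_map_of[OF respects_U square_int_test_functions[OF u]]
        l2_map_of[OF respects_U square_int_magnetic_laplace[OF subset_UNIV open_UNIV smooth_on_const u]] ..
  qed
  then show ?thesis
    unfolding magnetic_graph_def by (auto simp: image_iff) (metis (lifting))+
qed

lemma gauged_functions_fixed: "gauged_functions \<subseteq> fixed_functions"
proof clarify
  fix u assume "u \<in> even_real_functions (\<Omega> - B)"
  note u = even_real_functionsD[OF this]
  have out: "u x = 0" if "x \<in> B" for x using test_functions_outside[OF u(1)] that by auto
  have cu: "cnj (u x) = u x" for x using u(2) by (simp add: Reals_cnj_iff)
  have "gauge_conj (\<lambda>x. \<phi> x * u x) x = \<phi> x * u x" for x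
  proof (cases "x \<in> B")
    case False
    have "gauge_conj (\<lambda>x. \<phi> x * u x) x = \<phi> x * (\<phi> x * cnj (\<phi> x)) * cnj (u x)"
      unfolding half_gauge_square[OF False, symmetric] by (simp add: mult_ac)
    then show ?thesis by (simp add: half_gauge_mult_cnj[OF False] cu)
  qed (simp add: out)
  moreover have "conj_reflect (\<lambda>x. \<phi> x * u x) x = of_real s * (\<phi> x * u x)" for x
  proof (cases "x \<in> B")
    case False
    then show ?thesis by (simp add: half_gauge_reflect u(3) cu)
  qed (simp add: out u(3))
  moreover have "(\<lambda>x. \<phi> x * u x) \<in> test_functions \<Omega>'"
    using test_functions_half_gauge[OF u(1) cut_domain(1)] test_functions_mono[OF cut_domain(2)] by blast
  ultimately show "(\<lambda>x. \<phi> x * u x) \<in> fixed_functions"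
    by (simp add: fixed_functions_def fun_eq_iff)
qed

text \<open>Both symmetries force a fixed function to vanish on the branch cut, so its truncations
  are supported away from the cut and can be divided by \<open>\<phi>\<close>.\<close>
lemma gauged_functions_form_dense:
  "form_dense (magnetic_graph A gauged_functions) (magnetic_graph A fixed_functions)"
proof (rule form_dense_truncation[OF potential_facts])
  show "fixed_functions \<subseteq> test_functions \<Omega>'" by (auto simp: fixed_functions_def)
  fix w assume "w \<in> fixed_functions"
  then have w: "w \<in> test_functions \<Omega>'" and gw: "gauge_conj w = w"
    and cw: "conj_reflect w = (\<lambda>x. of_real s * w x)" by (auto simp: fixed_functions_def)
  show "Re (cnj (w x) * magnetic_deriv A e w x) = 0" for x e
    by (rule gauge_conj_fixed_deriv[OF w potential_domain gw])
  fix \<epsilon> :: real assume \<epsilon>: "\<epsilon> > 0"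
  have gx: "\<psi> x * cnj (w x) = w x" and cx: "cnj (w (reflect x)) = of_real s * w x" for x
    using fun_cong[OF gw, of x] fun_cong[OF cw, of x] by auto
  have zero: "w x = 0" if "x \<in> B" for x
  proof (cases "x \<in> {(a, 0), (b, 0)}")
    case True
    then show ?thesis using test_functions_outside[OF w] by auto
  next
    case False
    then have "\<psi> x = - of_real s" using that by (auto simp: branch_cut_def)
    moreover have "reflect x = x"
      using that branch_cut_subset_axis by (auto simp: real_axis_def reflect_def prod_eq_iff subset_eq)
    \<comment> \<open>On the cut the reflection is the identity and \<open>\<psi> = - s\<close>, so
      the two symmetries combine to \<open>- w x = w x\<close>.\<close>
    ultimately have "- of_real s * (of_real s * w x) = w x"
      using gx[of x] cx[of x] by simp
    then show ?thesis using s by auto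
  qed
  let ?t = "truncation \<epsilon> w"
  have supp: "closure {x. ?t x \<noteq> 0} \<subseteq> \<Omega> - B"
  proof -
    have "closure {x. ?t x \<noteq> 0} \<subseteq> closure {x. w x \<noteq> 0} \<inter> {x. \<epsilon> \<le> cmod (w x)}"
      by (rule test_functions_truncation(2)[OF w \<epsilon>])
    also have "\<dots> \<subseteq> \<Omega> - B"
      using test_functions_support[OF w] zero \<epsilon> by force
    finally show ?thesis .
  qed
  then have t: "?t \<in> test_functions (\<Omega> - B)"
    using test_functions_truncation(1)[OF w \<epsilon>] by (auto simp: test_functions_def)
  \<comment> \<open>Division by the unimodular \<phi>, legitimate since the truncation is supported
    where \<phi> is smooth.\<close>
  define u where "u x = cnj (\<phi> x) * ?t x" for x
  have "u \<in> test_functions (\<Omega> - B)"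
    unfolding u_def[abs_def]
    by (rule test_functions_smooth_mult[OF t cut_domain(1) open_branch_cut_compl
          smooth_on_cnj[OF open_branch_cut_compl half_gauge_smooth]])
  moreover have cu: "u x \<in> \<real> \<and> u (reflect x) = u x" for x
  proof (cases "x \<in> B")
    case True
    then show ?thesis using zero reflect_branch_cut[of x] by (simp add: u_def truncation_def)
  next
    case False
    let ?h = "complex_of_real (flat ((cmod (w x))\<^sup>2 / \<epsilon>\<^sup>2 - 1))"
    have sw: "cnj (\<phi> x) * w x = \<phi> x * cnj (w x)" by (rule half_gauge_swap[OF False gx])
    have ux: "u x = ?h * (cnj (\<phi> x) * w x)" by (simp add: u_def truncation_def)
    have wr: "w (reflect x) = of_real s * cnj (w x)"
      using arg_cong[OF cx[of x], of cnj] by simp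
    then have "cmod (w (reflect x)) = cmod (w x)" using s by (auto simp: norm_mult)
    then have "u (reflect x) = ?h * (cnj (\<phi> (reflect x)) * w (reflect x))"
      by (simp add: u_def truncation_def)
    also have "\<dots> = ?h * ((of_real s * of_real s) * (\<phi> x * cnj (w x)))"
      unfolding half_gauge_reflect[OF False] wr by (simp only: mult_ac)
    also have "\<dots> = u x" using s_square(2) by (simp add: ux sw)
    finally have "u (reflect x) = u x" .
    moreover have "cnj (u x) = u x" unfolding ux using sw by simp
    ultimately show ?thesis by (simp add: Reals_cnj_iff)
  qed
  ultimately have "u \<in> even_real_functions (\<Omega> - B)"
    by (intro even_real_functionsI) auto
  moreover have "?t = (\<lambda>x. \<phi> x * u x)"
  proof
    fix x show "?t x = \<phi> x * u x"
    proof (cases "x \<in> B")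
      case True
      then show ?thesis using zero by (simp add: u_def truncation_def)
    next
      case False
      then show ?thesis
        using half_gauge_mult_cnj[OF False] by (simp add: u_def mult.assoc[symmetric])
    qed
  qed
  ultimately show "?t \<in> gauged_functions" by blast
qed

lemma nonneg_op_fixed: "nonneg_op (magnetic_graph A fixed_functions)"
proof (rule nonneg_op_magnetic_graph[OF potential_facts])
  show "fixed_functions \<subseteq> test_functions \<Omega>'" "(\<lambda>x. 0) \<in> fixed_functions"
    by (auto simp: fixed_functions_def test_functions_zero)
  fix u v and r :: real assume u: "u \<in> fixed_functions"
  show "(\<lambda>x. of_real r * u x) \<in> fixed_functions"
    using u by (auto simp: fixed_functions_def fun_eq_iff mult_ac intro: test_functions_const_mult)
  assume v: "v \<in> fixed_functions"
  show "(\<lambda>x. u x + v x) \<in> fixed_functions"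
    using u v by (auto simp: fixed_functions_def fun_eq_iff distrib_left intro: test_functions_add)
qed

text \<open>The map \<open>U\<close> needs the closed cut \<open>B\<close>, whereas the Dirichlet
  set \<open>D\<close> need not be closed: the complement of the slit in the axis lacks the poles.
  Form density of the smaller core bridges the gap.\<close>

lemma unitarily_equivalent_sym_laplacian:
  assumes D: "D \<subseteq> B" "B \<subseteq> closure D"
  shows "unitarily_equivalent (l2_real_sym \<Omega>) (sym_laplacian \<Omega> D) L (restrict_op (H_A \<Omega> a b) L)"
proof -
  let ?H = "l2_real_sym \<Omega>" and ?T = "\<lambda>D. magnetic_graph (\<lambda>_. 0) (even_real_functions (\<Omega> - D))"
  have "?T B \<subseteq> ?T D"
    using D(1) test_functions_mono[of "\<Omega> - B" "\<Omega> - D"]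
    by (auto simp: magnetic_graph_def even_real_functions_def)
  then have "sym_laplacian \<Omega> D = real_friedrichs ?H (?T B)"
    unfolding sym_laplacian_eq
    by (rule real_friedrichs_form_dense[OF nonneg_op_even_real_functions _
          even_real_functions_form_dense[OF D], symmetric])
  then have "map_prod U U ` sym_laplacian \<Omega> D = real_friedrichs L (magnetic_graph A gauged_functions)"
    by (simp only: real_friedrichs_isometry[OF linear_U inner_U surj_U] U_image U_graph)
  also have "\<dots> = real_friedrichs L (magnetic_graph A fixed_functions)"
    using gauged_functions_fixed
    by (intro real_friedrichs_form_dense nonneg_op_fixed gauged_functions_form_dense)
      (auto simp: magnetic_graph_def)
  also have "\<dots> = restrict_op (H_A \<Omega> a b) L" by (rule restrict_H_A[symmetric])
  finally have graph: "map_prod U U ` sym_laplacian \<Omega> D = restrict_op (H_A \<Omega> a b) L" .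
  have "norm (U u) = norm u" for u by (simp add: norm_eq_sqrt_inner inner_U)
  then show ?thesis
    unfolding unitarily_equivalent_def
    using graph U_image linear_add[OF linear_U] linear_scale[OF linear_U] by (intro exI[of _ U]) simp
qed

end

theorem proposition3p9:
  fixes \<Omega> :: "plane set" and a b :: real and \<psi> :: "plane \<Rightarrow> complex"
  assumes "open \<Omega>" and "bounded \<Omega>" and "connected \<Omega>" and "reflect ` \<Omega> = \<Omega>"
    and "a < b"
    and "gauge_function a b \<psi>"
  shows "unitarily_equivalent (l2_real_sym \<Omega>) (H_NDN \<Omega> a b)
           (l2_K_Sigma \<Omega> \<psi>) (H_A_Sigma \<Omega> a b \<psi>) \<and>
         unitarily_equivalent (l2_real_sym \<Omega>) (H_DND \<Omega> a b)
           (l2_K_aSigma \<Omega> \<psi>) (H_A_aSigma \<Omega> a b \<psi>)"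
proof
  interpret gauge a b \<psi> by unfold_locales (use assms in auto)
  interpret N: symmetric_domain a b \<psi> 1 1 \<Omega> by unfold_locales (use assms in auto)
  \<comment> \<open>For the sign -1 the choice \<open>\<kappa> = i\<close> is right: its square is
    -1 and its conjugate is \<open>- i\<close>.\<close>
  interpret D: symmetric_domain a b \<psi> "- 1" \<i> \<Omega> by unfold_locales (use assms in auto)
  \<comment> \<open>The poles are split off because \<open>gauge_function_values\<close> determines
    \<psi> only away from them.\<close>
  have cut: "branch_cut a b s \<psi> = {(a, 0), (b, 0)} \<union> {x. x \<notin> {(a, 0), (b, 0)} \<and> \<psi> x = - of_real s}" for s
    by (auto simp: branch_cut_def)
  have "branch_cut a b 1 \<psi> = {(a, 0), (b, 0)} \<union> {x. x \<notin> {(a, 0), (b, 0)} \<and> snd x = 0 \<and> a < fst x \<and> fst x < b}"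
    unfolding cut using gauge_function_values(1) by (intro arg_cong2[of _ _ _ _ "(\<union>)"] Collect_cong) auto
  also have "\<dots> = slit a b"
    using assms(5) by (auto simp: slit_def)
  finally have N: "branch_cut a b 1 \<psi> = slit a b" .
  show "unitarily_equivalent (l2_real_sym \<Omega>) (H_NDN \<Omega> a b) (l2_K_Sigma \<Omega> \<psi>) (H_A_Sigma \<Omega> a b \<psi>)"
    using N.unitarily_equivalent_sym_laplacian[of "slit a b"] closure_subset[of "slit a b"]
    by (simp add: N H_NDN_def H_A_Sigma_def l2_K_Sigma_def)
  have "branch_cut a b (- 1) \<psi> = {(a, 0), (b, 0)} \<union> {x. x \<notin> {(a, 0), (b, 0)} \<and> snd x = 0 \<and> (fst x < a \<or> b < fst x)}"
    unfolding cut using gauge_function_values(2) by (intro arg_cong2[of _ _ _ _ "(\<union>)"] Collect_cong) auto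
  also have "\<dots> = {..a} \<times> {0} \<union> {b..} \<times> {0}"
    using assms(5) by auto
  \<comment> \<open>The poles are the endpoints that closing the two open half-lines adds.\<close>
  also have "\<dots> = closure ({..<a} \<times> {0} \<union> {b<..} \<times> {0})"
    by (simp add: closure_Times)
  also have "{..<a} \<times> {0} \<union> {b<..} \<times> {0} = real_axis - slit a b"
    by (auto simp: real_axis_def slit_def)
  finally have D: "branch_cut a b (- 1) \<psi> = closure (real_axis - slit a b)" .
  show "unitarily_equivalent (l2_real_sym \<Omega>) (H_DND \<Omega> a b) (l2_K_aSigma \<Omega> \<psi>) (H_A_aSigma \<Omega> a b \<psi>)"
    using D.unitarily_equivalent_sym_laplacian[of "real_axis - slit a b"] closure_subset[of "real_axis - slit a b"]
    by (simp add: D H_DND_def H_A_aSigma_def l2_K_aSigma_def)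
qed

end
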